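(* Let $\mathcal M$ be a finite, finally connected, finally aperiodic Markov chain with two output functions $k_1,k_2\colon\mathcal E\to\mathbb R$ and output sums $K_n^{(1)},K_n^{(2)}$. Then for $i=1,2$, $K_n^{(i)}$ has expected value $e_in+\mathcal O(1)$ and variance $v_in+\mathcal O(1)$, where $$e_i=\frac{k_i(\mathcal D_1)}{\mathbb{1}(\mathcal D_1)},\qquad v_i=\frac{1}{\mathbb{1}(\mathcal D_1)}\Big((k_i-e_i\mathbb{1},k_i-e_i\mathbb{1})(\mathcal D_1)-(k_i-e_i\mathbb{1},k_i-e_i\mathbb{1})(\mathcal D_2)\Big).$$ The covariance of $K_n^{(1)}$ and $K_n^{(2)}$ is $cn+\mathcal O(1)$ with $$c=\frac{1}{\mathbb{1}(\mathcal D_1)}\Big((k_1-e_1\mathbb{1},k_2-e_2\mathbb{1})(\mathcal D_1)-(k_1-e_1\mathbb{1},k_2-e_2\mathbb{1})(\mathcal D_2)\Big).$$ The random variables $K_n^{(1)}$ and $K_n^{(2)}$ are asymptotically independent if and only if $$(k_1-e_1\mathbb{1},k_2-e_2\mathbb{1})(\mathcal D_1)=(k_1-e_1\mathbb{1},k_2-e_2\mathbb{1})(\mathcal D_2).$$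
   Context: A finite Markov chain here consists of a finite state space $\{1,\dots,M\}$, a finite set $\mathcal E$ of transitions between states (multiple transitions and loops allowed), each transition $e$ having probability $p_e>0$ such that for every state the probabilities of its outgoing transitions sum to $1$, and a unique initial state $1$ from which all states are accessible. The chain is finally connected if the condensation of its underlying digraph has exactly one vertex of out-degree $0$; the corresponding strongly connected component is the final component. It is finally aperiodic if the gcd of the cycle lengths of the final component is $1$. $X_n$ is a random path of length $n$ from state $1$, a path $P$ having probability $\prod_{e\in P}p_e$. The output sum $K_n^{(i)}$ is the sum of $k_i(e)$ over the transitions $e$ of $X_n$. $\mathbb{1}$ is the constant function $\mathbb{1}(e)=1$. For a subgraph $D$, $p_D=\prod_{e\in D}p_e$; for a cycle $C$ and $g\colon\mathcal E\to\mathbb R$, $g(C)=\sum_{e\in C}g(e)$. A functional digraph is a digraph in which every vertex has out-degree $1$ (each component consists of one directed cycle with trees rooted on it); $\mathcal C_D$ is the set of cycles of a functional digraph $D$. $\mathcal D_1$ and $\mathcal D_2$ are the sets of spanning subgraphs of the final component that are functional digraphs with exactly one and exactly two components, respectively. For $g,h\colon\mathcal E\to\mathbb R$: $g(\mathcal D_1)=\sum_{D\in\mathcal D_1}p_D\sum_{C\in\mathcal C_D}g(C)$, $(g,h)(\mathcal D_1)=\sum_{D\in\mathcal D_1}p_D\sum_{C\in\mathcal C_D}g(C)h(C)$, $(g,h)(\mathcal D_2)=\sum_{D\in\mathcal D_2}p_D\sum_{C_1\in\mathcal C_D}\sum_{C_2\in\mathcal C_D,\,C_2\neq C_1}g(C_1)h(C_2)$.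 *)

theory Defs
  imports
    "HOL-Probability.Probability"
    "HOL-Library.Landau_Symbols"
    "Graph_Theory.Digraph_Component"
begin

locale finite_markov_chain = fin_digraph G
  for G :: "(nat, 'e) pre_digraph" +
  fixes M :: nat and p :: "'e \<Rightarrow> real"
  assumes states: "verts G = {1..M}"
    and initial: "1 \<in> verts G"
    and p_pos: "\<And>e. e \<in> arcs G \<Longrightarrow> 0 < p e"
    and p_sum: "\<And>v. v \<in> verts G \<Longrightarrow> (\<Sum>e\<in>out_arcs G v. p e) = 1"
    and accessible: "\<And>v. v \<in> verts G \<Longrightarrow> 1 \<rightarrow>\<^sup>*\<^bsub>G\<^esub> v"

definition condensation :: "('a, 'e) pre_digraph \<Rightarrow> ('a set, 'a set \<times> 'a set) pre_digraph" where
  "condensation G =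
    \<lparr> verts = pre_digraph.sccs_verts G,
      arcs = {(S, T). S \<in> pre_digraph.sccs_verts G \<and> T \<in> pre_digraph.sccs_verts G \<and> S \<noteq> T \<and>
                (\<exists>e\<in>arcs G. tail G e \<in> S \<and> head G e \<in> T)},
      tail = fst, head = snd \<rparr>"

definition finally_connected :: "('a, 'e) pre_digraph \<Rightarrow> bool" where
  "finally_connected G \<longleftrightarrow>
    (\<exists>!S. S \<in> verts (condensation G) \<and> out_degree (condensation G) S = 0)"

text \<open>The following is meaningful only if \<open>G\<close> is finally connected.\<close>

definition final_component :: "('a, 'e) pre_digraph \<Rightarrow> ('a, 'e) pre_digraph" where
  "final_component G =
    induce_subgraph G (THE S. S \<in> verts (condensation G) \<and> out_degree (condensation G) S = 0)"

definition finally_aperiodic :: "('a, 'e) pre_digraph \<Rightarrow> bool" where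
  "finally_aperiodic G \<longleftrightarrow> Gcd {length w | w. pre_digraph.cycle (final_component G) w} = 1"

text \<open>Paths are lists of arcs, so parallel arcs give different paths.\<close>

definition path_measure :: "(nat, 'e) pre_digraph \<Rightarrow> ('e \<Rightarrow> real) \<Rightarrow> nat \<Rightarrow> 'e list measure" where
  "path_measure G p n =
    point_measure {w. length w = n \<and> (\<exists>v. pre_digraph.awalk G 1 w v)}
      (\<lambda>w. ennreal (\<Prod>e\<leftarrow>w. p e))"

definition output_sum :: "('e \<Rightarrow> real) \<Rightarrow> 'e list \<Rightarrow> real" where
  "output_sum k w = (\<Sum>e\<leftarrow>w. k e)"

definition covariance :: "'a measure \<Rightarrow> ('a \<Rightarrow> real) \<Rightarrow> ('a \<Rightarrow> real) \<Rightarrow> real" where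
  "covariance P X Y =
    prob_space.expectation P
      (\<lambda>\<omega>. (X \<omega> - prob_space.expectation P X) * (Y \<omega> - prob_space.expectation P Y))"

definition functional_digraph :: "('a, 'e) pre_digraph \<Rightarrow> bool" where
  "functional_digraph D \<longleftrightarrow> fin_digraph D \<and> (\<forall>v\<in>verts D. out_degree D v = 1)"

text \<open>Weakly connected components; \<open>Digraph_Component.connected\<close> is connectedness of the
  underlying undirected graph.\<close>

definition components :: "('a, 'e) pre_digraph \<Rightarrow> ('a, 'e) pre_digraph set" where
  "components D = {H. pre_digraph.max_subgraph D Digraph_Component.connected H}"

text \<open>A cycle is identified with its set of arcs, so that the rotations of a closed arc list
  count as one cycle.\<close>

definition cycles :: "('a, 'e) pre_digraph \<Rightarrow> 'e set set" where
  "cycles D = {set w | w. pre_digraph.cycle D w}"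

definition functional_spanning :: "nat \<Rightarrow> ('a, 'e) pre_digraph \<Rightarrow> ('a, 'e) pre_digraph set" where
  "functional_spanning m F =
    {D. spanning D F \<and> functional_digraph D \<and> card (components D) = m}"

definition D1_sum :: "('a, 'e) pre_digraph \<Rightarrow> ('e \<Rightarrow> real) \<Rightarrow> ('e \<Rightarrow> real) \<Rightarrow> real" where
  "D1_sum F p g =
    (\<Sum>D\<in>functional_spanning 1 F. (\<Prod>e\<in>arcs D. p e) * (\<Sum>C\<in>cycles D. \<Sum>e\<in>C. g e))"

definition D1_pair ::
  "('a, 'e) pre_digraph \<Rightarrow> ('e \<Rightarrow> real) \<Rightarrow> ('e \<Rightarrow> real) \<Rightarrow> ('e \<Rightarrow> real) \<Rightarrow> real" where
  "D1_pair F p g h =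
    (\<Sum>D\<in>functional_spanning 1 F. (\<Prod>e\<in>arcs D. p e) *
      (\<Sum>C\<in>cycles D. (\<Sum>e\<in>C. g e) * (\<Sum>e\<in>C. h e)))"

definition D2_pair ::
  "('a, 'e) pre_digraph \<Rightarrow> ('e \<Rightarrow> real) \<Rightarrow> ('e \<Rightarrow> real) \<Rightarrow> ('e \<Rightarrow> real) \<Rightarrow> real" where
  "D2_pair F p g h =
    (\<Sum>D\<in>functional_spanning 2 F. (\<Prod>e\<in>arcs D. p e) *
      (\<Sum>C1\<in>cycles D. \<Sum>C2\<in>cycles D - {C1}. (\<Sum>e\<in>C1. g e) * (\<Sum>e\<in>C2. h e)))"

definition weak_conv_2d :: "(nat \<Rightarrow> (real \<times> real) measure) \<Rightarrow> (real \<times> real) measure \<Rightarrow> bool" where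
  "weak_conv_2d N L \<longleftrightarrow>
    (\<forall>f :: real \<times> real \<Rightarrow> real. continuous_on UNIV f \<and> bounded (range f) \<longrightarrow>
      (\<lambda>n. integral\<^sup>L (N n) f) \<longlonglongrightarrow> integral\<^sup>L L f)"

text \<open>The random variables, centred at their means and rescaled by \<open>sqrt n\<close>, converge jointly in
  distribution to a pair of independent random variables, i.e. to a product measure. The scale is
  \<open>sqrt n\<close> and not the standard deviation because the variances may be bounded; the corresponding
  factor of the limit is then a Dirac measure.\<close>

definition asymptotically_independent ::
  "(nat \<Rightarrow> 'a measure) \<Rightarrow> (nat \<Rightarrow> 'a \<Rightarrow> real) \<Rightarrow> (nat \<Rightarrow> 'a \<Rightarrow> real) \<Rightarrow> bool" where
  "asymptotically_independent P X Y \<longleftrightarrow>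
    (\<exists>\<mu> \<nu>. real_distribution \<mu> \<and> real_distribution \<nu> \<and>
      weak_conv_2d
        (\<lambda>n. distr (P n) borel
          (\<lambda>\<omega>. ((X n \<omega> - prob_space.expectation (P n) (X n)) / sqrt (real n),
                (Y n \<omega> - prob_space.expectation (P n) (Y n)) / sqrt (real n))))
        (\<mu> \<Otimes>\<^sub>M \<nu>))"

end

theory Submission
  imports Defs
begin

text \<open>
  For every output function \<open>k\<close> the Poisson equation has a solution: there is a potential \<open>h\<close> on the
  states such that \<open>k\<close> plus the coboundary of \<open>h\<close> has the same conditional mean \<open>e\<close> in every state.
  Subtracting \<open>e\<close> makes the output sum a martingale up to a bounded error, so that covariances,
  and by a first-step recursion also the joint characteristic function, are governed by
  the mean of the product of two corrected outputs.

  A coboundary does not change cycle sums, so the functionals on \<open>\<D>\<^sub>1\<close> and \<open>\<D>\<^sub>2\<close> may be evaluated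
  on the corrected outputs. A functional digraph is a choice of one outgoing arc per
  vertex; resampling the arcs chosen at two fixed vertices \<open>u \<noteq> v\<close>, whose corrected outputs average
  to zero, shows that the terms with \<open>u\<close> and \<open>v\<close> on a common cycle cancel against those with \<open>u\<close>
  and \<open>v\<close> on two different cycles. What is left is the diagonal, i.e. the mean of the product.

  The limit law of the rescaled pair is Gaussian with this covariance matrix, and a Gaussian law is
  a product measure exactly if its covariance vanishes.
\<close>

section \<open>Iterating a self-map\<close>

text \<open>No stationary distribution is constructed. Drawing the outgoing arc of each vertex
  independently turns the weights of spanning functional digraphs into probabilities, and the event
  that \<open>u\<close> lies on the only cycle does not depend on the arc drawn at \<open>u\<close>.
  Averaging over these random digraphs takes the place of averaging over the stationary law.

  The chain may start outside the final component, whereas the sums see only that component. The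
  Poisson equation is therefore solved on all states, by summing differences of iterates of the
  transition operator. Aperiodicity enters here, as geometric decay of the oscillation. The same
  decay is needed a second time: a bounded end term correlated with a martingale of size
  \<open>sqrt n\<close> could spoil the error O(1) of the covariance.

  Variances may vanish, so the limit theorem cannot normalise by them. The characteristic function
  is followed along its recursion with explicit errors at scale \<open>sqrt n\<close>, and the
  uniformly bounded second moments control the tails in the plane.\<close>

definition reaches :: "('a \<Rightarrow> 'a) \<Rightarrow> 'a \<Rightarrow> 'a \<Rightarrow> bool" where
  "reaches s x y \<longleftrightarrow> (\<exists>n. (s ^^ n) x = y)"

text \<open>In a functional graph this is weak connectedness: a step in either direction can be
  pushed forward until both ends have a common iterate.\<close>

definition merges :: "('a \<Rightarrow> 'a) \<Rightarrow> 'a \<Rightarrow> 'a \<Rightarrow> bool" where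
  "merges s x y \<longleftrightarrow> (\<exists>z. reaches s x z \<and> reaches s y z)"

text \<open>Starting at \<open>s x\<close> enforces at least one step; \<open>reaches s x x\<close>
  holds for every point.\<close>

definition periodic :: "('a \<Rightarrow> 'a) \<Rightarrow> 'a \<Rightarrow> bool" where
  "periodic s x \<longleftrightarrow> reaches s (s x) x"

lemma reaches_refl [simp]: "reaches s x x"
  unfolding reaches_def by (rule exI[of _ 0]) simp

lemma reaches_trans: "reaches s x y \<Longrightarrow> reaches s y z \<Longrightarrow> reaches s x z"
  unfolding reaches_def by (metis comp_apply funpow_add)

lemma reaches_step [simp]: "reaches s x (s x)"
  unfolding reaches_def by (rule exI[of _ 1]) simp

lemma reaches_Cons: "reaches s (s x) y \<Longrightarrow> reaches s x y"
  using reaches_trans reaches_step by metis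

lemma reaches_cases: "reaches s x y \<Longrightarrow> x = y \<or> reaches s (s x) y"
proof -
  assume "reaches s x y"
  then obtain n where n: "(s ^^ n) x = y" unfolding reaches_def by auto
  show ?thesis
  proof (cases n)
    case 0 then show ?thesis using n by simp
  next
    case (Suc m)
    then have "(s ^^ m) (s x) = y" using n by (simp add: funpow_swap1)
    then show ?thesis unfolding reaches_def by blast
  qed
qed

lemma reaches_linear:
  assumes "reaches s x y" "reaches s x z"
  shows "reaches s y z \<or> reaches s z y"
proof -
  obtain m n where m: "(s ^^ m) x = y" and n: "(s ^^ n) x = z"
    using assms unfolding reaches_def by auto
  show ?thesis
  proof (cases "m \<le> n")
    case True
    then have "(s ^^ (n - m)) y = z"
      using m n by (metis comp_apply funpow_add le_add_diff_inverse2)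
    then show ?thesis unfolding reaches_def by blast
  next
    case False
    then have "(s ^^ (m - n)) z = y"
      using m n by (metis comp_apply funpow_add le_add_diff_inverse2 nat_le_linear)
    then show ?thesis unfolding reaches_def by blast
  qed
qed

lemma reaches_closed:
  assumes "reaches s x y" "x \<in> A" "\<And>x. x \<in> A \<Longrightarrow> s x \<in> A"
  shows "y \<in> A"
proof -
  have "(s ^^ n) x \<in> A" for n by (induction n) (use assms in auto)
  then show ?thesis using assms(1) unfolding reaches_def by auto
qed

lemma merges_refl [simp]: "merges s x x"
  unfolding merges_def using reaches_refl by metis

lemma merges_sym: "merges s x y \<Longrightarrow> merges s y x"
  unfolding merges_def by auto

text \<open>The orbit of the middle point is linearly ordered by reachability, so one of its two
  meeting points reaches the other.\<close>

lemma merges_trans: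
  assumes "merges s x y" "merges s y z"
  shows "merges s x z"
proof -
  obtain a b where "reaches s x a" "reaches s y a" "reaches s y b" "reaches s z b"
    using assms unfolding merges_def by auto
  then show ?thesis unfolding merges_def using reaches_linear reaches_trans by metis
qed

lemma reaches_imp_merges: "reaches s x y \<Longrightarrow> merges s x y"
  unfolding merges_def using reaches_refl by metis

lemma periodic_reaches_back:
  assumes "periodic s y" "reaches s y z"
  shows "reaches s z y"
proof -
  have "reaches s ((s ^^ n) y) y" for n
  proof (induction n)
    case (Suc n)
    then show ?case using reaches_cases[OF Suc] assms(1) unfolding periodic_def by auto
  qed simp
  then show ?thesis using assms(2) unfolding reaches_def[of s y z] by auto
qed

text \<open>The orbit of a periodic point never leaves its cycle, so any common iterate can be
  continued back to \<open>y\<close>.\<close>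

lemma merges_periodic_iff:
  assumes "periodic s y"
  shows "merges s x y \<longleftrightarrow> reaches s x y"
  using assms periodic_reaches_back reaches_trans reaches_imp_merges unfolding merges_def
  by metis

lemma periodic_of_reaches:
  assumes "periodic s x" "reaches s x y"
  shows "periodic s y"
  using assms unfolding periodic_def
  by (metis periodic_def periodic_reaches_back reaches_cases reaches_step reaches_trans)

lemma ex_periodic:
  assumes "finite S" "x \<in> S" "\<And>x. x \<in> S \<Longrightarrow> s x \<in> S"
  shows "\<exists>y. reaches s x y \<and> periodic s y"
proof -
  have "range (\<lambda>n. (s ^^ n) x) \<subseteq> S"
  proof
    fix y assume "y \<in> range (\<lambda>n. (s ^^ n) x)"
    then have "reaches s x y" unfolding reaches_def by auto
    then show "y \<in> S" using reaches_closed assms by metis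
  qed
  then have "\<not> inj (\<lambda>n. (s ^^ n) x)"
    using assms(1) finite_subset infinite_UNIV_nat range_inj_infinite by blast
  then obtain i j where ij: "i < j" "(s ^^ i) x = (s ^^ j) x"
    unfolding inj_def by (metis linorder_neqE_nat)
  define y where "y = (s ^^ i) x"
  obtain d where d: "j = d + Suc i" using ij(1) by (metis less_iff_Suc_add add_Suc_right add.commute)
  have "(s ^^ d) (s y) = y"
    using ij(2) unfolding y_def d by (simp only: funpow_add comp_apply funpow.simps(2))
  then have "periodic s y" unfolding periodic_def reaches_def by blast
  moreover have "reaches s x y" unfolding reaches_def y_def by blast
  ultimately show ?thesis by blast
qed

text \<open>Points of \<open>A\<close> become fixed. Statements about the stopped map are blind to
  the values of \<open>s\<close> on \<open>A\<close>, which allows the arcs chosen there to be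
  resampled.\<close>

definition absorb :: "'a set \<Rightarrow> ('a \<Rightarrow> 'a) \<Rightarrow> 'a \<Rightarrow> 'a" where
  "absorb A s x = (if x \<in> A then x else s x)"

lemma absorb_cong: "(\<And>x. x \<notin> A \<Longrightarrow> s x = t x) \<Longrightarrow> absorb A s = absorb A t"
  unfolding absorb_def by auto

lemma reaches_absorb_imp_reaches: "reaches (absorb A s) x y \<Longrightarrow> reaches s x y"
proof -
  have "reaches s x ((absorb A s ^^ n) x)" for n
  proof (induction n)
    case (Suc n)
    have "reaches s z (absorb A s z)" for z unfolding absorb_def by simp
    then show ?case using Suc reaches_trans by (metis comp_apply funpow.simps(2))
  qed simp
  then show "reaches (absorb A s) x y \<Longrightarrow> reaches s x y"
    unfolding reaches_def[of "absorb A s"] by auto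
qed

lemma reaches_imp_ex_reaches_absorb:
  assumes "reaches s x u" "u \<in> A"
  shows "\<exists>a\<in>A. reaches (absorb A s) x a"
proof -
  have "(s ^^ n) x = u \<Longrightarrow> \<exists>a\<in>A. reaches (absorb A s) x a" for n
  proof (induction n arbitrary: x)
    case 0
    then show ?case using assms(2) reaches_refl by (metis funpow_0)
  next
    case (Suc n)
    show ?case
    proof (cases "x \<in> A")
      case False
      then have "absorb A s x = s x" by (simp add: absorb_def)
      moreover have "\<exists>a\<in>A. reaches (absorb A s) (s x) a"
        using Suc by (simp add: funpow_swap1)
      ultimately show ?thesis using reaches_Cons by metis
    qed (use reaches_refl in metis)
  qed
  then show ?thesis using assms(1) unfolding reaches_def[of s] by blast
qed

lemma reaches_absorb_fixed:
  assumes "reaches (absorb A s) a b" "a \<in> A"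
  shows "b = a"
  using reaches_closed[OF assms(1), of "{a}"] assms(2) by (simp add: absorb_def)

lemma reaches_absorb_unique:
  assumes "reaches (absorb A s) x a" "reaches (absorb A s) x b" "a \<in> A" "b \<in> A"
  shows "a = b"
  using reaches_linear[OF assms(1,2)] reaches_absorb_fixed assms(3,4) by metis

text \<open>For a closed finite \<open>S\<close> containing both points: there is a single
  component, and \<open>u\<close> and \<open>v\<close> lie on its cycle; see
  \<open>card_cls_1_iff\<close>.\<close>

definition same_cycle :: "'a set \<Rightarrow> ('a \<Rightarrow> 'a) \<Rightarrow> 'a \<Rightarrow> 'a \<Rightarrow> bool" where
  "same_cycle S s u v \<longleftrightarrow> (\<forall>x\<in>S. reaches s x u) \<and> (\<forall>x\<in>S. reaches s x v)"

text \<open>There are two components, with \<open>u\<close> on the cycle of one and \<open>v\<close>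
  on the cycle of the other; see \<open>card_cls_2_iff\<close>.\<close>

definition two_cycles :: "'a set \<Rightarrow> ('a \<Rightarrow> 'a) \<Rightarrow> 'a \<Rightarrow> 'a \<Rightarrow> bool" where
  "two_cycles S s u v \<longleftrightarrow> periodic s u \<and> periodic s v \<and> \<not> reaches s u v \<and> \<not> reaches s v u \<and>
     (\<forall>x\<in>S. reaches s x u \<or> reaches s x v)"

text \<open>In the stopped form the condition visibly does not depend on \<open>s u\<close>.\<close>

lemma same_cycle_refl_absorb:
  assumes "u \<in> S"
  shows "same_cycle S s u u \<longleftrightarrow> (\<forall>x\<in>S. reaches (absorb {u} s) x u)"
  unfolding same_cycle_def
  using reaches_absorb_imp_reaches reaches_imp_ex_reaches_absorb by fast

lemma not_two_cycles_refl: "\<not> two_cycles S s u u"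
  unfolding two_cycles_def by simp

text \<open>Stop the map at \<open>u\<close> and \<open>v\<close>. If every point gets stopped, the
  outcome depends only on where \<open>s u\<close> and \<open>s v\<close> end: crosswise gives one
  common cycle, value 1; each back at its own start gives two cycles, value -1; the mixed cases give
  0. The last factor is additive, so each of its summands involves at most one of the two
  successors. This is what resampling exploits.\<close>

lemma of_bool_same_cycle_minus_two_cycles:
  fixes s :: "'a \<Rightarrow> 'a"
  assumes "u \<in> S" "v \<in> S" "u \<noteq> v" and closed: "\<And>x. x \<in> S \<Longrightarrow> s x \<in> S"
  defines "r \<equiv> reaches (absorb {u, v} s)"
  shows "(of_bool (same_cycle S s u v) - of_bool (two_cycles S s u v) :: real) =
    of_bool (\<forall>x\<in>S. r x u \<or> r x v) * (of_bool (r (s u) v) + of_bool (r (s v) u) - 1)"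
proof -
  let ?A = "{u, v}"
  have imp: "reaches s x y" if "r x y" for x y
    using that reaches_absorb_imp_reaches unfolding r_def by metis
  have ex: "r x u \<or> r x v" if "reaches s x u \<or> reaches s x v" for x
    using that reaches_imp_ex_reaches_absorb[of s x _ ?A] unfolding r_def by blast
  have excl: "\<not> (r x u \<and> r x v)" for x
    using reaches_absorb_unique[of ?A s x u v] assms(3) unfolding r_def by blast
  have rr: "r u u" "r v v" unfolding r_def by simp_all
  have rstep: "r (s x) y" if "r x y" "x \<notin> ?A" "y \<in> ?A" for x y
    using reaches_cases[of "absorb ?A s" x y] that unfolding r_def by (auto simp: absorb_def)
  \<comment> \<open>If \<open>s a\<close> flows back to \<open>a\<close>, the points stopped at
    \<open>a\<close> form a set that is invariant under the unstopped map and misses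
    \<open>b\<close>.\<close>
  have stay: "\<not> reaches s a b" if "r (s a) a" "a = u \<and> b = v \<or> a = v \<and> b = u" for a b
  proof
    assume "reaches s a b"
    then have "b \<in> {x. r x a}"
      by (rule reaches_closed) (use that rstep rr excl in auto)
    then show False using rr excl that by auto
  qed
  show ?thesis
  proof (cases "\<forall>x\<in>S. r x u \<or> r x v")
    case False
    then have "\<not> same_cycle S s u v" "\<not> two_cycles S s u v"
      using ex unfolding same_cycle_def two_cycles_def by blast+
    then show ?thesis using False by auto
  next
    case X: True
    have su: "r (s u) u \<or> r (s u) v" and sv: "r (s v) u \<or> r (s v) v"
      using X closed assms(1,2) by blast+
    consider (both) "r (s u) v" "r (s v) u" | (none) "r (s u) u" "r (s v) v"
      | (l) "r (s u) v" "r (s v) v" | (r) "r (s u) u" "r (s v) u" using su sv by blast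
    then show ?thesis
    proof cases
      case both
      have "reaches s u v" "reaches s v u" using both imp reaches_Cons by metis+
      moreover from this have "same_cycle S s u v"
        unfolding same_cycle_def using X imp reaches_trans by metis
      ultimately show ?thesis using X both unfolding two_cycles_def by auto
    next
      case none
      have "\<not> reaches s u v" "\<not> reaches s v u"
        using stay[of u v] stay[of v u] none assms(3) by auto
      moreover from this have "two_cycles S s u v"
        unfolding two_cycles_def periodic_def using none imp X by metis
      moreover have "\<not> same_cycle S s u v" using calculation assms(1) unfolding same_cycle_def by auto
      moreover have "\<not> r (s u) v" "\<not> r (s v) u" using none excl by auto
      ultimately show ?thesis using X by auto
    next
      case l
      have "\<not> reaches s v u" using stay[of v u] l assms(3) by auto
      moreover have "reaches s u v" using l imp reaches_Cons by metis
      moreover have "\<not> r (s v) u" using l excl by auto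
      ultimately show ?thesis using X l assms(2) unfolding same_cycle_def two_cycles_def by auto
    next
      case r
      have "\<not> reaches s u v" using stay[of u v] r assms(3) by auto
      moreover have "reaches s v u" using r imp reaches_Cons by metis
      moreover have "\<not> r (s u) v" using r excl by auto
      ultimately show ?thesis using X r assms(1) unfolding same_cycle_def two_cycles_def by auto
    qed
  qed
qed

section \<open>Functional digraphs\<close>

lemma sum_filter_of_bool:
  fixes \<phi> :: "'a \<Rightarrow> real"
  assumes "finite A"
  shows "(\<Sum>x\<in>{x \<in> A. Q x}. \<phi> x) = (\<Sum>x\<in>A. of_bool (Q x) * \<phi> x)"
  unfolding sum.inter_filter[OF assms] by (rule sum.cong) simp_all

text \<open>The extensional product fixes the values off the vertices, so that different choices
  give different subgraphs.\<close>

locale functional_choice = fin_digraph F for F :: "('a, 'e) pre_digraph" +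
  fixes f :: "'a \<Rightarrow> 'e"
  assumes choice: "f \<in> (\<Pi>\<^sub>E v\<in>verts F. out_arcs F v)"
begin

abbreviation (input) S where "S \<equiv> verts F"

definition s where "s = head F \<circ> f"

definition D where "D = F\<lparr>arcs := f ` S\<rparr>"

lemma D_simps [simp]: "verts D = S" "arcs D = f ` S" "tail D = tail F" "head D = head F"
  unfolding D_def by simp_all

lemma f_arc: "v \<in> S \<Longrightarrow> f v \<in> arcs F" and tail_f [simp]: "v \<in> S \<Longrightarrow> tail F (f v) = v"
  using choice by (auto simp: PiE_iff)

lemma s_closed: "v \<in> S \<Longrightarrow> s v \<in> S"
  unfolding s_def using f_arc by simp

lemma head_f: "head F (f v) = s v" unfolding s_def by simp

lemma inj_f: "inj_on f S"
  by (rule inj_on_inverseI[of _ "tail F"]) simp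

lemma wf_D: "wf_digraph D"
  by unfold_locales (auto simp: f_arc)

sublocale D: wf_digraph D by (rule wf_D)

lemma out_arcs_D: "v \<in> S \<Longrightarrow> out_arcs D v = {f v}"
  by (auto simp: out_arcs_def)

lemma D_spanning: "spanning D F"
  unfolding spanning_def using wf_D wf_digraph_axioms
  by (auto simp: subgraph_def compatible_def f_arc)

lemma D_functional: "functional_digraph D"
  unfolding functional_digraph_def
proof
  show "fin_digraph D" by unfold_locales auto
  show "\<forall>v\<in>verts D. out_degree D v = 1" by (simp add: out_degree_def out_arcs_D)
qed

section \<open>Weak components and cycles as classes of merging points\<close>

definition cls where "cls x = {y \<in> S. merges s x y}"

lemma cls_eq_iff: "x \<in> S \<Longrightarrow> y \<in> S \<Longrightarrow> cls x = cls y \<longleftrightarrow> merges s x y"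
  unfolding cls_def using merges_trans[of s] merges_sym[of s] merges_refl[of s]
  by blast

lemma in_cls: "x \<in> S \<Longrightarrow> x \<in> cls x"
  unfolding cls_def by simp

lemma cls_closed: "x \<in> cls z \<Longrightarrow> s x \<in> cls z"
  unfolding cls_def using s_closed merges_trans reaches_imp_merges reaches_step by fast

text \<open>Two points of a class flow to a common iterate; the path of the second is then traversed
  backwards in the symmetric closure.\<close>

lemma connected_restrict_cls:
  assumes "z \<in> S"
  shows "Digraph_Component.connected (D \<restriction> cls z)"
  unfolding Digraph_Component.connected_def
proof
  let ?H = "D \<restriction> cls z"
  interpret H: wf_digraph ?H by (rule D.wellformed_induce_subgraph)
  interpret M: wf_digraph "with_proj (mk_symmetric ?H)"
    using H.wellformed_mk_symmetric wf_digraph_wp_iff by blast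
  show "verts (with_proj (mk_symmetric ?H)) \<noteq> {}" using in_cls[OF assms] by auto
  have reach: "x \<rightarrow>\<^sup>*\<^bsub>?H\<^esub> (s ^^ n) x \<and> (s ^^ n) x \<in> cls z" if "x \<in> cls z" for x n
  proof (induction n)
    case 0 then show ?case using that by simp
  next
    case (Suc n)
    let ?y = "(s ^^ n) x"
    have y: "?y \<in> cls z" "?y \<in> S" using Suc unfolding cls_def by auto
    have "f ?y \<in> arcs ?H" using y cls_closed by (simp add: head_f)
    then have "?y \<rightarrow>\<^bsub>?H\<^esub> s ?y"
      using H.in_arcs_imp_in_arcs_ends[of "f ?y"] y by (simp add: head_f)
    then show ?case using Suc y cls_closed H.reachable_adj_trans by fastforce
  qed
  fix x y assume "x \<in> verts (with_proj (mk_symmetric ?H))" "y \<in> verts (with_proj (mk_symmetric ?H))"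
  then have xy: "x \<in> cls z" "y \<in> cls z" by auto
  then have "merges s x y" unfolding cls_def using merges_trans merges_sym by fast
  then obtain m n where mn: "(s ^^ m) x = (s ^^ n) y" unfolding merges_def reaches_def by metis
  have x: "x \<rightarrow>\<^sup>*\<^bsub>mk_symmetric ?H\<^esub> (s ^^ m) x"
    using reach[OF xy(1)] H.reachable_mk_symmetricI by blast
  have y: "y \<rightarrow>\<^sup>*\<^bsub>mk_symmetric ?H\<^esub> (s ^^ m) x"
    using reach[OF xy(2)] H.reachable_mk_symmetricI mn by metis
  have "(s ^^ m) x \<rightarrow>\<^sup>*\<^bsub>mk_symmetric ?H\<^esub> y"
    using y symmetric_mk_symmetric[of ?H] symmetric_reachable M.wf_digraph_axioms by metis
  then show "x \<rightarrow>\<^sup>*\<^bsub>mk_symmetric ?H\<^esub> y" using x M.reachable_trans by blast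
qed

text \<open>Every arc of \<open>D\<close> joins some \<open>v\<close> to \<open>s v\<close>, and
  these merge, so a walk in the symmetric closure stays in one class.\<close>

lemma connected_subgraph_merges:
  assumes "subgraph H D" "Digraph_Component.connected H" "x \<in> verts H" "y \<in> verts H"
  shows "merges s x y"
proof -
  have "x \<rightarrow>\<^sup>*\<^bsub>mk_symmetric H\<^esub> y"
    using assms(2-4) unfolding Digraph_Component.connected_def by auto
  then show ?thesis unfolding reachable_def
  proof (induction rule: rtrancl_on_induct)
    case base show ?case by simp
  next
    case (step y z)
    have H: "arcs H \<subseteq> f ` S" "tail H = tail F" "head H = head F"
      using assms(1) by (auto simp: subgraph_def compatible_def)
    from step(2) obtain e where e: "e \<in> arcs H"
      "(y, z) = (tail H e, head H e) \<or> (y, z) = (head H e, tail H e)"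
      by (auto simp: parcs_mk_symmetric)
    then obtain v where "v \<in> S" "e = f v" using H by auto
    then have "(y, z) = (v, s v) \<or> (y, z) = (s v, v)" using e(2) H by (simp add: head_f)
    then have "merges s y z" using reaches_imp_merges[OF reaches_step] merges_sym by fastforce
    then show ?case using step merges_trans by metis
  qed
qed

lemma components_D: "components D = (\<lambda>C. D \<restriction> C) ` cls ` S"
proof
  have mono: "H = D \<restriction> cls x"
    if "subgraph (D \<restriction> cls x) H" "subgraph H D" "Digraph_Component.connected H" "x \<in> S" for H x
  proof -
    have x: "x \<in> verts H" using that in_cls by (auto simp: subgraph_def)
    have v: "verts H = cls x"
      using that x connected_subgraph_merges[OF that(2,3) x] subgraph_imp_subverts[OF that(2)]
      by (auto simp: subgraph_def cls_def)
    interpret H: wf_digraph H using that by auto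
    have "arcs H = arcs (D \<restriction> cls x)"
      using that(1,2) v H.tail_in_verts H.head_in_verts
      by (auto simp: subgraph_def compatible_def)
    then show ?thesis using v that(2)
      by (intro pre_digraph.equality) (auto simp: subgraph_def compatible_def)
  qed
  have sub: "subgraph (D \<restriction> cls x) D" for x
    by (rule D.subgraph_induce_subgraphI) (auto simp: cls_def)
  show "(\<lambda>C. D \<restriction> C) ` cls ` S \<subseteq> components D"
  proof clarify
    fix x assume x: "x \<in> S"
    show "D \<restriction> cls x \<in> components D"
      unfolding components_def D.max_subgraph_def mem_Collect_eq
      using sub[of x] connected_restrict_cls[OF x] mono[OF _ _ _ x] by metis
  qed
  show "components D \<subseteq> (\<lambda>C. D \<restriction> C) ` cls ` S"
  proof
    fix H assume "H \<in> components D"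
    then have H: "subgraph H D" "Digraph_Component.connected H"
      and max: "\<And>H'. H' \<noteq> H \<Longrightarrow> subgraph H H' \<Longrightarrow> \<not> (subgraph H' D \<and> Digraph_Component.connected H')"
      unfolding components_def D.max_subgraph_def by auto
    have "verts H \<noteq> {}" using H(2) unfolding Digraph_Component.connected_def strongly_connected_def by auto
    then obtain x where x: "x \<in> verts H" by auto
    then have xS: "x \<in> S" using H(1) by (auto simp: subgraph_def)
    have v: "verts H \<subseteq> cls x"
      using connected_subgraph_merges[OF H x] subgraph_imp_subverts[OF H(1)] by (auto simp: cls_def)
    interpret H: wf_digraph H using H by auto
    have "subgraph H (D \<restriction> cls x)"
      using H(1) v H.tail_in_verts H.head_in_verts D.wellformed_induce_subgraph[of "cls x"]
      by (auto simp: subgraph_def compatible_def)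
    then have "D \<restriction> cls x = H" using max sub connected_restrict_cls[OF xS] by blast
    then show "H \<in> (\<lambda>C. D \<restriction> C) ` cls ` S" using xS by auto
  qed
qed

lemma card_components_D: "card (components D) = card (cls ` S)"
proof -
  have "inj_on (\<lambda>C. D \<restriction> C) (cls ` S)"
    by (rule inj_on_inverseI[of _ verts]) simp
  then show ?thesis unfolding components_D by (rule card_image)
qed

text \<open>For a class \<open>C\<close> these are the vertices of its cycle.\<close>

definition per where "per C = {y \<in> C. periodic s y}"

lemma awalk_D_iterate:
  assumes "D.awalk x w y"
  shows "w = map (\<lambda>i. f ((s ^^ i) x)) [0..<length w] \<and> y = (s ^^ length w) x"
  using assms
proof (induction w arbitrary: x)
  case Nil then show ?case by (simp add: D.awalk_Nil_iff)
next
  case (Cons e w)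
  have e: "e = f x" "x \<in> S" and w: "D.awalk (s x) w y"
    using Cons.prems by (auto simp: D.awalk_Cons_iff head_f)
  note IH = Cons.IH[OF w]
  have "e # w = map (\<lambda>i. f ((s ^^ i) x)) (0 # map Suc [0..<length w])"
    using e IH by (simp add: comp_def funpow_swap1)
  also have "0 # map Suc [0..<length w] = [0..<length (e # w)]"
    using upt_conv_Cons[of 0 "Suc (length w)"] by (simp add: map_Suc_upt del: upt_Suc)
  finally show ?case using IH by (simp add: funpow_swap1)
qed

lemma iterate_awalk_D:
  assumes "x \<in> S"
  shows "D.awalk x (map (\<lambda>i. f ((s ^^ i) x)) [0..<n]) ((s ^^ n) x)"
proof (induction n)
  case 0 then show ?case using assms by (simp add: D.awalk_Nil_iff)
next
  case (Suc n)
  let ?y = "(s ^^ n) x"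
  have "?y \<in> S" using D.awalk_last_in_verts[OF Suc] by simp
  then have "D.awalk ?y [f ?y] (s ?y)" by (simp add: D.awalk_simps head_f s_closed)
  then have "D.awalk x (map (\<lambda>i. f ((s ^^ i) x)) [0..<n] @ [f ?y]) (s ?y)"
    using Suc D.awalk_appendI by blast
  then show ?case by simp
qed

lemma orbit_eq_per:
  assumes "x \<in> S" "(s ^^ n) x = x" "n > 0"
  shows "(\<lambda>i. (s ^^ i) x) ` {..<n} = per (cls x)"
proof -
  have "(s ^^ (n - 1)) (s x) = x" using assms(2,3)
    by (metis Suc_diff_1 comp_apply funpow_Suc_right)
  then have p: "periodic s x" unfolding periodic_def reaches_def by blast
  have "y \<in> (\<lambda>i. (s ^^ i) x) ` {..<n}" if "y \<in> per (cls x)" for y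
  proof -
    have "reaches s x y" using that merges_periodic_iff unfolding per_def cls_def by fast
    then obtain m where "(s ^^ m) x = y" unfolding reaches_def by auto
    then have "(s ^^ (m mod n)) x = y" using funpow_mod_eq[OF assms(2)] by metis
    then show ?thesis using assms(3) by auto
  qed
  moreover have "(s ^^ i) x \<in> per (cls x)" for i
  proof -
    have r: "reaches s x ((s ^^ i) x)" unfolding reaches_def by blast
    then have "(s ^^ i) x \<in> S" using reaches_closed s_closed assms(1) by metis
    then show ?thesis unfolding per_def cls_def
      using r p periodic_of_reaches reaches_imp_merges by fast
  qed
  ultimately show ?thesis by blast
qed

lemma cycles_D: "cycles D = (\<lambda>C. f ` per C) ` cls ` S"
proof
  show "cycles D \<subseteq> (\<lambda>C. f ` per C) ` cls ` S"
  proof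
    fix c assume "c \<in> cycles D"
    then obtain w x where w: "c = set w" "D.awalk x w x" "w \<noteq> []"
      unfolding cycles_def D.cycle_def by auto
    have x: "x \<in> S" using D.awalk_hd_in_verts[OF w(2)] by simp
    have it: "w = map (\<lambda>i. f ((s ^^ i) x)) [0..<length w]" "(s ^^ length w) x = x"
      using awalk_D_iterate[OF w(2)] by auto
    have "set w = f ` (\<lambda>i. (s ^^ i) x) ` {..<length w}"
      by (subst it(1)) (auto simp: image_image atLeast0LessThan)
    then have "c = f ` per (cls x)" using orbit_eq_per[OF x it(2)] w by simp
    then show "c \<in> (\<lambda>C. f ` per C) ` cls ` S" using x by auto
  qed
  show "(\<lambda>C. f ` per C) ` cls ` S \<subseteq> cycles D"
  proof clarify
    fix z assume z: "z \<in> S"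
    obtain x where x: "reaches s z x" "periodic s x"
      using ex_periodic[of S z s, OF finite_verts z s_closed] by auto
    have xS: "x \<in> S" by (rule reaches_closed[OF x(1), of S]) (use z s_closed in auto)
    have zx: "cls z = cls x" using cls_eq_iff[OF z xS] reaches_imp_merges[OF x(1)] by simp
    \<comment> \<open>The least period, so that the closed walk repeats no vertex, as
      \<open>cycle\<close> requires.\<close>
    define n where "n = (LEAST n. n > 0 \<and> (s ^^ n) x = x)"
    have "\<exists>n. n > 0 \<and> (s ^^ n) x = x"
    proof -
      obtain m where "(s ^^ m) (s x) = x" using x(2) unfolding periodic_def reaches_def by auto
      then have "(s ^^ Suc m) x = x" by (simp add: funpow_swap1)
      then show ?thesis by blast
    qed
    then have n: "n > 0" "(s ^^ n) x = x" unfolding n_def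
      by (metis (mono_tags, lifting) LeastI_ex)+
    have min: "(s ^^ m) x \<noteq> x" if "0 < m" "m < n" for m
      using not_less_Least[of m] that unfolding n_def by blast
    let ?w = "map (\<lambda>i. f ((s ^^ i) x)) [0..<n]"
    have w: "D.awalk x ?w x" using iterate_awalk_D[OF xS, of n] n by simp
    have inj: "inj_on (\<lambda>i. (s ^^ i) x) {0..<n}"
    proof (rule linorder_inj_onI')
      fix i j assume ij: "i \<in> {0..<n}" "j \<in> {0..<n}" "i < j"
      show "(s ^^ i) x \<noteq> (s ^^ j) x"
      proof
        assume "(s ^^ i) x = (s ^^ j) x"
        then have "(s ^^ (n - j)) ((s ^^ i) x) = (s ^^ (n - j)) ((s ^^ j) x)" by simp
        then have "(s ^^ (n - j + i)) x = (s ^^ (n - j + j)) x" by (simp only: funpow_add comp_apply)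
        then have "(s ^^ (n - j + i)) x = x" using ij n by simp
        moreover have "(s ^^ (n - j + i)) x \<noteq> x" by (rule min) (use ij in auto)
        ultimately show False by contradiction
      qed
    qed
    have "tl (D.awalk_verts x ?w) = map (head F) ?w"
      using D.awalk_verts_conv'[of x ?w x] w n(1) by (auto simp: D.awalk_def)
    also have "\<dots> = map (\<lambda>i. s ((s ^^ i) x)) [0..<n]" by (simp add: comp_def head_f)
    finally have tl: "tl (D.awalk_verts x ?w) = map (\<lambda>i. s ((s ^^ i) x)) [0..<n]" .
    \<comment> \<open>\<open>cycle\<close> asks for distinctness of the vertex list without its
      head, so injectivity is needed for times shifted by one; \<open>n - 1\<close> further steps
      undo the shift.\<close>
    have "inj_on (\<lambda>i. s ((s ^^ i) x)) {0..<n}"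
    proof (rule inj_onI)
      fix i j assume ij: "i \<in> {0..<n}" "j \<in> {0..<n}" "s ((s ^^ i) x) = s ((s ^^ j) x)"
      then have "(s ^^ (n - 1)) ((s ^^ Suc i) x) = (s ^^ (n - 1)) ((s ^^ Suc j) x)" by simp
      then have "(s ^^ (n - 1 + Suc i)) x = (s ^^ (n - 1 + Suc j)) x" by (simp only: funpow_add comp_apply)
      moreover have "n - 1 + Suc i = i + n" "n - 1 + Suc j = j + n" using n(1) by auto
      ultimately have "(s ^^ (i + n)) x = (s ^^ (j + n)) x" by metis
      then have "(s ^^ i) x = (s ^^ j) x" using n(2) by (simp only: funpow_add comp_apply)
      then show "i = j" using inj ij by (auto dest: inj_onD)
    qed
    then have "distinct (tl (D.awalk_verts x ?w))" unfolding tl by (simp add: distinct_map)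
    then have "D.cycle ?w" unfolding D.cycle_def using w n(1) by (intro exI[of _ x]) auto
    moreover have "set ?w = f ` per (cls x)"
      unfolding orbit_eq_per[OF xS n(2,1), symmetric] by (auto simp: image_image atLeast0LessThan)
    ultimately show "f ` per (cls z) \<in> cycles D" unfolding zx cycles_def by (metis (mono_tags, lifting) mem_Collect_eq)
  qed
qed

lemma per_nonempty:
  assumes "z \<in> S"
  shows "per (cls z) \<noteq> {}"
proof -
  obtain x where "reaches s z x" "periodic s x"
    using ex_periodic[of S z s, OF finite_verts assms s_closed] by auto
  moreover from this have "x \<in> S" using reaches_closed assms s_closed by metis
  ultimately show ?thesis unfolding per_def cls_def using reaches_imp_merges by fast
qed

text \<open>A class is recovered from any of its periodic points, and it has at least one.\<close>

lemma inj_on_f_per: "inj_on (\<lambda>C. f ` per C) (cls ` S)"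
proof (rule inj_onI)
  fix A B assume "A \<in> cls ` S" "B \<in> cls ` S" and eq: "f ` per A = f ` per B"
  then obtain a b where ab: "A = cls a" "B = cls b" "a \<in> S" "b \<in> S" by auto
  have "per A = per B"
    using eq inj_on_image_eq_iff[OF inj_f, of "per A" "per B"] ab
    by (auto simp: per_def cls_def)
  moreover obtain y where "y \<in> per A" using per_nonempty ab by auto
  ultimately have "y \<in> cls a" "y \<in> cls b" using ab unfolding per_def by auto
  then have "merges s a b" unfolding cls_def using merges_sym merges_trans by fast
  then show "A = B" using cls_eq_iff ab by simp
qed

lemma sum_f_per: "(\<Sum>e\<in>f ` per (cls z). g e) = (\<Sum>u\<in>per (cls z). g (f u))"
  by (rule sum.reindex[unfolded comp_def], rule inj_on_subset[OF inj_f]) (auto simp: per_def cls_def)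

section \<open>Component counts expressed by reachability\<close>

lemma card_cls_1_iff:
  assumes "u \<in> S" "v \<in> S"
  shows "card (cls ` S) = 1 \<and> periodic s u \<and> periodic s v \<longleftrightarrow> same_cycle S s u v"
proof
  assume A: "card (cls ` S) = 1 \<and> periodic s u \<and> periodic s v"
  then have "cls x = cls u" "cls x = cls v" if "x \<in> S" for x
    using that assms by (metis card_1_singletonE imageI singletonD)+
  then have "merges s x u \<and> merges s x v" if "x \<in> S" for x
    using that cls_eq_iff[OF that assms(1)] cls_eq_iff[OF that assms(2)] by blast
  then show "same_cycle S s u v" unfolding same_cycle_def using A merges_periodic_iff by metis
next
  assume A: "same_cycle S s u v"
  then have "cls x = cls u" if "x \<in> S" for x
    using that cls_eq_iff[OF that assms(1)] reaches_imp_merges[of s x u]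
    unfolding same_cycle_def by blast
  then have "cls ` S = {cls u}" using assms(1) by blast
  moreover have "periodic s u" "periodic s v"
    using A assms s_closed unfolding same_cycle_def periodic_def by auto
  ultimately show "card (cls ` S) = 1 \<and> periodic s u \<and> periodic s v" by simp
qed

lemma card_cls_2_iff:
  assumes "u \<in> S" "v \<in> S"
  shows "card (cls ` S) = 2 \<and> periodic s u \<and> periodic s v \<and> \<not> merges s u v \<longleftrightarrow> two_cycles S s u v"
proof
  assume A: "card (cls ` S) = 2 \<and> periodic s u \<and> periodic s v \<and> \<not> merges s u v"
  then have "cls u \<noteq> cls v" using cls_eq_iff[OF assms] by simp
  then have sub: "card {cls u, cls v} = 2" "{cls u, cls v} \<subseteq> cls ` S" using assms by auto
  then have "{cls u, cls v} = cls ` S" using A by (intro card_subset_eq) auto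
  then have "cls x = cls u \<or> cls x = cls v" if "x \<in> S" for x using that by blast
  then have "merges s x u \<or> merges s x v" if "x \<in> S" for x
    using that cls_eq_iff[OF that assms(1)] cls_eq_iff[OF that assms(2)] by blast
  then show "two_cycles S s u v"
    unfolding two_cycles_def using A merges_periodic_iff merges_sym by metis
next
  assume A: "two_cycles S s u v"
  then have P: "periodic s u" "periodic s v" "\<not> merges s u v"
    unfolding two_cycles_def using merges_periodic_iff by metis+
  have "cls x = cls u \<or> cls x = cls v" if "x \<in> S" for x
    using that A cls_eq_iff[OF that assms(1)] cls_eq_iff[OF that assms(2)]
      reaches_imp_merges[of s x u] reaches_imp_merges[of s x v]
    unfolding two_cycles_def by blast
  then have "cls ` S = {cls u, cls v}" using assms by blast
  moreover have "cls u \<noteq> cls v" using P cls_eq_iff[OF assms] by simp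
  ultimately show "card (cls ` S) = 2 \<and> periodic s u \<and> periodic s v \<and> \<not> merges s u v" using P by simp
qed

lemma cls_disjoint:
  assumes "A \<in> cls ` S" "B \<in> cls ` S" "A \<noteq> B"
  shows "A \<inter> B = {}"
proof (rule ccontr)
  assume "A \<inter> B \<noteq> {}"
  moreover obtain a b where ab: "A = cls a" "B = cls b" "a \<in> S" "b \<in> S" using assms by auto
  ultimately obtain y where "y \<in> cls a" "y \<in> cls b" by auto
  then have "merges s a b" unfolding cls_def using merges_sym merges_trans by fast
  then show False using cls_eq_iff ab assms by simp
qed

lemma sum_cls:
  fixes \<phi> :: "'a \<Rightarrow> real"
  assumes "\<C> \<subseteq> cls ` S"
  shows "(\<Sum>C\<in>\<C>. \<Sum>u\<in>per C. \<phi> u) = (\<Sum>u\<in>\<Union>\<C>. of_bool (periodic s u) * \<phi> u)"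
proof -
  have fin: "\<forall>A\<in>\<C>. finite A"
    using assms by (auto simp: cls_def intro: finite_subset[OF _ finite_verts])
  have "(\<Sum>u\<in>\<Union>\<C>. of_bool (periodic s u) * \<phi> u) = (\<Sum>C\<in>\<C>. \<Sum>u\<in>C. of_bool (periodic s u) * \<phi> u)"
    using sum.Union_disjoint[OF fin, of "\<lambda>u. of_bool (periodic s u) * \<phi> u"] cls_disjoint assms
    by (auto simp: subset_iff comp_def)
  also have "\<dots> = (\<Sum>C\<in>\<C>. \<Sum>u\<in>per C. \<phi> u)"
    unfolding per_def by (rule sum.cong[OF refl], rule sum_filter_of_bool[symmetric]) (use fin in blast)
  finally show ?thesis by simp
qed

lemma Union_cls: "\<Union> (cls ` S) = S"
  using in_cls by (auto simp: cls_def)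

text \<open>The count is absorbed pointwise: a single component together with periodicity of
  \<open>u\<close> is \<open>same_cycle\<close> of \<open>u\<close> with itself.\<close>

lemma D1_sum_term:
  fixes g :: "'e \<Rightarrow> real"
  shows "of_bool (card (components D) = 1) * (\<Sum>C\<in>cycles D. \<Sum>e\<in>C. g e)
    = (\<Sum>u\<in>S. of_bool (same_cycle S s u u) * g (f u))"
proof -
  have "(\<Sum>C\<in>cycles D. \<Sum>e\<in>C. g e) = (\<Sum>C\<in>cls ` S. \<Sum>e\<in>f ` per C. g e)"
    unfolding cycles_D by (rule sum.reindex[OF inj_on_f_per, unfolded comp_def])
  also have "\<dots> = (\<Sum>C\<in>cls ` S. \<Sum>u\<in>per C. g (f u))"
    by (intro sum.cong refl) (auto simp: sum_f_per)
  also have "\<dots> = (\<Sum>u\<in>S. of_bool (periodic s u) * g (f u))"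
    by (subst sum_cls) (auto simp: Union_cls)
  finally show ?thesis
    unfolding card_components_D sum_distrib_left
    by (auto intro!: sum.cong simp: card_cls_1_iff[symmetric] split: if_splits)
qed

lemma D1_pair_term:
  fixes g h :: "'e \<Rightarrow> real"
  shows "of_bool (card (components D) = 1) * (\<Sum>C\<in>cycles D. (\<Sum>e\<in>C. g e) * (\<Sum>e\<in>C. h e))
    = (\<Sum>u\<in>S. \<Sum>v\<in>S. of_bool (same_cycle S s u v) * (g (f u) * h (f v)))"
proof -
  have "(\<Sum>C\<in>cycles D. (\<Sum>e\<in>C. g e) * (\<Sum>e\<in>C. h e)) =
      (\<Sum>C\<in>cls ` S. (\<Sum>e\<in>f ` per C. g e) * (\<Sum>e\<in>f ` per C. h e))"
    unfolding cycles_D by (rule sum.reindex[OF inj_on_f_per, unfolded comp_def])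
  also have "\<dots> = (\<Sum>C\<in>cls ` S. (\<Sum>u\<in>per C. g (f u)) * (\<Sum>v\<in>per C. h (f v)))"
    by (intro sum.cong refl) (auto simp: sum_f_per)
  finally have *: "(\<Sum>C\<in>cycles D. (\<Sum>e\<in>C. g e) * (\<Sum>e\<in>C. h e)) = \<dots>" .
  \<comment> \<open>A single class exhausts \<open>S\<close>, so the sum over cycles has one term,
    whose product expands over pairs of vertices.\<close>
  have one: "cls ` S = {S}" if "card (cls ` S) = 1"
    using that Union_cls by (metis card_1_singletonE ccpo_Sup_singleton)
  have per: "(\<Sum>u\<in>per S. \<phi> u) = (\<Sum>u\<in>S. of_bool (periodic s u) * \<phi> u)" for \<phi> :: "'a \<Rightarrow> real"
    unfolding per_def by (rule sum_filter_of_bool) simp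
  show ?thesis
  proof (cases "card (cls ` S) = 1")
    case True
    have "(\<Sum>C\<in>cls ` S. (\<Sum>u\<in>per C. g (f u)) * (\<Sum>v\<in>per C. h (f v))) =
      (\<Sum>u\<in>S. \<Sum>v\<in>S. of_bool (periodic s u) * g (f u) * (of_bool (periodic s v) * h (f v)))"
      unfolding one[OF True] by (simp only: per sum_product[symmetric] sum.insert finite.emptyI empty_iff sum.empty add_0_right not_False_eq_True)
    also have "\<dots> = (\<Sum>u\<in>S. \<Sum>v\<in>S. of_bool (same_cycle S s u v) * (g (f u) * h (f v)))"
      using True by (intro sum.cong refl) (auto simp: card_cls_1_iff[symmetric])
    finally show ?thesis unfolding * card_components_D using True by simp
  next
    case False
    then have "\<not> same_cycle S s u v" if "u \<in> S" "v \<in> S" for u v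
      using card_cls_1_iff[OF that] by blast
    then show ?thesis unfolding card_components_D using False by simp
  qed
qed

text \<open>Different cycles lie in different classes. Hence for \<open>u\<close> on the first
  cycle, the second vertex ranges over the periodic points that do not merge with
  \<open>u\<close>.\<close>

lemma D2_pair_term:
  fixes g h :: "'e \<Rightarrow> real"
  shows "of_bool (card (components D) = 2) *
      (\<Sum>C1\<in>cycles D. \<Sum>C2\<in>cycles D - {C1}. (\<Sum>e\<in>C1. g e) * (\<Sum>e\<in>C2. h e))
    = (\<Sum>u\<in>S. \<Sum>v\<in>S. of_bool (two_cycles S s u v) * (g (f u) * h (f v)))"
proof -
  let ?c = "\<lambda>C. f ` per C"
  have "(\<Sum>C1\<in>cycles D. \<Sum>C2\<in>cycles D - {C1}. (\<Sum>e\<in>C1. g e) * (\<Sum>e\<in>C2. h e)) =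
      (\<Sum>A\<in>cls ` S. \<Sum>C2\<in>cycles D - {?c A}. (\<Sum>e\<in>?c A. g e) * (\<Sum>e\<in>C2. h e))"
    by (subst (1) cycles_D) (rule sum.reindex[OF inj_on_f_per, unfolded comp_def])
  also have "\<dots> = (\<Sum>A\<in>cls ` S. \<Sum>B\<in>cls ` S - {A}. (\<Sum>e\<in>?c A. g e) * (\<Sum>e\<in>?c B. h e))"
  proof (intro sum.cong refl)
    fix A assume A: "A \<in> cls ` S"
    have "cycles D - {?c A} = ?c ` (cls ` S - {A})"
      unfolding cycles_D using inj_on_image_set_diff[OF inj_on_f_per, of "cls ` S" "{A}"] A by auto
    then show "(\<Sum>C2\<in>cycles D - {?c A}. (\<Sum>e\<in>?c A. g e) * (\<Sum>e\<in>C2. h e)) =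
      (\<Sum>B\<in>cls ` S - {A}. (\<Sum>e\<in>?c A. g e) * (\<Sum>e\<in>?c B. h e))"
      using sum.reindex[OF inj_on_subset[OF inj_on_f_per], of "cls ` S - {A}"] by (simp add: comp_def)
  qed
  also have "\<dots> = (\<Sum>A\<in>cls ` S. \<Sum>B\<in>cls ` S - {A}. (\<Sum>u\<in>per A. g (f u)) * (\<Sum>v\<in>per B. h (f v)))"
    by (intro sum.cong refl) (auto simp: sum_f_per)
  also have "\<dots> = (\<Sum>A\<in>cls ` S. \<Sum>u\<in>per A. g (f u) * (\<Sum>B\<in>cls ` S - {A}. \<Sum>v\<in>per B. h (f v)))"
    by (simp add: sum_distrib_left[symmetric] sum_distrib_right[symmetric])
  also have "\<dots> = (\<Sum>A\<in>cls ` S. \<Sum>u\<in>per A. g (f u) *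
      (\<Sum>v\<in>S. of_bool (\<not> merges s u v) * (of_bool (periodic s v) * h (f v))))"
  proof (intro sum.cong refl)
    fix A u assume A: "A \<in> cls ` S" and u: "u \<in> per A"
    have "\<Union> (cls ` S - {A}) = \<Union> (cls ` S) - A" using cls_disjoint A by blast
    also have "\<dots> = S - A" by (simp add: Union_cls)
    also have "\<dots> = {v\<in>S. \<not> merges s u v}"
    proof -
      obtain a where a: "A = cls a" "a \<in> S" using A by auto
      then have "u \<in> S" "merges s a u" using u by (auto simp: per_def cls_def)
      then have "A = cls u" using a cls_eq_iff by simp
      then show ?thesis by (auto simp: cls_def)
    qed
    finally have "\<Union> (cls ` S - {A}) = {v\<in>S. \<not> merges s u v}" .
    then have "(\<Sum>B\<in>cls ` S - {A}. \<Sum>v\<in>per B. h (f v)) =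
      (\<Sum>v\<in>{v\<in>S. \<not> merges s u v}. of_bool (periodic s v) * h (f v))"
      by (subst sum_cls) auto
    also have "\<dots> = (\<Sum>v\<in>S. of_bool (\<not> merges s u v) * (of_bool (periodic s v) * h (f v)))"
      by (rule sum_filter_of_bool) simp
    finally show "g (f u) * (\<Sum>B\<in>cls ` S - {A}. \<Sum>v\<in>per B. h (f v)) =
      g (f u) * (\<Sum>v\<in>S. of_bool (\<not> merges s u v) * (of_bool (periodic s v) * h (f v)))" by simp
  qed
  also have "\<dots> = (\<Sum>u\<in>S. of_bool (periodic s u) * (g (f u) *
      (\<Sum>v\<in>S. of_bool (\<not> merges s u v) * (of_bool (periodic s v) * h (f v)))))"
    by (subst sum_cls) (auto simp: Union_cls)
  also have "of_bool (card (cls ` S) = 2) * \<dots> =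
      (\<Sum>u\<in>S. \<Sum>v\<in>S. of_bool (two_cycles S s u v) * (g (f u) * h (f v)))"
    unfolding sum_distrib_left
    by (intro sum.cong refl) (auto simp: card_cls_2_iff[symmetric])
  finally show ?thesis unfolding card_components_D .
qed

end

section \<open>Sums over spanning functional digraphs\<close>

lemma spanning_functional_eq:
  assumes "fin_digraph F"
  shows "{D. spanning D F \<and> functional_digraph D} =
    functional_choice.D F ` (\<Pi>\<^sub>E v\<in>verts F. out_arcs F v)"
proof
  interpret fin_digraph F by (rule assms)
  have loc: "functional_choice F f" if "f \<in> (\<Pi>\<^sub>E v\<in>verts F. out_arcs F v)" for f
    by unfold_locales (rule that)
  show "functional_choice.D F ` (\<Pi>\<^sub>E v\<in>verts F. out_arcs F v) \<subseteq> {D. spanning D F \<and> functional_digraph D}"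
    using functional_choice.D_spanning[OF loc] functional_choice.D_functional[OF loc] by auto
  show "{D. spanning D F \<and> functional_digraph D} \<subseteq> functional_choice.D F ` (\<Pi>\<^sub>E v\<in>verts F. out_arcs F v)"
  proof clarify
    fix D :: "('a, 'b) pre_digraph" assume D: "spanning D F" "functional_digraph D"
    interpret D: fin_digraph D using D unfolding functional_digraph_def by auto
    have sub: "verts D = verts F" "arcs D \<subseteq> arcs F" "tail D = tail F" "head D = head F"
      using D(1) by (auto simp: spanning_def subgraph_def compatible_def)
    have "\<forall>v\<in>verts F. \<exists>e. out_arcs D v = {e}"
      using D(2) sub unfolding functional_digraph_def out_degree_def by (auto simp: card_1_singleton_iff)
    then obtain f0 where f0: "\<And>v. v \<in> verts F \<Longrightarrow> out_arcs D v = {f0 v}" by metis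
    define f where "f = restrict f0 (verts F)"
    have f: "out_arcs D v = {f v}" if "v \<in> verts F" for v using f0 that unfolding f_def by simp
    have mem: "f \<in> (\<Pi>\<^sub>E v\<in>verts F. out_arcs F v)"
    proof
      fix v assume v: "v \<in> verts F"
      have "f v \<in> out_arcs D v" using f[OF v] by simp
      then show "f v \<in> out_arcs F v" using sub by auto
    qed (simp add: f_def)
    interpret c: functional_choice F f by (rule loc[OF mem])
    have "arcs D = f ` verts F"
    proof
      show "arcs D \<subseteq> f ` verts F"
      proof
        fix e assume e: "e \<in> arcs D"
        then have "e \<in> out_arcs D (tail D e)" by simp
        moreover have "tail D e \<in> verts F" using e sub D.tail_in_verts by metis
        ultimately show "e \<in> f ` verts F" using f by auto
      qed
      show "f ` verts F \<subseteq> arcs D" using f by (auto simp: out_arcs_def)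
    qed
    then have "D = c.D" using sub by (intro pre_digraph.equality) auto
    then show "D \<in> functional_choice.D F ` (\<Pi>\<^sub>E v\<in>verts F. out_arcs F v)" using mem by blast
  qed
qed

locale weighted_digraph = fin_digraph F for F :: "('a, 'e) pre_digraph" +
  fixes p :: "'e \<Rightarrow> real"
  assumes weight_pos: "\<And>e. e \<in> arcs F \<Longrightarrow> 0 < p e"
    and weight_sum: "\<And>v. v \<in> verts F \<Longrightarrow> (\<Sum>e\<in>out_arcs F v. p e) = 1"
begin

section \<open>Random choice of one arc per vertex\<close>

definition choices where "choices = (\<Pi>\<^sub>E v\<in>verts F. out_arcs F v)"

text \<open>As the weights leaving each vertex add up to 1, this is the probability of
  \<open>f\<close> when the arcs are drawn independently.\<close>

definition wgt where "wgt f = (\<Prod>v\<in>verts F. p (f v))"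

lemma finite_choices [simp]: "finite choices"
  unfolding choices_def by (intro finite_PiE) auto

lemma choiceI: "f \<in> choices \<Longrightarrow> functional_choice F f"
  unfolding choices_def by unfold_locales

lemma inj_on_D: "inj_on (functional_choice.D F) choices"
proof (rule inj_onI)
  fix f g assume fg: "f \<in> choices" "g \<in> choices"
    and eq: "functional_choice.D F f = functional_choice.D F g"
  interpret f: functional_choice F f by (rule choiceI[OF fg(1)])
  interpret g: functional_choice F g by (rule choiceI[OF fg(2)])
  have im: "f ` verts F = g ` verts F" using arg_cong[OF eq, of arcs] by simp
  show "f = g"
  proof (rule PiE_ext[OF fg[unfolded choices_def]])
    fix v assume v: "v \<in> verts F"
    then obtain w where w: "w \<in> verts F" "f v = g w" using im by blast
    then have "v = w" using f.tail_f[OF v] g.tail_f[OF w(1)] by metis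
    then show "f v = g v" using w by simp
  qed
qed

text \<open>Makes the functionals expectations over a product set, where a single arc can be
  resampled.\<close>

lemma sum_functional_spanning:
  fixes \<phi> :: "('a, 'e) pre_digraph \<Rightarrow> real"
  shows "(\<Sum>D\<in>functional_spanning m F. (\<Prod>e\<in>arcs D. p e) * \<phi> D) =
    (\<Sum>f\<in>choices. wgt f * (of_bool (card (components (functional_choice.D F f)) = m) *
       \<phi> (functional_choice.D F f)))"
proof -
  let ?D = "functional_choice.D F"
  let ?C = "{f \<in> choices. card (components (?D f)) = m}"
  have "functional_spanning m F = {D \<in> {D. spanning D F \<and> functional_digraph D}. card (components D) = m}"
    unfolding functional_spanning_def by auto
  also have "\<dots> = ?D ` ?C"
    unfolding spanning_functional_eq[OF fin_digraph_axioms] choices_def by auto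
  finally have "functional_spanning m F = ?D ` ?C" .
  then have "(\<Sum>D\<in>functional_spanning m F. (\<Prod>e\<in>arcs D. p e) * \<phi> D) =
      (\<Sum>f\<in>?C. (\<Prod>e\<in>arcs (?D f). p e) * \<phi> (?D f))"
    using sum.reindex[OF inj_on_subset[OF inj_on_D, of ?C], of "\<lambda>D. (\<Prod>e\<in>arcs D. p e) * \<phi> D"]
    by auto
  also have "\<dots> = (\<Sum>f\<in>?C. wgt f * \<phi> (?D f))"
  proof (rule sum.cong[OF refl])
    fix f assume f: "f \<in> ?C"
    interpret f: functional_choice F f using f choiceI by auto
    show "(\<Prod>e\<in>arcs (?D f). p e) * \<phi> (?D f) = wgt f * \<phi> (?D f)"
      by (simp add: wgt_def prod.reindex[OF f.inj_f])
  qed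
  also have "\<dots> = (\<Sum>f\<in>choices. of_bool (card (components (?D f)) = m) * (wgt f * \<phi> (?D f)))"
    by (rule sum_filter_of_bool) simp
  finally show ?thesis by (simp add: mult.left_commute)
qed

lemma D1_sum_choices:
  "D1_sum F p g =
    (\<Sum>f\<in>choices. wgt f * (\<Sum>u\<in>verts F. of_bool (same_cycle (verts F) (head F \<circ> f) u u) * g (f u)))"
  unfolding D1_sum_def sum_functional_spanning
  by (intro sum.cong refl)
     (simp only: functional_choice.D1_sum_term[OF choiceI] functional_choice.s_def[OF choiceI])

lemma D1_pair_choices:
  "D1_pair F p g h = (\<Sum>f\<in>choices. wgt f *
    (\<Sum>u\<in>verts F. \<Sum>v\<in>verts F. of_bool (same_cycle (verts F) (head F \<circ> f) u v) * (g (f u) * h (f v))))"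
  unfolding D1_pair_def sum_functional_spanning
  by (intro sum.cong refl)
     (simp only: functional_choice.D1_pair_term[OF choiceI] functional_choice.s_def[OF choiceI])

lemma D2_pair_choices:
  "D2_pair F p g h = (\<Sum>f\<in>choices. wgt f *
    (\<Sum>u\<in>verts F. \<Sum>v\<in>verts F. of_bool (two_cycles (verts F) (head F \<circ> f) u v) * (g (f u) * h (f v))))"
  unfolding D2_pair_def sum_functional_spanning
  by (intro sum.cong refl)
     (simp only: functional_choice.D2_pair_term[OF choiceI] functional_choice.s_def[OF choiceI])

text \<open>Under the product weight the arc at \<open>v\<close> is independent of all others, and
  \<open>Q\<close> sees only the others; so the expectation factorises.\<close>

lemma sum_choices_marginal:
  fixes Q :: "('a \<Rightarrow> 'e) \<Rightarrow> real"
  assumes v: "v \<in> verts F"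
    and Q: "\<And>f e. f \<in> choices \<Longrightarrow> e \<in> out_arcs F v \<Longrightarrow> Q (f(v := e)) = Q f"
  shows "(\<Sum>f\<in>choices. wgt f * (Q f * k (f v))) = (\<Sum>e\<in>out_arcs F v. p e * k e) * (\<Sum>f\<in>choices. wgt f * Q f)"
proof -
  let ?V = "verts F - {v}"
  let ?P = "\<Pi>\<^sub>E w\<in>?V. out_arcs F w"
  have ins: "insert v ?V = verts F" using v by auto
  have ch: "choices = (\<lambda>(y, g). g(v := y)) ` (out_arcs F v \<times> ?P)"
    unfolding choices_def using PiE_insert_eq[of v ?V "out_arcs F"] unfolding ins .
  have inj: "inj_on (\<lambda>(y, g). g(v := y)) (out_arcs F v \<times> ?P)"
    by (rule inj_combinator) simp
  \<comment> \<open>A reference arc at \<open>v\<close>, at which \<open>Q\<close> can be evaluated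
    without changing its value.\<close>
  obtain e0 where e0: "e0 \<in> out_arcs F v"
    using weight_sum[OF v] by (metis all_not_in_conv sum.empty zero_neq_one)
  have w: "wgt (g(v := e)) = p e * (\<Prod>w\<in>?V. p (g w))" for g e
    unfolding wgt_def using prod.remove[OF finite_verts v, of "\<lambda>w. p ((g(v := e)) w)"]
    by (auto intro: prod.cong)
  have q: "Q (g(v := e)) = Q (g(v := e0))" if "e \<in> out_arcs F v" "g \<in> ?P" for e g
  proof -
    have "g(v := e0) \<in> choices" unfolding ch using that e0 by auto
    then have "Q ((g(v := e0))(v := e)) = Q (g(v := e0))" using Q that by blast
    then show ?thesis by simp
  qed
  have gen: "(\<Sum>f\<in>choices. wgt f * (Q f * k (f v))) =
    (\<Sum>e\<in>out_arcs F v. p e * k e) * (\<Sum>g\<in>?P. (\<Prod>w\<in>?V. p (g w)) * Q (g(v := e0)))" for k :: "'e \<Rightarrow> real"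
  proof -
    have "(\<Sum>f\<in>choices. wgt f * (Q f * k (f v))) =
      (\<Sum>(e, g)\<in>out_arcs F v \<times> ?P. wgt (g(v := e)) * (Q (g(v := e)) * k e))"
      unfolding ch by (subst sum.reindex[OF inj]) (simp add: case_prod_unfold)
    also have "\<dots> = (\<Sum>(e, g)\<in>out_arcs F v \<times> ?P. (p e * k e) * ((\<Prod>w\<in>?V. p (g w)) * Q (g(v := e0))))"
    proof (rule sum.cong[OF refl], clarify)
      fix e g assume eg: "e \<in> out_arcs F v" "g \<in> ?P"
      show "wgt (g(v := e)) * (Q (g(v := e)) * k e) = (p e * k e) * ((\<Prod>w\<in>?V. p (g w)) * Q (g(v := e0)))"
        unfolding q[OF eg] w by simp
    qed
    also have "\<dots> = (\<Sum>e\<in>out_arcs F v. \<Sum>g\<in>?P. (p e * k e) * ((\<Prod>w\<in>?V. p (g w)) * Q (g(v := e0))))"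
      by (rule sum.cartesian_product[symmetric])
    finally show ?thesis unfolding sum_product .
  qed
  \<comment> \<open>The instance with the constant 1 identifies the second factor, because the
    weights leaving \<open>v\<close> add up to 1.\<close>
  show ?thesis using gen[of k] gen[of "\<lambda>_. 1"] weight_sum[OF v] by simp
qed

text \<open>Whether \<open>u\<close> lies on the only cycle is independent of the arc at
  \<open>u\<close>, so this arc contributes its mean \<open>a\<close>.\<close>

theorem D1_sum_const_row_sum:
  assumes "\<And>v. v \<in> verts F \<Longrightarrow> (\<Sum>e\<in>out_arcs F v. p e * k e) = a"
  shows "D1_sum F p k = a * D1_sum F p (\<lambda>_. 1)"
proof -
  let ?Q = "\<lambda>u f. of_bool (same_cycle (verts F) (head F \<circ> f) u u) :: real"
  have Q: "?Q u (f(u := e)) = ?Q u f" if "u \<in> verts F" for u f e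
    unfolding same_cycle_refl_absorb[OF that]
    using absorb_cong[of "{u}" "head F \<circ> f(u := e)" "head F \<circ> f"] by auto
  have "D1_sum F p k = (\<Sum>u\<in>verts F. \<Sum>f\<in>choices. wgt f * (?Q u f * k (f u)))" for k
    unfolding D1_sum_choices by (simp only: sum_distrib_left) (rule sum.swap)
  note * = this
  have "D1_sum F p k = (\<Sum>u\<in>verts F. a * (\<Sum>f\<in>choices. wgt f * ?Q u f))"
    unfolding *
  proof (intro sum.cong refl)
    fix u assume u: "u \<in> verts F"
    show "(\<Sum>f\<in>choices. wgt f * (?Q u f * k (f u))) = a * (\<Sum>f\<in>choices. wgt f * ?Q u f)"
      unfolding sum_choices_marginal[of u "?Q u" k, OF u Q[OF u]] assms[OF u] ..
  qed
  also have "\<dots> = a * D1_sum F p (\<lambda>_. 1)" unfolding * by (simp only: sum_distrib_left mult_1_right)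
  finally show ?thesis .
qed

theorem D1_pair_minus_D2_pair:
  assumes g: "\<And>v. v \<in> verts F \<Longrightarrow> (\<Sum>e\<in>out_arcs F v. p e * g e) = 0"
    and h: "\<And>v. v \<in> verts F \<Longrightarrow> (\<Sum>e\<in>out_arcs F v. p e * h e) = 0"
  shows "D1_pair F p g h - D2_pair F p g h = D1_sum F p (\<lambda>e. g e * h e)"
proof -
  let ?S = "verts F"
  let ?s = "\<lambda>f. head F \<circ> f"
  let ?d = "\<lambda>u v f. of_bool (same_cycle ?S (?s f) u v) - of_bool (two_cycles ?S (?s f) u v) :: real"
  have "D1_pair F p g h - D2_pair F p g h =
    (\<Sum>f\<in>choices. wgt f * (\<Sum>u\<in>?S. \<Sum>v\<in>?S. ?d u v f * (g (f u) * h (f v))))"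
    unfolding D1_pair_choices D2_pair_choices
    by (simp only: sum_subtractf[symmetric] right_diff_distrib[symmetric] left_diff_distrib[symmetric])
  also have "\<dots> = (\<Sum>u\<in>?S. \<Sum>v\<in>?S. \<Sum>f\<in>choices. wgt f * (?d u v f * (g (f u) * h (f v))))"
    unfolding sum_distrib_left by (rule trans[OF sum.swap]) (intro sum.cong refl sum.swap)
  also have "\<dots> = (\<Sum>u\<in>?S. \<Sum>v\<in>?S. if u = v then
      (\<Sum>f\<in>choices. wgt f * (of_bool (same_cycle ?S (?s f) u u) * (g (f u) * h (f u)))) else 0)"
  proof (intro sum.cong refl)
    fix u v assume uv: "u \<in> ?S" "v \<in> ?S"
    show "(\<Sum>f\<in>choices. wgt f * (?d u v f * (g (f u) * h (f v)))) = (if u = v then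
      (\<Sum>f\<in>choices. wgt f * (of_bool (same_cycle ?S (?s f) u u) * (g (f u) * h (f u)))) else 0)"
    proof (cases "u = v")
      case True
      then show ?thesis by (simp only: not_two_cycles_refl of_bool_eq diff_0_right simp_thms if_True)
    next
      case False
      let ?r = "\<lambda>f. reaches (absorb {u, v} (?s f))"
      \<comment> \<open>Of the arcs at \<open>u\<close> and \<open>v\<close>, \<open>X\<close>
        involves neither, \<open>\<alpha>\<close> only the one at \<open>u\<close>, and
        \<open>\<beta>\<close> only the one at \<open>v\<close>.\<close>
      define X where "X f = (of_bool (\<forall>x\<in>?S. ?r f x u \<or> ?r f x v) :: real)" for f
      define \<alpha> where "\<alpha> f = (of_bool (?r f (?s f u) v) :: real)" for f
      define \<beta> where "\<beta> f = (of_bool (?r f (?s f v) u) :: real)" for f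
      have r: "?r (f(w := e)) = ?r f" if "w \<in> {u, v}" for f w e
        by (rule arg_cong[OF absorb_cong]) (use that in auto)
      have X: "X (f(w := e)) = X f" if "w \<in> {u, v}" for f w e
        unfolding X_def r[OF that] ..
      have \<alpha>: "\<alpha> (f(v := e)) = \<alpha> f" for f e
        unfolding \<alpha>_def using r[of v f e] False by simp
      have \<beta>: "\<beta> (f(u := e)) = \<beta> f" for f e
        unfolding \<beta>_def using r[of u f e] False by simp
      have "?d u v f = X f * (\<alpha> f + \<beta> f - 1)" if "f \<in> choices" for f
        unfolding X_def \<alpha>_def \<beta>_def
      proof (rule of_bool_same_cycle_minus_two_cycles[OF uv False])
        fix x assume "x \<in> ?S"
        then show "?s f x \<in> ?S"
          using functional_choice.s_closed[OF choiceI[OF that]] functional_choice.s_def[OF choiceI[OF that]] by metis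
      qed
      then have "(\<Sum>f\<in>choices. wgt f * (?d u v f * (g (f u) * h (f v)))) =
        (\<Sum>f\<in>choices. wgt f * (X f * (\<alpha> f + \<beta> f - 1) * (g (f u) * h (f v))))"
        by (intro sum.cong refl) (simp only:)
      \<comment> \<open>Grouped so that in the first sum \<open>h (f v)\<close> meets only factors
        free of the arc at \<open>v\<close>, and in the second \<open>g (f u)\<close> only factors
        free of the arc at \<open>u\<close>. Both then average to 0.\<close>
      also have "\<dots> = (\<Sum>f\<in>choices. wgt f * ((X f * (\<alpha> f - 1) * g (f u)) * h (f v)))
         + (\<Sum>f\<in>choices. wgt f * ((X f * \<beta> f * h (f v)) * g (f u)))"
        unfolding sum.distrib[symmetric] by (intro sum.cong refl) (simp add: algebra_simps)
      also have "(\<Sum>f\<in>choices. wgt f * ((X f * (\<alpha> f - 1) * g (f u)) * h (f v))) = 0"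
        by (subst sum_choices_marginal[OF uv(2)]) (use False in \<open>simp_all add: X \<alpha> h[OF uv(2)]\<close>)
      also have "(\<Sum>f\<in>choices. wgt f * ((X f * \<beta> f * h (f v)) * g (f u))) = 0"
        by (subst sum_choices_marginal[OF uv(1)]) (use False in \<open>simp_all add: X \<beta> g[OF uv(1)]\<close>)
      finally show ?thesis by (simp only: False if_False add_0_right)
    qed
  qed
  also have "\<dots> = (\<Sum>u\<in>?S. \<Sum>f\<in>choices. wgt f * (of_bool (same_cycle ?S (?s f) u u) * (g (f u) * h (f u))))"
    by (intro sum.cong refl) (simp only: sum.delta[OF finite_verts] sum.delta'[OF finite_verts] if_True)
  also have "\<dots> = D1_sum F p (\<lambda>e. g e * h e)"
    unfolding D1_sum_choices by (simp only: sum_distrib_left) (rule sum.swap)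
  finally show ?thesis .
qed

lemma wgt_pos: "f \<in> choices \<Longrightarrow> 0 < wgt f"
  unfolding wgt_def by (intro prod_pos) (auto simp: choices_def PiE_iff weight_pos)

lemma D1_sum_nonneg:
  assumes "\<And>e. 0 \<le> k e"
  shows "0 \<le> D1_sum F p k"
  unfolding D1_sum_choices using assms wgt_pos
  by (intro sum_nonneg mult_nonneg_nonneg) (auto intro: less_imp_le)

text \<open>Arcs that decrease the distance to a root \<open>r\<close>, together with any arc out of
  \<open>r\<close>, form a functional digraph whose only cycle passes through \<open>r\<close>. Its
  weight is positive.\<close>

lemma D1_sum_one_pos:
  assumes "strongly_connected F"
  shows "0 < D1_sum F p (\<lambda>_. 1)"
proof -
  obtain r where r: "r \<in> verts F" using assms unfolding strongly_connected_def by auto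
  define d where "d x = (LEAST n. \<exists>w. awalk x w r \<and> length w = n)" for x
  have "\<exists>e. e \<in> out_arcs F x \<and> (x \<noteq> r \<longrightarrow> d (head F e) < d x)" if x: "x \<in> verts F" for x
  proof (cases "x = r")
    case True
    obtain e where "e \<in> out_arcs F x"
      using weight_sum[OF x] by (metis all_not_in_conv sum.empty zero_neq_one)
    then show ?thesis using True by blast
  next
    case False
    have "x \<rightarrow>\<^sup>*\<^bsub>F\<^esub> r" using assms x r unfolding strongly_connected_def by auto
    then obtain w0 where "awalk x w0 r" using reachable_awalk by auto
    then have "\<exists>n w. awalk x w r \<and> length w = n" by blast
    from LeastI_ex[OF this] obtain w where w: "awalk x w r" "length w = d x"
      unfolding d_def by auto
    then obtain e w' where w': "w = e # w'" using False by (cases w) (auto simp: awalk_Nil_iff)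
    have "awalk (head F e) w' r" "e \<in> out_arcs F x" using w w' by (auto simp: awalk_Cons_iff)
    moreover from this have "d (head F e) \<le> length w'" unfolding d_def by (intro Least_le) blast
    ultimately show ?thesis using w w' by auto
  qed
  then obtain f0 where f0: "\<And>x. x \<in> verts F \<Longrightarrow> f0 x \<in> out_arcs F x"
    "\<And>x. x \<in> verts F \<Longrightarrow> x \<noteq> r \<Longrightarrow> d (head F (f0 x)) < d x" by metis
  define f where "f = restrict f0 (verts F)"
  have f: "f \<in> choices" unfolding f_def choices_def using f0(1) by auto
  interpret f: functional_choice F f by (rule choiceI[OF f])
  have "reaches f.s x r" if "x \<in> verts F" for x
    using that
  proof (induction "d x" arbitrary: x rule: less_induct)
    case less
    show ?case
    proof (cases "x = r")
      case False
      have "f x = f0 x" using less.prems by (simp add: f_def)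
      then have "d (f.s x) < d x" unfolding f.s_def using f0(2)[OF less.prems False] by simp
      then have "reaches f.s (f.s x) r" using less f.s_closed by blast
      then show ?thesis by (rule reaches_Cons)
    qed simp
  qed
  then have sc: "same_cycle (verts F) (head F \<circ> f) r r"
    unfolding same_cycle_def f.s_def by blast
  let ?c = "\<lambda>f. wgt f * (\<Sum>u\<in>verts F. of_bool (same_cycle (verts F) (head F \<circ> f) u u) * 1)"
  have "1 \<le> (\<Sum>u\<in>verts F. of_bool (same_cycle (verts F) (head F \<circ> f) u u) * 1 :: real)"
    using member_le_sum[OF r, of "\<lambda>u. of_bool (same_cycle (verts F) (head F \<circ> f) u u) * 1 :: real"] sc by simp
  then have "0 < ?c f" using wgt_pos[OF f] by (intro mult_pos_pos) auto
  also have "\<dots> \<le> D1_sum F p (\<lambda>_. 1)" unfolding D1_sum_choices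
    by (rule member_le_sum[OF f]) (auto intro!: mult_nonneg_nonneg sum_nonneg less_imp_le[OF wgt_pos])
  finally show ?thesis .
qed

lemma D1_sum_linear:
  "D1_sum F p (\<lambda>e. a * g e + b * h e) = a * D1_sum F p g + b * D1_sum F p h"
  unfolding D1_sum_choices sum_distrib_left sum.distrib[symmetric]
  by (intro sum.cong refl) (simp add: algebra_simps)

end

section \<open>Invariance of cycle sums under coboundaries\<close>

lemma sum_cycle_coboundary:
  assumes "C \<in> cycles D" "wf_digraph D" "tail D = tail F" "head D = head F"
  shows "(\<Sum>e\<in>C. k e + (h (head F e) - h (tail F e))) = (\<Sum>e\<in>C. k e :: real)"
proof -
  interpret wf_digraph D by fact
  obtain w u where w: "C = set w" "awalk u w u" "distinct w"
    using assms(1) unfolding cycles_def cycle_conv by auto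
  \<comment> \<open>The coboundary telescopes along any walk, hence vanishes on a closed
    one.\<close>
  have "cas u w v \<Longrightarrow> (\<Sum>e\<leftarrow>w. h (head D e) - h (tail D e)) = h v - h u" for v u
    by (induction w arbitrary: u) auto
  then have "(\<Sum>e\<leftarrow>w. h (head D e) - h (tail D e)) = 0" using w(2) by (auto simp: awalk_def)
  then have "(\<Sum>e\<in>C. h (head F e) - h (tail F e)) = 0"
    using w assms(3,4) by (simp add: sum_list_distinct_conv_sum_set)
  then show ?thesis by (simp add: sum.distrib)
qed

lemma sum_cycle_coboundary_spanning:
  assumes "D \<in> functional_spanning m F" "C \<in> cycles D"
  shows "(\<Sum>e\<in>C. k e + (h (head F e) - h (tail F e))) = (\<Sum>e\<in>C. k e :: real)"
  by (rule sum_cycle_coboundary[OF assms(2)])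
     (use assms(1) in \<open>auto simp: functional_spanning_def spanning_def subgraph_def compatible_def\<close>)

lemma D1_sum_coboundary:
  "D1_sum F p (\<lambda>e. k e + (h (head F e) - h (tail F e))) = D1_sum F p k"
  unfolding D1_sum_def by (simp only: sum_cycle_coboundary_spanning cong: sum.cong)

lemma D1_pair_coboundary:
  "D1_pair F p (\<lambda>e. k e + (h (head F e) - h (tail F e))) (\<lambda>e. k' e + (h' (head F e) - h' (tail F e)))
    = D1_pair F p k k'"
  unfolding D1_pair_def by (simp only: sum_cycle_coboundary_spanning cong: sum.cong)

lemma D2_pair_coboundary:
  "D2_pair F p (\<lambda>e. k e + (h (head F e) - h (tail F e))) (\<lambda>e. k' e + (h' (head F e) - h' (tail F e)))
    = D2_pair F p k k'"
  unfolding D2_pair_def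
proof (rule sum.cong[OF refl], rule arg_cong2[where f = "(*)", OF refl],
    rule sum.cong[OF refl], rule sum.cong[OF refl])
  fix D C1 C2 assume D: "D \<in> functional_spanning 2 F" and C: "C1 \<in> cycles D" "C2 \<in> cycles D - {C1}"
  show "(\<Sum>e\<in>C1. k e + (h (head F e) - h (tail F e))) * (\<Sum>e\<in>C2. k' e + (h' (head F e) - h' (tail F e)))
    = (\<Sum>e\<in>C1. k e) * (\<Sum>e\<in>C2. k' e)"
    by (simp only: sum_cycle_coboundary_spanning[OF D C(1)] sum_cycle_coboundary_spanning[OF D DiffD1[OF C(2)]])
qed

section \<open>Characteristic functions in the plane\<close>

definition char2 :: "(real \<times> real) measure \<Rightarrow> real \<Rightarrow> real \<Rightarrow> complex" where
  "char2 N s t = (CLINT z|N. iexp (s * fst z + t * snd z))"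

text \<open>Finite sums of characters. Convergence of \<open>char2\<close> gives convergence of
  their integrals, and they are closed under products because exponents add.\<close>

inductive trig_poly :: "(real \<times> real \<Rightarrow> complex) \<Rightarrow> bool" where
  monomial: "trig_poly (\<lambda>z. c * iexp (s * fst z + t * snd z))"
| add: "trig_poly f \<Longrightarrow> trig_poly g \<Longrightarrow> trig_poly (\<lambda>z. f z + g z)"

lemma trig_poly_const: "trig_poly (\<lambda>_. c)"
  using trig_poly.monomial[of c 0 0] by simp

lemma trig_poly_mult:
  assumes "trig_poly f" "trig_poly g"
  shows "trig_poly (\<lambda>z. f z * g z)"
  using assms(1)
proof (induction f rule: trig_poly.induct)
  case (monomial c s t)
  show ?case using assms(2)
  proof (induction g rule: trig_poly.induct)
    case (monomial d s' t')
    have "(\<lambda>z. c * iexp (s * fst z + t * snd z) * (d * iexp (s' * fst z + t' * snd z))) =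
      (\<lambda>z. (c * d) * iexp ((s + s') * fst z + (t + t') * snd z))"
      by (auto simp: exp_add[symmetric] algebra_simps)
    then show ?case by (simp only: trig_poly.monomial)
  next
    case (add f g)
    then show ?case using trig_poly.add[OF add.IH] by (simp only: distrib_left)
  qed
next
  case (add f g)
  then show ?case using trig_poly.add[OF add.IH] by (simp only: distrib_right)
qed

lemma sin_eq_iexp: "complex_of_real (sin a) = (- \<i> / 2) * iexp a + (\<i> / 2) * iexp (- a)"
  unfolding cis_conv_exp[symmetric] by (simp add: complex_eq_iff)

lemma iexp_eq_cos_sin: "iexp a = complex_of_real (cos a) + \<i> * complex_of_real (sin a)"
  unfolding cis_conv_exp[symmetric] by (simp add: complex_eq_iff)

lemma trig_poly_sin:
  "trig_poly (\<lambda>z. complex_of_real (sin (s * fst z + t * snd z)))"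
proof -
  have "(\<lambda>z. complex_of_real (sin (s * fst z + t * snd z))) =
    (\<lambda>z. (- \<i> / 2) * iexp (s * fst z + t * snd z) + (\<i> / 2) * iexp ((- s) * fst z + (- t) * snd z))"
  proof
    fix z :: "real \<times> real"
    let ?a = "s * fst z + t * snd z"
    have "(- s) * fst z + (- t) * snd z = - ?a" by simp
    then show "complex_of_real (sin ?a) = (- \<i> / 2) * iexp ?a + (\<i> / 2) * iexp ((- s) * fst z + (- t) * snd z)"
      using sin_eq_iexp[of ?a] by (simp only:)
  qed
  then show ?thesis
    by (simp only:) (rule trig_poly.add; rule trig_poly.monomial)
qed

lemma trig_poly_real_polynomial_function:
  assumes "real_polynomial_function (P :: real \<times> real \<Rightarrow> real)"
  shows "trig_poly (\<lambda>z. complex_of_real (P (sin (\<omega> * fst z), sin (\<omega> * snd z))))"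
  using assms
proof (induction P rule: real_polynomial_function.induct)
  case (linear h)
  have hlin: "h (a, b) = h (1, 0) * a + h (0, 1) * b" for a b
  proof -
    have "(a, b) = a *\<^sub>R (1, 0) + b *\<^sub>R (0, 1 :: real)" by simp
    then have "h (a, b) = h (a *\<^sub>R (1, 0) + b *\<^sub>R (0, 1))" by simp
    also have "\<dots> = a * h (1, 0) + b * h (0, 1)"
      by (simp only: linear_simps[OF linear] real_scaleR_def)
    finally show ?thesis by (simp add: mult.commute)
  qed
  have "(\<lambda>z. complex_of_real (h (sin (\<omega> * fst z), sin (\<omega> * snd z)))) =
    (\<lambda>z. of_real (h (1, 0)) * of_real (sin (\<omega> * fst z + 0 * snd z)) +
         of_real (h (0, 1)) * of_real (sin (0 * fst z + \<omega> * snd z)))"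
    by (rule ext, subst hlin) simp
  then show ?case
    by (simp only:) (rule trig_poly.add; rule trig_poly_mult[OF trig_poly_const trig_poly_sin])
next
  case (const c)
  then show ?case by (rule trig_poly_const)
next
  case (add f g)
  then show ?case using trig_poly.add[OF add.IH] by (simp only: of_real_add)
next
  case (mult f g)
  then show ?case using trig_poly_mult[OF mult.IH] by (simp only: of_real_mult)
qed

lemma trig_poly_integrable:
  assumes "prob_space N" "sets N = sets (borel :: (real \<times> real) measure)" "trig_poly f"
  shows "integrable N f"
  using assms(3)
proof (induction rule: trig_poly.induct)
  case (monomial c s t)
  interpret prob_space N by fact
  have "(\<lambda>z. c * iexp (s * fst z + t * snd z)) \<in> borel_measurable borel"
    by (intro borel_measurable_continuous_onI continuous_intros)
  then have "(\<lambda>z. c * iexp (s * fst z + t * snd z)) \<in> borel_measurable N"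
    using measurable_cong_sets[OF assms(2) refl] by blast
  moreover have "cmod (c * iexp (s * fst z + t * snd z)) \<le> cmod c" for z :: "real \<times> real"
    by (simp add: norm_mult)
  ultimately show ?case by (intro integrable_const_bound[where B = "cmod c"]) auto
next
  case (add f g)
  then show ?case by simp
qed

lemma trig_poly_integral_tendsto:
  assumes N: "\<And>n. prob_space (N n)" "\<And>n. sets (N n) = sets (borel :: (real \<times> real) measure)"
    and L: "prob_space L" "sets L = sets (borel :: (real \<times> real) measure)"
    and char: "\<And>s t. (\<lambda>n. char2 (N n) s t) \<longlonglongrightarrow> char2 L s t"
    and f: "trig_poly f"
  shows "(\<lambda>n. CLINT z|N n. f z) \<longlonglongrightarrow> (CLINT z|L. f z)"
  using f
proof (induction rule: trig_poly.induct)
  case (monomial c s t)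
  show ?case using tendsto_mult_left[OF char[of s t], of c] unfolding char2_def by simp
next
  case (add f g)
  then show ?case
    using tendsto_add[OF add.IH] N L trig_poly_integrable by (simp add: Bochner_Integration.integral_add)
qed

lemma integral_diff_le:
  fixes f g w :: "real \<times> real \<Rightarrow> real"
  assumes "prob_space N" "integrable N f" "integrable N g" "integrable N w"
    and "\<And>z. \<bar>f z - g z\<bar> \<le> \<epsilon> + b * w z" "(LINT z|N. w z) \<le> C" "0 \<le> b"
  shows "\<bar>(LINT z|N. f z) - (LINT z|N. g z)\<bar> \<le> \<epsilon> + b * C"
proof -
  interpret prob_space N by fact
  have "\<bar>(LINT z|N. f z) - (LINT z|N. g z)\<bar> = \<bar>LINT z|N. f z - g z\<bar>"
    using assms by simp
  also have "\<dots> \<le> (LINT z|N. \<bar>f z - g z\<bar>)" by (rule integral_abs_bound)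
  also have "\<dots> \<le> (LINT z|N. \<epsilon> + b * w z)"
    using assms by (intro integral_mono) auto
  also have "\<dots> = \<epsilon> + b * (LINT z|N. w z)"
    using assms by (simp add: prob_space)
  also have "\<dots> \<le> \<epsilon> + b * C" using assms by (simp add: mult_left_mono)
  finally show ?thesis .
qed

text \<open>Folding the plane into a box by \<open>x \<mapsto> arcsin (sin (\<omega> x)) / \<omega>\<close> turns a bounded continuous
  function into a continuous function of \<open>sin (\<omega> x)\<close> and \<open>sin (\<omega> y)\<close>, hence by Weierstrass into a
  uniform limit of trigonometric polynomials; outside the box the second moments control the
  error.\<close>

theorem weak_conv_2d_if_char2:
  fixes N :: "nat \<Rightarrow> (real \<times> real) measure"
  assumes N: "\<And>n. prob_space (N n)" "\<And>n. sets (N n) = sets borel"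
    and L: "prob_space L" "sets L = sets borel"
    and char: "\<And>s t. (\<lambda>n. char2 (N n) s t) \<longlonglongrightarrow> char2 L s t"
    and mN: "\<And>n. integrable (N n) (\<lambda>z. (fst z)\<^sup>2 + (snd z)\<^sup>2)"
      "\<And>n. (LINT z|N n. (fst z)\<^sup>2 + (snd z)\<^sup>2) \<le> C"
    and mL: "integrable L (\<lambda>z. (fst z)\<^sup>2 + (snd z)\<^sup>2)" "(LINT z|L. (fst z)\<^sup>2 + (snd z)\<^sup>2) \<le> C"
  shows "weak_conv_2d N L"
  unfolding weak_conv_2d_def
proof (intro allI impI, elim conjE)
  fix f :: "real \<times> real \<Rightarrow> real"
  assume cont: "continuous_on UNIV f" and bdd: "bounded (range f)"
  obtain B where B: "B > 0" "\<And>z. \<bar>f z\<bar> \<le> B"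
    using bdd unfolding bounded_pos by auto
  let ?w = "\<lambda>z :: real \<times> real. (fst z)\<^sup>2 + (snd z)\<^sup>2"
  have int_f: "integrable M f" if "prob_space M" "sets M = sets borel" for M
  proof -
    interpret prob_space M by fact
    have "f \<in> borel_measurable M"
      using borel_measurable_continuous_onI[OF cont] measurable_cong_sets[OF that(2) refl] by blast
    then show ?thesis using B by (intro integrable_const_bound[where B = B]) auto
  qed
  have C: "C \<ge> 0"
    using mL(2) by (rule order_trans[rotated]) (intro Bochner_Integration.integral_nonneg, simp)
  show "(\<lambda>n. LINT z|N n. f z) \<longlonglongrightarrow> (LINT z|L. f z)"
  proof (rule LIMSEQ_I)
    fix \<epsilon> :: real assume eps: "\<epsilon> > 0"
    \<comment> \<open>Three errors enter: \<open>2 * \<delta>\<close> for each of the two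
      replacements of \<open>f\<close> by \<open>Q\<close>, and \<open>\<delta>\<close> for the
      convergence of the integrals of \<open>Q\<close>; the total \<open>5 * \<delta>\<close> is
      below \<open>\<epsilon>\<close>.\<close>
    define \<delta> where "\<delta> = \<epsilon> / 6"
    have \<delta>: "\<delta> > 0" using eps by (simp add: \<delta>_def)
    \<comment> \<open>Makes the second-moment bound for the part outside the box at most
      \<open>\<delta>\<close>; \<open>C + 1\<close> keeps \<open>R\<close> positive when
      \<open>C\<close> is 0.\<close>
    define R where "R = sqrt (2 * B * (C + 1) / \<delta>)"
    have R: "R > 0" unfolding R_def using B C \<delta> by simp
    have R2: "2 * B / R\<^sup>2 * C \<le> \<delta>"
    proof -
      have "R\<^sup>2 = 2 * B * (C + 1) / \<delta>" unfolding R_def using B C \<delta> by simp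
      then have "2 * B * C \<le> \<delta> * R\<^sup>2" using B C \<delta> by (simp add: field_simps)
      then show ?thesis using R by (simp add: divide_simps)
    qed
    \<comment> \<open>Scales the interval from \<open>- R\<close> to \<open>R\<close> to the one
      from \<open>- pi / 2\<close> to \<open>pi / 2\<close>, on which \<open>arcsin\<close> inverts
      \<open>sin\<close>.\<close>
    define \<omega> where "\<omega> = pi / (2 * R)"
    have \<omega>: "\<omega> > 0" using R by (simp add: \<omega>_def)
    let ?K = "{-1..1 :: real} \<times> {-1..1 :: real}"
    define G where "G q = f (arcsin (fst q) / \<omega>, arcsin (snd q) / \<omega>)" for q
    have "continuous_on ?K G" unfolding G_def
      using \<omega> by (intro continuous_on_compose2[OF cont] continuous_intros) auto
    moreover have "compact ?K" by (intro compact_Times compact_Icc)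
    ultimately obtain P where P: "real_polynomial_function P" "\<And>q. q \<in> ?K \<Longrightarrow> \<bar>G q - P q\<bar> < \<delta>"
      using Stone_Weierstrass_real_polynomial_function[of ?K G \<delta>] \<delta> by metis
    define Q where "Q z = P (sin (\<omega> * fst z), sin (\<omega> * snd z))" for z :: "real \<times> real"
    have trig: "trig_poly (\<lambda>z. complex_of_real (Q z))"
      unfolding Q_def by (rule trig_poly_real_polynomial_function[OF P(1)])
    have int_Q: "integrable M Q" if "prob_space M" "sets M = sets borel" for M
      using trig_poly_integrable[OF that trig] by (simp add: complex_of_real_integrable_eq)
    have fold: "arcsin (sin (\<omega> * x)) / \<omega> = x" if "\<bar>x\<bar> \<le> R" for x
    proof -
      have "\<bar>\<omega> * x\<bar> \<le> \<omega> * R" using that \<omega> by (simp add: abs_mult)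
      also have "\<omega> * R = pi / 2" using R by (simp add: \<omega>_def)
      finally have "arcsin (sin (\<omega> * x)) = \<omega> * x" by (intro arcsin_sin) auto
      then show ?thesis using \<omega> by simp
    qed
    have close: "\<bar>f z - Q z\<bar> \<le> \<delta> + (2 * B / R\<^sup>2) * ?w z" for z
    proof -
      let ?q = "(sin (\<omega> * fst z), sin (\<omega> * snd z))"
      have "?q \<in> ?K" by auto
      then have 1: "\<bar>G ?q - Q z\<bar> < \<delta>" unfolding Q_def by (rule P(2))
      have 2: "\<bar>f z - G ?q\<bar> \<le> (2 * B / R\<^sup>2) * ?w z"
      proof (cases "\<bar>fst z\<bar> \<le> R \<and> \<bar>snd z\<bar> \<le> R")
        case True
        then have "G ?q = f z" unfolding G_def by (simp add: fold)
        then show ?thesis using B by simp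
      next
        case False
        \<comment> \<open>Outside the box \<open>?w z / R\<^sup>2\<close> is at least 1 and
          therefore pays for the trivial bound \<open>2 * B\<close>.\<close>
        then have "R\<^sup>2 \<le> (fst z)\<^sup>2 \<or> R\<^sup>2 \<le> (snd z)\<^sup>2"
          using R by (auto simp: abs_le_square_iff[symmetric])
        then have "R\<^sup>2 \<le> ?w z" using zero_le_power2[of "fst z"] zero_le_power2[of "snd z"] by linarith
        then have "2 * B * 1 \<le> 2 * B * (?w z / R\<^sup>2)"
          using R B by (intro mult_left_mono) auto
        moreover have "\<bar>f z - G ?q\<bar> \<le> 2 * B"
          unfolding G_def using B(2)[of z] B(2)[of "(arcsin (fst ?q) / \<omega>, arcsin (snd ?q) / \<omega>)"] by linarith
        ultimately show ?thesis by simp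
      qed
      show ?thesis using 1 2 by linarith
    qed
    have bound: "\<bar>(LINT z|M. f z) - (LINT z|M. Q z)\<bar> \<le> 2 * \<delta>"
      if "prob_space M" "sets M = sets borel" "integrable M ?w" "(LINT z|M. ?w z) \<le> C" for M
    proof -
      have "\<bar>(LINT z|M. f z) - (LINT z|M. Q z)\<bar> \<le> \<delta> + 2 * B / R\<^sup>2 * C"
        using int_f[OF that(1,2)] int_Q[OF that(1,2)] close that B
        by (intro integral_diff_le[where w = ?w]) auto
      then show ?thesis using R2 by linarith
    qed
    have "(\<lambda>n. complex_of_real (LINT z|N n. Q z)) \<longlonglongrightarrow> complex_of_real (LINT z|L. Q z)"
      using trig_poly_integral_tendsto[OF N L char trig] by simp
    then have "(\<lambda>n. LINT z|N n. Q z) \<longlonglongrightarrow> (LINT z|L. Q z)"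
      by (simp only: tendsto_of_real_iff)
    then obtain n0 where n0: "\<And>n. n \<ge> n0 \<Longrightarrow> \<bar>(LINT z|N n. Q z) - (LINT z|L. Q z)\<bar> < \<delta>"
      using LIMSEQ_D[OF _ \<delta>] by (metis real_norm_def)
    have "norm ((LINT z|N n. f z) - (LINT z|L. f z)) < \<epsilon>" if "n \<ge> n0" for n
      using n0[OF that] bound[OF N mN, of n] bound[OF L mL] \<delta> unfolding real_norm_def \<delta>_def by linarith
    then show "\<exists>no. \<forall>n\<ge>no. norm ((LINT z|N n. f z) - (LINT z|L. f z)) < \<epsilon>" by blast
  qed
qed

text \<open>The test functions of \<open>weak_conv_2d\<close> are real, hence the split into cosine
  and sine.\<close>

lemma char2_tendsto_if_weak_conv_2d:
  assumes N: "\<And>n. prob_space (N n)" "\<And>n. sets (N n) = sets (borel :: (real \<times> real) measure)"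
    and L: "prob_space L" "sets L = sets (borel :: (real \<times> real) measure)"
    and conv: "weak_conv_2d N L"
  shows "(\<lambda>n. char2 (N n) s t) \<longlonglongrightarrow> char2 L s t"
proof -
  let ?a = "\<lambda>z :: real \<times> real. s * fst z + t * snd z"
  have split: "char2 M s t = complex_of_real (LINT z|M. cos (?a z)) + \<i> * complex_of_real (LINT z|M. sin (?a z))"
    if "prob_space M" "sets M = sets borel" for M
  proof -
    interpret prob_space M by fact
    have "(\<lambda>z. cos (?a z)) \<in> borel_measurable borel" "(\<lambda>z. sin (?a z)) \<in> borel_measurable borel"
      by (intro borel_measurable_continuous_onI continuous_intros)+
    then have "(\<lambda>z. cos (?a z)) \<in> borel_measurable M" "(\<lambda>z. sin (?a z)) \<in> borel_measurable M"
      using measurable_cong_sets[OF that(2) refl] by blast+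
    then have i: "integrable M (\<lambda>z. cos (?a z))" "integrable M (\<lambda>z. sin (?a z))"
      by (auto intro!: integrable_const_bound[where B = 1])
    have "char2 M s t = (CLINT z|M. complex_of_real (cos (?a z)) + \<i> * complex_of_real (sin (?a z)))"
      unfolding char2_def iexp_eq_cos_sin ..
    also have "\<dots> = complex_of_real (LINT z|M. cos (?a z)) + \<i> * complex_of_real (LINT z|M. sin (?a z))"
      using i by (subst Bochner_Integration.integral_add) (auto simp: complex_of_real_integrable_eq)
    finally show ?thesis .
  qed
  have "bounded (range (\<lambda>z. cos (?a z)))" "bounded (range (\<lambda>z. sin (?a z)))"
    unfolding bounded_iff by (auto intro!: exI[of _ 1])
  moreover have "continuous_on UNIV (\<lambda>z. cos (?a z))" "continuous_on UNIV (\<lambda>z. sin (?a z))"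
    by (intro continuous_intros)+
  ultimately have "(\<lambda>n. LINT z|N n. cos (?a z)) \<longlonglongrightarrow> (LINT z|L. cos (?a z))"
    "(\<lambda>n. LINT z|N n. sin (?a z)) \<longlonglongrightarrow> (LINT z|L. sin (?a z))"
    using conv unfolding weak_conv_2d_def by blast+
  then show ?thesis unfolding split[OF N] split[OF L] by (intro tendsto_intros)
qed

lemma char2_pair_measure:
  assumes "real_distribution \<mu>" "real_distribution \<nu>"
  shows "char2 (\<mu> \<Otimes>\<^sub>M \<nu>) s t = char \<mu> s * char \<nu> t"
proof -
  interpret \<mu>: real_distribution \<mu> by fact
  interpret \<nu>: real_distribution \<nu> by fact
  interpret pair_prob_space \<mu> \<nu> ..
  have "integrable (\<mu> \<Otimes>\<^sub>M \<nu>) (\<lambda>(x, y). iexp (s * x) * iexp (t * y))"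
    by (rule integrable_const_bound[where B = 1]) (auto simp: norm_mult)
  from integral_fst'[OF this] have "(CLINT z|\<mu> \<Otimes>\<^sub>M \<nu>. iexp (s * fst z) * iexp (t * snd z)) =
    (CLINT x|\<mu>. CLINT y|\<nu>. iexp (s * x) * iexp (t * y))" by (simp add: case_prod_unfold)
  also have "\<dots> = char \<mu> s * char \<nu> t" unfolding char_def by simp
  finally show ?thesis unfolding char2_def by (simp add: distrib_left exp_add)
qed

section \<open>Geometric ergodicity\<close>

text \<open>The nonnegative differences \<open>D\<close> of elements of \<open>A\<close> behave like
  a subgroup, so their least positive element \<open>d\<close> divides all of \<open>A\<close> and
  must be 1. Thus \<open>A\<close> contains two consecutive numbers \<open>b\<close> and
  \<open>b + 1\<close>, and these generate everything from \<open>b * b\<close> on.\<close>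

lemma additive_nat_set_cofinite:
  fixes A :: "nat set"
  assumes zero: "0 \<in> A" and add: "\<And>a b. a \<in> A \<Longrightarrow> b \<in> A \<Longrightarrow> a + b \<in> A" and gcd: "Gcd A = 1"
  obtains N where "\<And>n. n \<ge> N \<Longrightarrow> n \<in> A"
proof -
  have mult: "k * a \<in> A" if "a \<in> A" for k a
    by (induction k) (use that zero add in auto)
  define D where "D = {x. \<exists>b\<in>A. b + x \<in> A}"
  have A_D: "a \<in> D" if "a \<in> A" for a unfolding D_def using that zero by (auto intro!: bexI[of _ 0])
  have D_add: "x + y \<in> D" if D: "x \<in> D" "y \<in> D" for x y
  proof -
    obtain b c where "b \<in> A" "b + x \<in> A" "c \<in> A" "c + y \<in> A" using D unfolding D_def by blast
    then have "b + c \<in> A" "(b + x) + (c + y) \<in> A" using add by blast+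
    moreover have "(b + x) + (c + y) = (b + c) + (x + y)" by simp
    ultimately show ?thesis unfolding D_def by auto
  qed
  have D_diff: "x \<in> D" if D: "x + y \<in> D" "y \<in> D" for x y
  proof -
    obtain b c where "b \<in> A" "b + (x + y) \<in> A" "c \<in> A" "c + y \<in> A" using D unfolding D_def by blast
    then have "b + (c + y) \<in> A" "c + (b + (x + y)) \<in> A" using add by blast+
    moreover have "c + (b + (x + y)) = (b + (c + y)) + x" by simp
    ultimately show ?thesis unfolding D_def by auto
  qed
  have D_mult: "k * x \<in> D" if "x \<in> D" for k x
    by (induction k) (use that D_add A_D[OF zero] in auto)
  have "\<exists>d. d \<in> D \<and> d > 0"
  proof (rule ccontr)
    assume "\<not> (\<exists>d. d \<in> D \<and> d > 0)"
    then have "A \<subseteq> {0}" using A_D by auto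
    then show False using gcd by (metis Gcd_0_iff zero_neq_one)
  qed
  then have d: "(LEAST d. d \<in> D \<and> d > 0) \<in> D \<and> (LEAST d. d \<in> D \<and> d > 0) > 0" by (rule LeastI_ex)
  define d where "d = (LEAST d. d \<in> D \<and> d > 0)"
  have d: "d \<in> D" "d > 0" using d unfolding d_def by auto
  have "d dvd a" if "a \<in> A" for a
  proof -
    have "a mod d + (a div d) * d \<in> D" using A_D[OF that] by simp
    then have "a mod d \<in> D" by (rule D_diff) (rule D_mult[OF d(1)])
    moreover have "\<not> (a mod d \<in> D \<and> a mod d > 0)"
      by (rule not_less_Least) (use d in \<open>simp add: d_def[symmetric]\<close>)
    ultimately have "a mod d = 0" by simp
    then show ?thesis by auto
  qed
  then have "d dvd Gcd A" by (rule Gcd_greatest)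
  then have "d = 1" using gcd by simp
  then obtain b where b: "b \<in> A" "b + 1 \<in> A" using d unfolding D_def by auto
  show ?thesis
  \<comment> \<open>Let \<open>q\<close> and \<open>r\<close> be quotient and remainder of
    \<open>n\<close> by \<open>b\<close>. Then \<open>n = (q - r) * b + r * (b + 1)\<close>, and for
    positive \<open>b\<close> the bound \<open>b * b\<close> gives
    \<open>q \<ge> b > r\<close>.\<close>
  proof (rule that[of "b * b"])
    fix n assume n: "b * b \<le> n"
    show "n \<in> A"
    proof (cases "b = 0")
      case True
      then show ?thesis using mult[OF b(2), of n] by simp
    next
      case False
      have r: "n mod b < b" using False by simp
      also have "b \<le> n div b" using n False by (simp add: less_eq_div_iff_mult_less_eq)
      finally have le: "n mod b \<le> n div b" by simp
      have "n = (n div b) * b + n mod b" by simp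
      also have "\<dots> = (n div b - n mod b) * b + (n mod b) * (b + 1)"
        using le by (simp add: diff_mult_distrib algebra_simps)
      finally have "n = (n div b - n mod b) * b + (n mod b) * (b + 1)" .
      then show ?thesis using add[OF mult[OF b(1)] mult[OF b(2)]] by metis
    qed
  qed
qed

text \<open>Each power occurs \<open>N\<close> times, so the partial sums are at most
  \<open>N\<close> times the geometric series.\<close>

lemma summable_power_div:
  fixes r :: real
  assumes "0 \<le> r" "r < 1" "0 < N"
  shows "summable (\<lambda>n. r ^ (n div N))"
proof (rule summableI_nonneg_bounded)
  show "0 \<le> r ^ (n div N)" for n using assms by simp
  fix n
  have "(\<Sum>i<n. r ^ (i div N)) \<le> (\<Sum>i<n * N. r ^ (i div N))"
    using assms by (intro sum_mono2) auto
  also have "\<dots> = (\<Sum>m<n. \<Sum>i = m * N..<m * N + N. r ^ (i div N))"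
    by (rule sum.nat_group[symmetric])
  also have "\<dots> = (\<Sum>m<n. \<Sum>i = m * N..<m * N + N. r ^ m)"
  proof (intro sum.cong refl)
    fix m i assume "i \<in> {m * N..<m * N + N}"
    then have "i div N = m" by (intro div_nat_eqI) (auto simp: algebra_simps)
    then show "r ^ (i div N) = r ^ m" by simp
  qed
  also have "\<dots> = real N * (\<Sum>m<n. r ^ m)" by (simp add: sum_distrib_left)
  also have "\<dots> \<le> real N * (1 / (1 - r))"
    using assms sum_le_suminf[OF summable_geometric[of r], of "{..<n}"] suminf_geometric[of r]
    by (intro mult_left_mono) auto
  finally show "(\<Sum>i<n. r ^ (i div N)) \<le> real N * (1 / (1 - r))" .
qed

section \<open>Contraction of the transition operator\<close>

context finite_markov_chain
begin

text \<open>The transition operator; its \<open>n\<close>-th power is the expectation over the state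
  after \<open>n\<close> steps, see \<open>path_exp_awlast\<close>.\<close>

definition step_op :: "(nat \<Rightarrow> real) \<Rightarrow> nat \<Rightarrow> real" where
  "step_op f x = (\<Sum>e\<in>out_arcs G x. p e * f (head G e))"

lemma step_op_mono:
  assumes "\<And>x. x \<in> verts G \<Longrightarrow> f x \<le> g x" "x \<in> verts G"
  shows "step_op f x \<le> step_op g x"
  unfolding step_op_def using assms p_pos by (intro sum_mono mult_left_mono) (auto simp: less_imp_le)

lemma step_op_const: "x \<in> verts G \<Longrightarrow> step_op (\<lambda>_. c) x = c"
  unfolding step_op_def using p_sum by (simp add: sum_distrib_right[symmetric])

lemma step_op_cong:
  assumes "\<And>x. x \<in> verts G \<Longrightarrow> f x = g x"
  shows "step_op f x = step_op g x"
  unfolding step_op_def using assms by (intro sum.cong refl) simp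

lemma step_op_affine: "x \<in> verts G \<Longrightarrow> step_op (\<lambda>y. b + c * f y) x = b + c * step_op f x"
  unfolding step_op_def using p_sum
  by (simp add: sum.distrib algebra_simps sum_distrib_left[symmetric])

lemma step_op_pow_affine:
  "x \<in> verts G \<Longrightarrow> (step_op ^^ n) (\<lambda>y. b + c * f y) x = b + c * (step_op ^^ n) f x"
proof (induction n arbitrary: x)
  case (Suc n)
  have "(step_op ^^ Suc n) (\<lambda>y. b + c * f y) x = step_op (\<lambda>y. b + c * (step_op ^^ n) f y) x"
    using step_op_cong[OF Suc.IH] by simp
  then show ?case using step_op_affine[OF Suc.prems] by simp
qed simp

lemma step_op_pow_nonneg:
  assumes "\<And>x. x \<in> verts G \<Longrightarrow> 0 \<le> f x" "x \<in> verts G"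
  shows "0 \<le> (step_op ^^ n) f x"
  using assms(2)
proof (induction n arbitrary: x)
  case (Suc n)
  then show ?case using step_op_mono[of "\<lambda>_. 0" "(step_op ^^ n) f" x] step_op_const[of x 0] by simp
qed (use assms in simp)

text \<open>The oscillation vanishes on constants, which \<open>step_op\<close> fixes; only modulo
  constants can the operator contract.\<close>

definition osc_le :: "(nat \<Rightarrow> real) \<Rightarrow> real \<Rightarrow> bool" where
  "osc_le f c \<longleftrightarrow> (\<forall>x\<in>verts G. \<forall>y\<in>verts G. f x - f y \<le> c)"

lemma osc_leD: "osc_le f c \<Longrightarrow> x \<in> verts G \<Longrightarrow> y \<in> verts G \<Longrightarrow> \<bar>f x - f y\<bar> \<le> c"
  unfolding osc_le_def by (auto simp: abs_le_iff)

lemma ex_osc_le: "\<exists>c\<ge>0. osc_le f c"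
proof -
  let ?c = "Max (f ` verts G) - Min (f ` verts G)"
  have "osc_le f ?c" unfolding osc_le_def using Max_ge[of "f ` verts G"] Min_le[of "f ` verts G"]
    by (force intro!: diff_mono)
  moreover have "?c \<ge> 0" using osc_leD[OF \<open>osc_le f ?c\<close> initial initial] by simp
  ultimately show ?thesis by blast
qed

lemma step_op_pow_ge_awalk:
  assumes "awalk x w r" "\<And>x. x \<in> verts G \<Longrightarrow> 0 \<le> f x"
  shows "(\<Prod>e\<leftarrow>w. p e) * f r \<le> (step_op ^^ length w) f x"
  using assms(1)
proof (induction w arbitrary: x)
  case Nil
  then show ?case by (simp add: awalk_Nil_iff)
next
  case (Cons e w)
  have e: "e \<in> out_arcs G x" "e \<in> arcs G" and w: "awalk (head G e) w r"
    using Cons.prems by (auto simp: awalk_Cons_iff)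
  have "(\<Prod>e\<leftarrow>e # w. p e) * f r = p e * ((\<Prod>e\<leftarrow>w. p e) * f r)" by simp
  also have "\<dots> \<le> p e * (step_op ^^ length w) f (head G e)"
    using Cons.IH[OF w] p_pos[OF e(2)] by (intro mult_left_mono) auto
  also have "\<dots> \<le> (\<Sum>e\<in>out_arcs G x. p e * (step_op ^^ length w) f (head G e))"
  proof (rule member_le_sum[OF e(1)])
    fix e' assume "e' \<in> out_arcs G x - {e}"
    then show "0 \<le> p e' * (step_op ^^ length w) f (head G e')"
      using p_pos step_op_pow_nonneg[of f] assms(2) by (intro mult_nonneg_nonneg) (auto simp: less_imp_le)
  qed (rule finite_out_arcs)
  also have "\<dots> = step_op ((step_op ^^ length w) f) x" by (rule step_op_def[symmetric])
  finally show ?case by simp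
qed

text \<open>Doeblin's argument: from every state, \<open>r\<close> is hit after exactly
  \<open>N\<close> steps with probability at least \<open>\<delta>\<close>. A share
  \<open>\<delta>\<close> of all \<open>N\<close>-step laws thus coincides and drops out of
  differences.\<close>

lemma osc_decay:
  assumes r: "r \<in> verts G" and N: "0 < N" and walks: "\<And>x. x \<in> verts G \<Longrightarrow> \<exists>w. awalk x w r \<and> length w = N"
  obtains \<beta> where "summable \<beta>" "\<And>n. 0 \<le> \<beta> n" "\<And>f c n. osc_le f c \<Longrightarrow> osc_le ((step_op ^^ n) f) (c * \<beta> n)"
proof -
  obtain W where W: "\<And>x. x \<in> verts G \<Longrightarrow> awalk x (W x) r" "\<And>x. x \<in> verts G \<Longrightarrow> length (W x) = N"
    using walks by metis
  define \<delta> where "\<delta> = Min ((\<lambda>x. \<Prod>e\<leftarrow>W x. p e) ` verts G)"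
  have wpos: "0 < (\<Prod>e\<leftarrow>w. p e)" if "set w \<subseteq> arcs G" for w
    using that by (induction w) (auto simp: p_pos)
  have ne: "verts G \<noteq> {}" using initial by auto
  have \<delta>_pos: "\<delta> > 0" unfolding \<delta>_def
    using ne W(1) by (subst Min_gr_iff) (auto intro!: wpos simp: awalk_def)
  have minor: "\<delta> * f r \<le> (step_op ^^ N) f x" if "x \<in> verts G" "\<And>x. x \<in> verts G \<Longrightarrow> 0 \<le> f x" for f x
  proof -
    have "\<delta> \<le> (\<Prod>e\<leftarrow>W x. p e)" unfolding \<delta>_def using that by (intro Min_le) auto
    then have "\<delta> * f r \<le> (\<Prod>e\<leftarrow>W x. p e) * f r" using that(2)[OF r] by (intro mult_right_mono)
    also have "\<dots> \<le> (step_op ^^ N) f x" using step_op_pow_ge_awalk[OF W(1)[OF that(1)] that(2)] W(2) that(1) by simp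
    finally show ?thesis .
  qed
  \<comment> \<open>Minorisation of the constant 1, which the operator fixes.\<close>
  have "\<delta> \<le> 1"
    using minor[OF initial, of "\<lambda>_. 1"] step_op_pow_affine[OF initial, of N 1 0 "\<lambda>_. 0"] by simp
  have contract: "osc_le ((step_op ^^ N) f) ((1 - \<delta>) * c)" if c: "osc_le f c" for f c
    unfolding osc_le_def
  proof (intro ballI)
    fix x y assume xy: "x \<in> verts G" "y \<in> verts G"
    define a b where "a = Min (f ` verts G)" and "b = Max (f ` verts G)"
    have ab: "a \<le> f z" "f z \<le> b" if "z \<in> verts G" for z unfolding a_def b_def using that by auto
    have "a \<in> f ` verts G" "b \<in> f ` verts G" unfolding a_def b_def using ne by (auto intro: Min_in Max_in)
    then have bac: "b - a \<le> c" using c unfolding osc_le_def by auto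
    \<comment> \<open>The minorisation is for nonnegative functions, so it is applied to
      \<open>b - f\<close> at \<open>x\<close> and to \<open>f - a\<close> at \<open>y\<close>; the
      value \<open>f r\<close> cancels in the sum.\<close>
    have "\<delta> * (b + (-1) * f r) \<le> (step_op ^^ N) (\<lambda>z. b + (-1) * f z) x"
      by (rule minor[OF xy(1)]) (use ab in auto)
    then have 1: "\<delta> * (b - f r) \<le> b - (step_op ^^ N) f x" using step_op_pow_affine[OF xy(1), of N b "-1" f] by simp
    have "\<delta> * ((- a) + 1 * f r) \<le> (step_op ^^ N) (\<lambda>z. (- a) + 1 * f z) y"
      by (rule minor[OF xy(2)]) (use ab in auto)
    then have 2: "\<delta> * (f r - a) \<le> (step_op ^^ N) f y - a" using step_op_pow_affine[OF xy(2), of N "- a" 1 f] by simp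
    have "(step_op ^^ N) f x - (step_op ^^ N) f y \<le> (b - a) - (\<delta> * (b - f r) + \<delta> * (f r - a))" using 1 2 by linarith
    also have "\<dots> = (1 - \<delta>) * (b - a)" by (simp add: algebra_simps)
    also have "\<dots> \<le> (1 - \<delta>) * c" using bac \<open>\<delta> \<le> 1\<close> by (intro mult_left_mono) auto
    finally show "(step_op ^^ N) f x - (step_op ^^ N) f y \<le> (1 - \<delta>) * c" .
  qed
  have step: "osc_le (step_op f) c" if c: "osc_le f c" for f c
    unfolding osc_le_def
  proof (intro ballI)
    fix x y assume xy: "x \<in> verts G" "y \<in> verts G"
    have "step_op f x \<le> step_op (\<lambda>_. Max (f ` verts G)) x" by (rule step_op_mono) (use xy in auto)
    moreover have "step_op (\<lambda>_. Min (f ` verts G)) y \<le> step_op f y" by (rule step_op_mono) (use xy in auto)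
    moreover have "Max (f ` verts G) \<in> f ` verts G" "Min (f ` verts G) \<in> f ` verts G"
      using ne by (auto intro: Min_in Max_in)
    then have "Max (f ` verts G) - Min (f ` verts G) \<le> c" using c unfolding osc_le_def by auto
    ultimately show "step_op f x - step_op f y \<le> c" using step_op_const xy by simp
  qed
  \<comment> \<open>Between multiples of \<open>N\<close> the oscillation at least does not
    grow.\<close>
  have steps: "osc_le ((step_op ^^ m) f) c" if "osc_le f c" for f c m
    by (induction m) (use that step in auto)
  have blocks: "osc_le ((step_op ^^ (k * N)) f) (c * (1 - \<delta>) ^ k)" if "osc_le f c" for f c k
  proof (induction k)
    case (Suc k)
    have "(step_op ^^ (Suc k * N)) f = (step_op ^^ N) ((step_op ^^ (k * N)) f)" by (simp add: funpow_add)
    then show ?case using contract[OF Suc] by (simp add: algebra_simps)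
  qed (use that in simp)
  define \<beta> where "\<beta> n = (1 - \<delta>) ^ (n div N)" for n
  show ?thesis
  proof (rule that)
    show "summable \<beta>" unfolding \<beta>_def by (rule summable_power_div) (use \<delta>_pos \<open>\<delta> \<le> 1\<close> N in auto)
    show "0 \<le> \<beta> n" for n unfolding \<beta>_def using \<open>\<delta> \<le> 1\<close> by simp
    fix f c n assume "osc_le f c"
    have "(step_op ^^ n) f = (step_op ^^ (n mod N)) ((step_op ^^ (n div N * N)) f)"
      using funpow_add[of "n mod N" "n div N * N" step_op] by simp
    then show "osc_le ((step_op ^^ n) f) (c * \<beta> n)"
      unfolding \<beta>_def using steps[OF blocks[OF \<open>osc_le f c\<close>]] by simp
  qed
qed

end

section \<open>The Poisson equation\<close>

locale ergodic_chain = finite_markov_chain G M p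
  for G :: "(nat, 'e) pre_digraph" and M :: nat and p :: "'e \<Rightarrow> real" +
  assumes fin_conn: "finally_connected G" and fin_aper: "finally_aperiodic G"
begin

section \<open>The final component as the unique sink\<close>

definition S where
  "S = (THE S. S \<in> verts (condensation G) \<and> out_degree (condensation G) S = 0)"

abbreviation F where "F \<equiv> G \<restriction> S"

lemma final_component_eq: "final_component G = F"
  unfolding final_component_def S_def ..

lemma S_sink: "S \<in> sccs_verts" "out_degree (condensation G) S = 0"
  and S_unique: "\<And>T. T \<in> sccs_verts \<Longrightarrow> out_degree (condensation G) T = 0 \<Longrightarrow> T = S"
proof -
  have ex1: "\<exists>!S. S \<in> verts (condensation G) \<and> out_degree (condensation G) S = 0"
    using fin_conn unfolding finally_connected_def .
  have v: "verts (condensation G) = sccs_verts" by (simp add: condensation_def)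
  from theI'[OF ex1] show "S \<in> sccs_verts" "out_degree (condensation G) S = 0"
    unfolding S_def v by auto
  show "T = S" if "T \<in> sccs_verts" "out_degree (condensation G) T = 0" for T
    unfolding S_def using the1_equality[OF ex1, of T] that by (simp add: v)
qed

lemma sccs_verts_subset:
  assumes "T \<in> sccs_verts"
  shows "T \<subseteq> verts G"
  using assms reachable_in_verts unfolding sccs_verts_def by blast

lemma S_subset: "S \<subseteq> verts G"
  by (rule sccs_verts_subset[OF S_sink(1)])

lemma S_nonempty: "S \<noteq> {}"
  using S_sink(1) unfolding sccs_verts_def by auto

lemma S_closed:
  assumes "e \<in> arcs G" "tail G e \<in> S"
  shows "head G e \<in> S"
proof (rule ccontr)
  assume no: "head G e \<notin> S"
  let ?T = "scc_of (head G e)"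
  have T: "?T \<in> sccs_verts" "head G e \<in> ?T"
    using scc_of_in_sccs_verts in_scc_of_self assms(1) by auto
  have "(S, ?T) \<in> out_arcs (condensation G) S"
    using T no assms S_sink(1) by (auto simp: condensation_def out_arcs_def)
  \<comment> \<open>\<open>out_degree\<close> is a cardinality and would be 0 for an infinite set as
    well.\<close>
  moreover have "finite (out_arcs (condensation G) S)"
  proof (rule finite_subset)
    show "out_arcs (condensation G) S \<subseteq> Pow (verts G) \<times> Pow (verts G)"
      using sccs_verts_subset by (auto simp: condensation_def out_arcs_def dest!: sccs_verts_subset)
  qed simp
  ultimately show False using S_sink(2) unfolding out_degree_def by (metis card_0_eq empty_iff)
qed

lemma S_reach: "x \<in> S \<Longrightarrow> y \<in> S \<Longrightarrow> x \<rightarrow>\<^sup>*\<^bsub>G\<^esub> y"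
  using S_sink(1) unfolding sccs_verts_def by auto

text \<open>Among the states reachable from \<open>x\<close>, take \<open>y\<close> with the fewest
  reachable states. It can be reached back from each of them, so its reachable set is a component
  without outgoing arcs, and the only such component is \<open>S\<close>.\<close>

lemma reaches_S:
  assumes "x \<in> verts G"
  obtains y where "y \<in> S" "x \<rightarrow>\<^sup>*\<^bsub>G\<^esub> y"
proof -
  let ?R = "\<lambda>y. {z. y \<rightarrow>\<^sup>*\<^bsub>G\<^esub> z}"
  have fin: "finite (?R y)" for y
    by (rule finite_subset[OF _ finite_verts]) (auto dest: reachable_in_verts)
  obtain y where y: "x \<rightarrow>\<^sup>*\<^bsub>G\<^esub> y" and min: "\<And>z. x \<rightarrow>\<^sup>*\<^bsub>G\<^esub> z \<Longrightarrow> card (?R y) \<le> card (?R z)"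
    using ex_has_least_nat[of "\<lambda>y. x \<rightarrow>\<^sup>*\<^bsub>G\<^esub> y" x "\<lambda>y. card (?R y)"] assms by auto
  have yv: "y \<in> verts G" using y reachable_in_verts by auto
  have ret: "z \<rightarrow>\<^sup>*\<^bsub>G\<^esub> y" if "y \<rightarrow>\<^sup>*\<^bsub>G\<^esub> z" for z
  proof -
    have sub: "?R z \<subseteq> ?R y" using that reachable_trans by blast
    have "x \<rightarrow>\<^sup>*\<^bsub>G\<^esub> z" using y that reachable_trans by blast
    then have "?R z = ?R y" using card_seteq[OF fin sub] min by blast
    then show ?thesis using yv by auto
  qed
  have eq: "scc_of y = ?R y" unfolding scc_of_def using ret by auto
  have scc: "scc_of y \<in> sccs_verts" by (rule scc_of_in_sccs_verts[OF yv])
  have "out_arcs (condensation G) (scc_of y) = {}"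
  proof (rule ccontr)
    assume "out_arcs (condensation G) (scc_of y) \<noteq> {}"
    then obtain T e where T: "T \<in> sccs_verts" "scc_of y \<noteq> T" "e \<in> arcs G" "tail G e \<in> scc_of y" "head G e \<in> T"
      by (auto simp: condensation_def out_arcs_def)
    have "tail G e \<rightarrow>\<^bsub>G\<^esub> head G e" using T(3) by (rule in_arcs_imp_in_arcs_ends)
    then have "head G e \<in> scc_of y" using T(4) unfolding eq using reachable_adj_trans by blast
    then have "scc_of y = T" using sccs_verts_disjoint[OF scc T(1)] T(5) by blast
    then show False using T(2) by simp
  qed
  then have "scc_of y = S" using S_unique[OF scc] by (simp add: out_degree_def)
  moreover have "y \<in> scc_of y" unfolding eq using yv by simp
  ultimately show ?thesis using that y by blast
qed

lemma out_arcs_F: "x \<in> S \<Longrightarrow> out_arcs F x = out_arcs G x"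
  using S_closed by (auto simp: out_arcs_def)

lemma subgraph_F: "subgraph F G"
  by (rule subgraph_induce_subgraphI[OF S_subset])

sublocale F: weighted_digraph F p
proof (rule weighted_digraph.intro)
  show "fin_digraph F" by (rule fin_digraph_subgraph[OF subgraph_F])
  show "weighted_digraph_axioms F p"
    by unfold_locales (use p_pos p_sum S_subset in \<open>auto simp: out_arcs_F\<close>)
qed

lemma strongly_connected_F: "strongly_connected F"
proof
  show "verts F \<noteq> {}" using S_nonempty by simp
  fix u v assume "u \<in> verts F" "v \<in> verts F"
  then have u: "u \<in> S" and "u \<rightarrow>\<^sup>*\<^bsub>G\<^esub> v" using S_reach by auto
  then obtain w where w: "awalk u w v" using reachable_awalk by auto
  have "awalk u w v \<Longrightarrow> u \<in> S \<Longrightarrow> F.awalk u w v" for u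
  proof (induction w arbitrary: u)
    case Nil
    then show ?case by (simp add: awalk_Nil_iff F.awalk_Nil_iff)
  next
    case (Cons e w)
    then show ?case using S_closed by (auto simp: awalk_Cons_iff F.awalk_Cons_iff)
  qed
  then have "F.awalk u w v" using w u by blast
  then show "u \<rightarrow>\<^sup>*\<^bsub>F\<^esub> v" by (rule F.reachable_awalkI)
qed

text \<open>The lengths of returns to a state \<open>r\<close> of \<open>S\<close> are closed under
  addition. Any cycle of \<open>F\<close> can be inserted into a return as a detour, so the gcd of
  these lengths divides every cycle length and is 1. Hence all large lengths occur, and they even
  out the different distances of the states to \<open>r\<close>.\<close>

lemma ex_uniform_walks:
  obtains r N where "r \<in> verts G" "0 < N" "\<And>x. x \<in> verts G \<Longrightarrow> \<exists>w. awalk x w r \<and> length w = N"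
proof -
  obtain r where r: "r \<in> S" using S_nonempty by auto
  have rv: "r \<in> verts G" using r S_subset by auto
  define A where "A = {length w | w. awalk r w r}"
  have A0: "0 \<in> A" unfolding A_def using rv by (auto intro!: exI[of _ "[]"] simp: awalk_Nil_iff)
  have Aadd: "a + b \<in> A" if "a \<in> A" "b \<in> A" for a b
  proof -
    obtain v w where "awalk r v r" "awalk r w r" "a = length v" "b = length w"
      using \<open>a \<in> A\<close> \<open>b \<in> A\<close> unfolding A_def by auto
    moreover from this have "awalk r (v @ w) r" by (auto intro: awalk_appendI)
    ultimately show ?thesis unfolding A_def by (auto intro!: exI[of _ "v @ w"])
  qed
  have dvd: "Gcd A dvd length w" if w: "F.cycle w" for w
  proof -
    obtain u where u: "F.awalk u w u" using w unfolding F.cycle_def by auto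
    have uS: "u \<in> S" using F.awalk_hd_in_verts[OF u] by simp
    have u': "awalk u w u" using subgraph_awalk_imp_awalk[OF u subgraph_F] .
    obtain a b where ab: "awalk r a u" "awalk u b r"
      using S_reach[OF r uS] S_reach[OF uS r] reachable_awalk by blast
    have "awalk r (a @ b) r" using ab by (rule awalk_appendI)
    moreover have "awalk r ((a @ w) @ b) r" using awalk_appendI[OF awalk_appendI[OF ab(1) u'] ab(2)] .
    ultimately have "length (a @ b) \<in> A" "length ((a @ w) @ b) \<in> A" unfolding A_def by blast+
    then have "Gcd A dvd length (a @ b)" "Gcd A dvd length ((a @ w) @ b)" by (auto intro: Gcd_dvd)
    moreover have "length ((a @ w) @ b) = length w + length (a @ b)" by simp
    ultimately show ?thesis by (metis dvd_add_left_iff)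
  qed
  have "Gcd A dvd Gcd {length w | w. F.cycle w}" by (rule Gcd_greatest) (use dvd in auto)
  then have "Gcd A = 1" using fin_aper unfolding finally_aperiodic_def final_component_eq by simp
  then obtain N0 where N0: "\<And>n. n \<ge> N0 \<Longrightarrow> n \<in> A" using additive_nat_set_cofinite[OF A0 Aadd] by blast
  have "\<exists>w. awalk x w r" if x: "x \<in> verts G" for x
  proof -
    obtain y where y: "y \<in> S" "x \<rightarrow>\<^sup>*\<^bsub>G\<^esub> y" using reaches_S[OF x] .
    have "x \<rightarrow>\<^sup>*\<^bsub>G\<^esub> r" using reachable_trans[OF y(2) S_reach[OF y(1) r]] .
    then show ?thesis using reachable_awalk by blast
  qed
  then obtain W where W: "\<And>x. x \<in> verts G \<Longrightarrow> awalk x (W x) r" by metis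
  \<comment> \<open>Leaves at least \<open>N0\<close> steps for a return to \<open>r\<close> after
    the walk from any \<open>x\<close>; \<open>Suc\<close> makes \<open>N\<close> positive.\<close>
  define N where "N = Suc N0 + (\<Sum>x\<in>verts G. length (W x))"
  show ?thesis
  proof (rule that[OF rv])
    show "0 < N" unfolding N_def by simp
    fix x assume x: "x \<in> verts G"
    have "length (W x) \<le> (\<Sum>x\<in>verts G. length (W x))" by (rule member_le_sum[OF x]) auto
    then have le: "length (W x) + N0 \<le> N" unfolding N_def by simp
    then have "N - length (W x) \<in> A" by (intro N0) simp
    then obtain v where v: "awalk r v r" "length v = N - length (W x)" unfolding A_def by auto
    have "awalk x (W x @ v) r" using awalk_appendI[OF W[OF x] v(1)] .
    moreover have "length (W x @ v) = N" using v le by simp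
    ultimately show "\<exists>w. awalk x w r \<and> length w = N" by blast
  qed
qed

lemma geometric_ergodicity:
  obtains \<beta> where "summable \<beta>" "\<And>n. 0 \<le> \<beta> n" "\<And>f c n. osc_le f c \<Longrightarrow> osc_le ((step_op ^^ n) f) (c * \<beta> n)"
  using ex_uniform_walks osc_decay by metis

text \<open>The potential sums the iterates \<open>q n\<close> of \<open>g\<close>, normalised at
  state 1 to make the series converge. Telescoping shows that \<open>g x + step_op h x - h x\<close>
  is the limit of \<open>q n x\<close>, which cannot depend on \<open>x\<close> because the
  oscillation tends to 0.\<close>

lemma poisson_vertex:
  fixes g :: "nat \<Rightarrow> real"
  obtains h a where "\<And>x. x \<in> verts G \<Longrightarrow> g x + step_op h x - h x = a"
proof -
  obtain \<beta> where \<beta>: "summable \<beta>" "\<And>n. 0 \<le> \<beta> n"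
    and decay: "\<And>f c n. osc_le f c \<Longrightarrow> osc_le ((step_op ^^ n) f) (c * \<beta> n)"
    using geometric_ergodicity by blast
  obtain c where c: "c \<ge> 0" "osc_le g c" using ex_osc_le by auto
  define q where "q n = (step_op ^^ n) g" for n
  have q: "\<bar>q n x - q n y\<bar> \<le> c * \<beta> n" if "x \<in> verts G" "y \<in> verts G" for n x y
    unfolding q_def using osc_leD[OF decay[OF c(2)] that] .
  define h where "h x = (\<Sum>n. q n x - q n 1)" for x
  have sm: "summable (\<lambda>n. q n x - q n 1)" if "x \<in> verts G" for x
    by (rule summable_comparison_test'[OF summable_mult[OF \<beta>(1), of c], of 0])
       (use q[OF that initial] in auto)
  have lim0: "(\<lambda>n. q n x - q n 1) \<longlonglongrightarrow> 0" if "x \<in> verts G" for x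
    by (rule summable_LIMSEQ_zero[OF sm[OF that]])
  have Suc: "q (Suc n) x = step_op (q n) x" for n x unfolding q_def by simp
  have lim: "(\<lambda>n. q n x) \<longlonglongrightarrow> g x + step_op h x - h x" if x: "x \<in> verts G" for x
  proof -
    have "(\<lambda>n. \<Sum>e\<in>out_arcs G x. p e * (q n (head G e) - q n 1)) sums
        (\<Sum>e\<in>out_arcs G x. p e * h (head G e))"
      unfolding h_def by (intro sums_sum sums_mult summable_sums sm) auto
    moreover have "(\<Sum>e\<in>out_arcs G x. p e * (q n (head G e) - q n 1)) = q (Suc n) x - q n 1" for n
      using p_sum[OF x] unfolding Suc step_op_def
      by (simp add: right_diff_distrib sum_subtractf sum_distrib_right[symmetric])
    ultimately have "(\<lambda>n. q (Suc n) x - q n 1) sums step_op h x" unfolding step_op_def by simp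
    moreover have "(\<lambda>n. q n x - q n 1) sums h x" unfolding h_def by (rule summable_sums[OF sm[OF x]])
    ultimately have "(\<lambda>n. (q (Suc n) x - q n 1) - (q n x - q n 1)) sums (step_op h x - h x)"
      by (rule sums_diff)
    then have "(\<lambda>n. \<Sum>i<n. q (Suc i) x - q i x) \<longlonglongrightarrow> step_op h x - h x" unfolding sums_def by simp
    then have "(\<lambda>n. q n x - q 0 x) \<longlonglongrightarrow> step_op h x - h x" unfolding sum_lessThan_telescope[of "\<lambda>i. q i x"] .
    from tendsto_add[OF this tendsto_const[of "q 0 x"]] show ?thesis by (simp add: q_def algebra_simps)
  qed
  have "g x + step_op h x - h x = g 1 + step_op h 1 - h 1" if x: "x \<in> verts G" for x
  proof -
    have "(\<lambda>n. (q n x - q n 1) + q n 1) \<longlonglongrightarrow> 0 + (g 1 + step_op h 1 - h 1)"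
      by (intro tendsto_add lim0[OF x] lim[OF initial])
    then show ?thesis using LIMSEQ_unique[OF lim[OF x]] by simp
  qed
  then show ?thesis using that by blast
qed

definition mean :: "('e \<Rightarrow> real) \<Rightarrow> real" where
  "mean k = D1_sum F p k / D1_sum F p (\<lambda>_. 1)"

lemma D1_sum_one_pos: "0 < D1_sum F p (\<lambda>_. 1)"
  by (rule F.D1_sum_one_pos[OF strongly_connected_F])

text \<open>The solvability constant of the Poisson equation is read off on the final component: there
  the corrected output has the same cycle sums as \<open>k\<close>, and constant row sums.\<close>

theorem poisson:
  obtains h where "\<And>x. x \<in> verts G \<Longrightarrow>
    (\<Sum>e\<in>out_arcs G x. p e * (k e + (h (head G e) - h (tail G e)))) = mean k"
proof -
  obtain h a where ha: "\<And>x. x \<in> verts G \<Longrightarrow> (\<Sum>e\<in>out_arcs G x. p e * k e) + step_op h x - h x = a"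
    using poisson_vertex[of "\<lambda>x. \<Sum>e\<in>out_arcs G x. p e * k e"] by blast
  let ?k = "\<lambda>e. k e + (h (head G e) - h (tail G e))"
  have row: "(\<Sum>e\<in>out_arcs G x. p e * ?k e) = a" if x: "x \<in> verts G" for x
  proof -
    have "(\<Sum>e\<in>out_arcs G x. p e * ?k e) =
      (\<Sum>e\<in>out_arcs G x. p e * k e + p e * h (head G e) - p e * h x)"
      by (intro sum.cong refl) (auto simp: algebra_simps)
    also have "\<dots> = (\<Sum>e\<in>out_arcs G x. p e * k e) + step_op h x - h x"
      using p_sum[OF x] unfolding step_op_def by (simp add: sum_subtractf sum.distrib sum_distrib_right[symmetric])
    finally show ?thesis using ha[OF x] by simp
  qed
  have "D1_sum F p k = D1_sum F p ?k" using D1_sum_coboundary[of F p k h] by simp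
  also have "\<dots> = a * D1_sum F p (\<lambda>_. 1)"
    by (rule F.D1_sum_const_row_sum) (use row S_subset in \<open>auto simp: out_arcs_F\<close>)
  finally have "mean k = a" unfolding mean_def using D1_sum_one_pos by simp
  then show ?thesis using that row by blast
qed

end

section \<open>Expectations over random paths\<close>

context finite_markov_chain
begin

definition paths :: "nat \<Rightarrow> nat \<Rightarrow> 'e list set" where
  "paths n x = {w. length w = n \<and> (\<exists>v. awalk x w v)}"

text \<open>The start \<open>x\<close> is variable because recursion on the first step moves it; the
  values may be complex, for characteristic functions.\<close>

definition path_exp :: "nat \<Rightarrow> nat \<Rightarrow> ('e list \<Rightarrow> 'b) \<Rightarrow> 'b::real_normed_vector" where
  "path_exp n x f = (\<Sum>w\<in>paths n x. (\<Prod>e\<leftarrow>w. p e) *\<^sub>R f w)"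

lemma paths_0: "x \<in> verts G \<Longrightarrow> paths 0 x = {[]}"
  unfolding paths_def by (auto simp: awalk_Nil_iff)

lemma paths_Suc:
  "paths (Suc n) x = (\<lambda>(e, w). e # w) ` (SIGMA e:out_arcs G x. paths n (head G e))"
proof
  show "paths (Suc n) x \<subseteq> (\<lambda>(e, w). e # w) ` (SIGMA e:out_arcs G x. paths n (head G e))"
  proof
    fix w assume "w \<in> paths (Suc n) x"
    then obtain e w' v where "w = e # w'" "length w' = n" "awalk x (e # w') v"
      unfolding paths_def by (auto simp: length_Suc_conv)
    then show "w \<in> (\<lambda>(e, w). e # w) ` (SIGMA e:out_arcs G x. paths n (head G e))"
      unfolding paths_def by (force simp: awalk_Cons_iff)
  qed
qed (auto simp: paths_def awalk_Cons_iff)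

lemma finite_paths: "finite (paths n x)"
proof (rule finite_subset)
  show "paths n x \<subseteq> {w. set w \<subseteq> arcs G \<and> length w = n}" unfolding paths_def by auto
qed (intro finite_lists_length_eq finite_arcs)

lemma path_weight_pos: "w \<in> paths n x \<Longrightarrow> 0 < (\<Prod>e\<leftarrow>w. p e)"
proof -
  have "set w \<subseteq> arcs G \<Longrightarrow> 0 < (\<Prod>e\<leftarrow>w. p e)" by (induction w) (auto simp: p_pos)
  then show "w \<in> paths n x \<Longrightarrow> 0 < (\<Prod>e\<leftarrow>w. p e)" unfolding paths_def by auto
qed

lemma path_exp_0: "x \<in> verts G \<Longrightarrow> path_exp 0 x f = f []"
  unfolding path_exp_def by (simp add: paths_0)

lemma path_exp_Suc: "path_exp (Suc n) x f = (\<Sum>e\<in>out_arcs G x. p e *\<^sub>R path_exp n (head G e) (\<lambda>w. f (e # w)))"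
proof -
  let ?A = "SIGMA e:out_arcs G x. paths n (head G e)"
  have "inj_on (\<lambda>(e, w). e # w) ?A" by (auto simp: inj_on_def)
  then have "path_exp (Suc n) x f = (\<Sum>(e, w)\<in>?A. (p e * (\<Prod>e\<leftarrow>w. p e)) *\<^sub>R f (e # w))"
    unfolding path_exp_def paths_Suc by (subst sum.reindex) (auto simp: case_prod_unfold)
  also have "\<dots> = (\<Sum>e\<in>out_arcs G x. \<Sum>w\<in>paths n (head G e). (p e * (\<Prod>e\<leftarrow>w. p e)) *\<^sub>R f (e # w))"
    by (rule sum.Sigma[symmetric]) (auto simp: finite_paths)
  finally show ?thesis unfolding path_exp_def by (simp add: scaleR_sum_right)
qed

lemma path_exp_add: "path_exp n x (\<lambda>w. f w + g w) = path_exp n x f + path_exp n x g"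
  unfolding path_exp_def by (simp add: scaleR_add_right sum.distrib)

lemma path_exp_diff: "path_exp n x (\<lambda>w. f w - g w) = path_exp n x f - path_exp n x g"
  unfolding path_exp_def by (simp add: scaleR_diff_right sum_subtractf)

lemma path_exp_cmult: "path_exp n x (\<lambda>w. c * f w) = c * path_exp n x f" for c :: "'b::real_normed_algebra"
  unfolding path_exp_def by (simp add: sum_distrib_left)

lemma path_exp_cong: "(\<And>w. w \<in> paths n x \<Longrightarrow> f w = g w) \<Longrightarrow> path_exp n x f = path_exp n x g"
  unfolding path_exp_def by (intro sum.cong refl) simp

lemma path_exp_const: "x \<in> verts G \<Longrightarrow> path_exp n x (\<lambda>_. c) = c"
proof (induction n arbitrary: x)
  case (Suc n)
  have "path_exp (Suc n) x (\<lambda>_. c) = (\<Sum>e\<in>out_arcs G x. p e *\<^sub>R c)"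
    unfolding path_exp_Suc by (intro sum.cong refl) (simp add: Suc.IH)
  then show ?case using p_sum[OF Suc.prems] by (simp add: scaleR_sum_left[symmetric])
qed (simp add: path_exp_0)

lemma path_weight_sum: "x \<in> verts G \<Longrightarrow> (\<Sum>w\<in>paths n x. (\<Prod>e\<leftarrow>w. p e)) = 1"
  using path_exp_const[of x n "1 :: real"] unfolding path_exp_def by simp

lemma norm_path_exp_le:
  assumes "x \<in> verts G" "\<And>w. w \<in> paths n x \<Longrightarrow> norm (f w) \<le> B"
  shows "norm (path_exp n x f) \<le> B"
proof -
  have "norm (path_exp n x f) \<le> (\<Sum>w\<in>paths n x. norm ((\<Prod>e\<leftarrow>w. p e) *\<^sub>R f w))"
    unfolding path_exp_def by (rule norm_sum)
  also have "\<dots> \<le> (\<Sum>w\<in>paths n x. (\<Prod>e\<leftarrow>w. p e) * B)"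
    using path_weight_pos assms(2) by (intro sum_mono) (auto simp: less_imp_le intro!: mult_left_mono)
  also have "\<dots> = B" using path_weight_sum[OF assms(1)] by (simp add: sum_distrib_right[symmetric])
  finally show ?thesis .
qed

lemma row_average_le:
  fixes f :: "'e \<Rightarrow> 'b::real_normed_vector"
  assumes "x \<in> verts G" "\<And>e. e \<in> out_arcs G x \<Longrightarrow> norm (f e) \<le> B"
  shows "norm (\<Sum>e\<in>out_arcs G x. p e *\<^sub>R f e) \<le> B"
proof -
  have "norm (\<Sum>e\<in>out_arcs G x. p e *\<^sub>R f e) \<le> (\<Sum>e\<in>out_arcs G x. norm (p e *\<^sub>R f e))" by (rule norm_sum)
  also have "\<dots> \<le> (\<Sum>e\<in>out_arcs G x. p e * B)"
    using p_pos assms(2) by (intro sum_mono) (auto simp: less_imp_le intro!: mult_left_mono)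
  also have "\<dots> = B" using p_sum[OF assms(1)] by (simp add: sum_distrib_right[symmetric])
  finally show ?thesis .
qed

lemma path_measure_eq: "path_measure G p n = point_measure (paths n 1) (\<lambda>w. ennreal (\<Prod>e\<leftarrow>w. p e))"
  unfolding path_measure_def paths_def ..

lemma prob_space_path_measure: "prob_space (path_measure G p n)"
  unfolding path_measure_eq
proof (rule prob_space_point_measure[OF finite_paths])
  show "(\<Sum>w\<in>paths n 1. ennreal (\<Prod>e\<leftarrow>w. p e)) = 1"
    using path_weight_sum[OF initial] path_weight_pos by (subst sum_ennreal) (auto simp: less_imp_le)
qed auto

lemma integral_path_measure:
  fixes f :: "'e list \<Rightarrow> 'b::{banach, second_countable_topology}"
  shows "integral\<^sup>L (path_measure G p n) f = path_exp n 1 f"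
  unfolding path_measure_eq path_exp_def
  by (rule lebesgue_integral_point_measure_finite[OF finite_paths]) (auto simp: path_weight_pos less_imp_le)

lemma integrable_path_measure:
  fixes f :: "'e list \<Rightarrow> 'b::{banach, second_countable_topology}"
  shows "integrable (path_measure G p n) f"
  unfolding path_measure_eq by (rule integrable_point_measure_finite[OF finite_paths])

lemma measurable_path_measure: "f \<in> path_measure G p n \<rightarrow>\<^sub>M borel"
  unfolding path_measure_eq by simp

lemma output_sum_Cons: "output_sum k (e # w) = k e + output_sum k w"
  unfolding output_sum_def by simp

lemma output_sum_Nil: "output_sum k [] = 0"
  unfolding output_sum_def by simp

text \<open>Such outputs are martingale increments along the random path.\<close>

definition centered :: "('e \<Rightarrow> real) \<Rightarrow> bool" where
  "centered g \<longleftrightarrow> (\<forall>x\<in>verts G. (\<Sum>e\<in>out_arcs G x. p e * g e) = 0)"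

lemma path_exp_output_sum_Suc:
  assumes "x \<in> verts G"
  shows "path_exp (Suc n) x (output_sum k) = (\<Sum>e\<in>out_arcs G x. p e * (k e + path_exp n (head G e) (output_sum k)))"
  unfolding path_exp_Suc output_sum_Cons path_exp_add by (intro sum.cong refl) (auto simp: path_exp_const)

lemma path_exp_centered:
  assumes "centered g" "x \<in> verts G"
  shows "path_exp n x (output_sum g) = 0"
  using assms(2)
proof (induction n arbitrary: x)
  case 0 then show ?case by (simp add: path_exp_0 output_sum_Nil)
next
  case (Suc n)
  have "path_exp (Suc n) x (output_sum g) = (\<Sum>e\<in>out_arcs G x. p e * g e)"
    unfolding path_exp_output_sum_Suc[OF Suc.prems] by (intro sum.cong refl) (auto simp: Suc.IH)
  then show ?case using assms(1) Suc.prems unfolding centered_def by simp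
qed

text \<open>Orthogonality of martingale increments: once the first step is split off, each mixed
  term contains the mean of a centred output sum, which is 0.\<close>

lemma path_exp_centered_product:
  assumes "centered g" "centered h" "x \<in> verts G"
  shows "path_exp n x (\<lambda>w. output_sum g w * output_sum h w) = path_exp n x (output_sum (\<lambda>e. g e * h e))"
  using assms(3)
proof (induction n arbitrary: x)
  case 0 then show ?case by (simp add: path_exp_0 output_sum_Nil)
next
  case (Suc n)
  have "path_exp n y (\<lambda>w. output_sum g (e # w) * output_sum h (e # w)) =
    g e * h e + path_exp n y (output_sum (\<lambda>e. g e * h e))" if "y \<in> verts G" for y e
  proof -
    have "path_exp n y (\<lambda>w. output_sum g (e # w) * output_sum h (e # w)) =
      path_exp n y (\<lambda>w. (g e * h e + g e * output_sum h w) + (h e * output_sum g w + output_sum g w * output_sum h w))"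
      by (rule path_exp_cong) (simp add: output_sum_Cons algebra_simps)
    then show ?thesis using Suc.IH[OF that] path_exp_centered[OF assms(1) that] path_exp_centered[OF assms(2) that]
      by (simp add: path_exp_add path_exp_cmult path_exp_const[OF that])
  qed
  then show ?case unfolding path_exp_output_sum_Suc[OF Suc.prems] unfolding path_exp_Suc
    by (intro sum.cong refl) simp
qed

lemma path_exp_awlast: "x \<in> verts G \<Longrightarrow> path_exp n x (\<lambda>w. h (awlast x w)) = (step_op ^^ n) h x"
proof (induction n arbitrary: x)
  case 0 then show ?case by (simp add: path_exp_0)
next
  case (Suc n)
  have "path_exp (Suc n) x (\<lambda>w. h (awlast x w)) = (\<Sum>e\<in>out_arcs G x. p e * (step_op ^^ n) h (head G e))"
    unfolding path_exp_Suc by (intro sum.cong refl) (simp add: Suc.IH)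
  then show ?case unfolding funpow.simps comp_apply by (subst step_op_def)
qed

lemma awlast_in_verts': "w \<in> paths n x \<Longrightarrow> awlast x w \<in> verts G"
  unfolding paths_def by (auto dest: awalk_last_in_verts)

lemma output_sum_coboundary:
  assumes "w \<in> paths n x"
  shows "output_sum (\<lambda>e. k e - a + (h (head G e) - h (tail G e))) w
    = output_sum k w - a * real n + (h (awlast x w) - h x)"
  using assms
proof (induction n arbitrary: w x)
  case 0
  then show ?case by (auto simp: paths_def output_sum_Nil)
next
  case (Suc n)
  then obtain e w' where "w = e # w'" "e \<in> out_arcs G x" "w' \<in> paths n (head G e)"
    unfolding paths_Suc by auto
  then show ?case using Suc.IH[of w' "head G e"] by (auto simp: output_sum_Cons algebra_simps)
qed

end

section \<open>Moments of the output sum up to bounded errors\<close>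

context ergodic_chain
begin

lemma bounded_on_verts:
  fixes h :: "nat \<Rightarrow> real"
  obtains H where "0 \<le> H" "\<And>x. x \<in> verts G \<Longrightarrow> \<bar>h x\<bar> \<le> H"
proof -
  have "\<bar>h x\<bar> \<le> (\<Sum>x\<in>verts G. \<bar>h x\<bar>)" if "x \<in> verts G" for x
    by (rule member_le_sum[OF that]) auto
  then show ?thesis using that by (metis abs_ge_zero sum_nonneg)
qed

lemma bounded_on_arcs:
  fixes g :: "'e \<Rightarrow> real"
  obtains K where "0 \<le> K" "\<And>e. e \<in> arcs G \<Longrightarrow> \<bar>g e\<bar> \<le> K"
proof -
  have "\<bar>g e\<bar> \<le> (\<Sum>e\<in>arcs G. \<bar>g e\<bar>)" if "e \<in> arcs G" for e
    by (rule member_le_sum[OF that]) auto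
  then show ?thesis using that by (metis abs_ge_zero sum_nonneg)
qed

lemma ex_corrector:
  obtains h where "centered (\<lambda>e. k e - mean k + (h (head G e) - h (tail G e)))"
proof -
  obtain h where h: "\<And>x. x \<in> verts G \<Longrightarrow>
    (\<Sum>e\<in>out_arcs G x. p e * (k e + (h (head G e) - h (tail G e)))) = mean k"
    using poisson[of k] by blast
  have "(\<Sum>e\<in>out_arcs G x. p e * (k e - mean k + (h (head G e) - h (tail G e)))) = 0"
    if x: "x \<in> verts G" for x
  proof -
    have "(\<Sum>e\<in>out_arcs G x. p e * (k e - mean k + (h (head G e) - h (tail G e)))) =
      (\<Sum>e\<in>out_arcs G x. p e * (k e + (h (head G e) - h (tail G e))) - p e * mean k)"
      by (intro sum.cong refl) (simp add: algebra_simps)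
    then show ?thesis using h[OF x] p_sum[OF x] by (simp add: sum_subtractf sum_distrib_right[symmetric])
  qed
  then show ?thesis using that unfolding centered_def by blast
qed

text \<open>The corrected sum has mean 0 and differs from the sum without drift by two values of
  \<open>h\<close>. Besides the expectations, this also serves the products of corrected outputs in
  \<open>covariance_bounded\<close>.\<close>

lemma path_exp_output_sum_bounded:
  obtains B where "\<And>n x. x \<in> verts G \<Longrightarrow> \<bar>path_exp n x (output_sum k) - mean k * real n\<bar> \<le> B"
proof -
  obtain h where h: "centered (\<lambda>e. k e - mean k + (h (head G e) - h (tail G e)))"
    using ex_corrector by blast
  obtain H where H: "0 \<le> H" "\<And>x. x \<in> verts G \<Longrightarrow> \<bar>h x\<bar> \<le> H" using bounded_on_verts by blast
  show ?thesis
  proof (rule that[of "2 * H"])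
    fix n x assume x: "x \<in> verts G"
    have "path_exp n x (\<lambda>w. output_sum k w - mean k * real n + (h (awlast x w) - h x)) = 0"
      using path_exp_centered[OF h x, of n] by (subst path_exp_cong[OF output_sum_coboundary[symmetric]]) auto
    then have "path_exp n x (output_sum k) - mean k * real n = - path_exp n x (\<lambda>w. h (awlast x w) - h x)"
      by (simp add: path_exp_add path_exp_diff path_exp_const[OF x])
    moreover have "norm (path_exp n x (\<lambda>w. h (awlast x w) - h x)) \<le> 2 * H"
    proof (rule norm_path_exp_le[OF x])
      fix w assume "w \<in> paths n x"
      then have "\<bar>h (awlast x w)\<bar> \<le> H" "\<bar>h x\<bar> \<le> H" using H(2) awlast_in_verts' x by blast+
      then show "norm (h (awlast x w) - h x) \<le> 2 * H" by (simp add: abs_le_iff)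
    qed
    ultimately show "\<bar>path_exp n x (output_sum k) - mean k * real n\<bar> \<le> 2 * H" by simp
  qed
qed

text \<open>These are the mixed terms of the covariance, for which Cauchy-Schwarz would only give
  order \<open>sqrt n\<close>. A centred step counts only through its influence on the final state;
  this influence decays geometrically, so the contributions are summable.\<close>

lemma path_exp_centered_awlast_bounded:
  assumes "centered g"
  obtains B where "\<And>n x. x \<in> verts G \<Longrightarrow> \<bar>path_exp n x (\<lambda>w. output_sum g w * h (awlast x w))\<bar> \<le> B"
proof -
  obtain \<beta> where \<beta>: "summable \<beta>" "\<And>n. 0 \<le> \<beta> n"
    and decay: "\<And>f c n. osc_le f c \<Longrightarrow> osc_le ((step_op ^^ n) f) (c * \<beta> n)"
    using geometric_ergodicity by blast
  obtain c where c: "c \<ge> 0" "osc_le h c" using ex_osc_le by auto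
  obtain K where K: "0 \<le> K" "\<And>e. e \<in> arcs G \<Longrightarrow> \<bar>g e\<bar> \<le> K" using bounded_on_arcs by blast
  have ind: "\<bar>path_exp n x (\<lambda>w. output_sum g w * h (awlast x w))\<bar> \<le> (\<Sum>i<n. K * (c * \<beta> i))" if "x \<in> verts G" for n x
    using that
  proof (induction n arbitrary: x)
    case 0 then show ?case by (simp add: path_exp_0 output_sum_Nil)
  next
    case (Suc n)
    let ?B = "\<lambda>x. path_exp n x (\<lambda>w. output_sum g w * h (awlast x w))"
    let ?q = "(step_op ^^ n) h"
    have "path_exp (Suc n) x (\<lambda>w. output_sum g w * h (awlast x w)) =
      (\<Sum>e\<in>out_arcs G x. p e * (g e * ?q (head G e) + ?B (head G e)))"
      unfolding path_exp_Suc
    proof (intro sum.cong refl)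
      fix e assume e: "e \<in> out_arcs G x"
      then have y: "head G e \<in> verts G" by simp
      have "path_exp n (head G e) (\<lambda>w. output_sum g (e # w) * h (awlast x (e # w))) =
        path_exp n (head G e) (\<lambda>w. g e * h (awlast (head G e) w) + output_sum g w * h (awlast (head G e) w))"
        by (rule path_exp_cong) (simp add: output_sum_Cons algebra_simps)
      then show "p e *\<^sub>R path_exp n (head G e) (\<lambda>w. output_sum g (e # w) * h (awlast x (e # w))) =
        p e * (g e * ?q (head G e) + ?B (head G e))"
        by (simp add: path_exp_add path_exp_cmult path_exp_awlast[OF y])
    qed
    \<comment> \<open>As \<open>g\<close> has mean 0 at \<open>x\<close>, subtracting the constant
      \<open>?q x\<close> is free and replaces the size of \<open>?q\<close> by its
      oscillation.\<close>
    also have "\<dots> = (\<Sum>e\<in>out_arcs G x. p e * (g e * (?q (head G e) - ?q x) + ?B (head G e)))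
       + ?q x * (\<Sum>e\<in>out_arcs G x. p e * g e)"
      by (simp add: sum_distrib_left sum.distrib[symmetric] algebra_simps)
    also have "(\<Sum>e\<in>out_arcs G x. p e * g e) = 0" using assms Suc.prems unfolding centered_def by blast
    finally have eq: "path_exp (Suc n) x (\<lambda>w. output_sum g w * h (awlast x w)) =
      (\<Sum>e\<in>out_arcs G x. p e *\<^sub>R (g e * (?q (head G e) - ?q x) + ?B (head G e)))" by simp
    have "norm (\<Sum>e\<in>out_arcs G x. p e *\<^sub>R (g e * (?q (head G e) - ?q x) + ?B (head G e)))
       \<le> K * (c * \<beta> n) + (\<Sum>i<n. K * (c * \<beta> i))"
    proof (rule row_average_le[OF Suc.prems])
      fix e assume e: "e \<in> out_arcs G x"
      have "\<bar>?q (head G e) - ?q x\<bar> \<le> c * \<beta> n"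
        using osc_leD[OF decay[OF c(2)], of "head G e" x] e Suc.prems by auto
      then have "\<bar>g e * (?q (head G e) - ?q x)\<bar> \<le> K * (c * \<beta> n)"
        unfolding abs_mult using K e by (intro mult_mono) auto
      moreover have "\<bar>?B (head G e)\<bar> \<le> (\<Sum>i<n. K * (c * \<beta> i))" using Suc.IH e by auto
      ultimately show "norm (g e * (?q (head G e) - ?q x) + ?B (head G e)) \<le> K * (c * \<beta> n) + (\<Sum>i<n. K * (c * \<beta> i))"
        unfolding real_norm_def by linarith
    qed
    then show ?case unfolding eq by (simp add: add.commute)
  qed
  have "(\<Sum>i<n. K * (c * \<beta> i)) \<le> (\<Sum>i. K * (c * \<beta> i))" for n
    by (rule sum_le_suminf) (use \<beta> c K in \<open>auto intro!: summable_mult\<close>)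
  then show ?thesis using that[of "\<Sum>i. K * (c * \<beta> i)"] ind by (meson order_trans)
qed

end

section \<open>Characteristic function of the output sum\<close>

lemma iexp_taylor2:
  "norm (iexp y - (1 + \<i> * complex_of_real y - complex_of_real (y\<^sup>2 / 2))) \<le> \<bar>y\<bar> ^ 3 / 6"
proof -
  have "(\<Sum>k\<le>2. f k) = f 0 + f 1 + f 2" for f :: "nat \<Rightarrow> complex"
    by (simp add: numeral_2_eq_2)
  then have "(\<Sum>k\<le>2. (\<i> * complex_of_real y) ^ k / fact k) =
    1 + \<i> * complex_of_real y - complex_of_real (y\<^sup>2 / 2)"
    by (simp add: power_mult_distrib)
  then show ?thesis using iexp_approx1[of y 2] by (simp add: fact_numeral)
qed

context ergodic_chain
begin

lemma mean_nonneg: "(\<And>e. 0 \<le> k e) \<Longrightarrow> 0 \<le> mean k"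
  unfolding mean_def using F.D1_sum_nonneg[of k] D1_sum_one_pos by simp

lemma mean_linear: "mean (\<lambda>e. a * g e + b * h e) = a * mean g + b * mean h"
  unfolding mean_def F.D1_sum_linear by (simp add: add_divide_distrib)

text \<open>The potential \<open>u\<close> solves the Poisson equation for minus the square of
  \<open>g\<close>. This choice makes the second-order coefficient of the one-step mean at
  \<open>x\<close> equal to \<open>u x - v\<close>, with no other dependence on
  \<open>x\<close>.\<close>

lemma characteristic_step:
  assumes g: "centered g" and v: "v = mean (\<lambda>e. (g e)\<^sup>2)"
  obtains u C where "0 \<le> C" "\<And>(\<theta> :: real) x. \<lbrakk>\<bar>\<theta>\<bar> \<le> 1; x \<in> verts G\<rbrakk> \<Longrightarrow>
    norm ((\<Sum>e\<in>out_arcs G x. p e *\<^sub>R (iexp (\<theta> * g e) * complex_of_real (1 + \<theta>\<^sup>2 / 2 * u (head G e))))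
      - complex_of_real ((1 - \<theta>\<^sup>2 / 2 * v) * (1 + \<theta>\<^sup>2 / 2 * u x))) \<le> C * \<bar>\<theta>\<bar> ^ 3"
proof -
  obtain u where u: "\<And>x. x \<in> verts G \<Longrightarrow>
    (\<Sum>e\<in>out_arcs G x. p e * (- (g e)\<^sup>2 + (u (head G e) - u (tail G e)))) = mean (\<lambda>e. - (g e)\<^sup>2)"
    using poisson[of "\<lambda>e. - (g e)\<^sup>2"] by blast
  have "mean (\<lambda>e. - (g e)\<^sup>2) = - v"
    using mean_linear[of "-1" "\<lambda>e. (g e)\<^sup>2" 0 "\<lambda>_. 0"] v by simp
  note u = u[unfolded this]
  obtain U where U: "0 \<le> U" "\<And>x. x \<in> verts G \<Longrightarrow> \<bar>u x\<bar> \<le> U" using bounded_on_verts by blast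
  obtain K where K: "0 \<le> K" "\<And>e. e \<in> arcs G \<Longrightarrow> \<bar>g e\<bar> \<le> K" using bounded_on_arcs by blast
  have v0: "0 \<le> v" unfolding v by (rule mean_nonneg) simp
  \<comment> \<open>In order: the Taylor remainder of the exponential, its deviation from 1
    multiplied by the correction with \<open>u\<close>, and the fourth-order term of the product of
    the two real factors.\<close>
  define C where "C = K ^ 3 / 6 + K * U / 2 + U * v / 4"
  have C: "0 \<le> C" unfolding C_def using K U v0 by simp
  show ?thesis
  proof (rule that[OF C])
    fix \<theta> :: real and x assume \<theta>: "\<bar>\<theta>\<bar> \<le> 1" and x: "x \<in> verts G"
    define A where "A e = iexp (\<theta> * g e) * complex_of_real (1 + \<theta>\<^sup>2 / 2 * u (head G e))" for e
    \<comment> \<open>\<open>A e\<close> truncated after second order in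
      \<open>\<theta>\<close>.\<close>
    define T where "T e = complex_of_real (1 + \<theta>\<^sup>2 / 2 * (u (head G e) - (g e)\<^sup>2)) + \<i> * complex_of_real (\<theta> * g e)" for e
    have AT: "norm (A e - T e) \<le> (K ^ 3 / 6 + K * U / 2) * \<bar>\<theta>\<bar> ^ 3" if e: "e \<in> out_arcs G x" for e
    proof -
      have ge: "\<bar>g e\<bar> \<le> K" and ue: "\<bar>u (head G e)\<bar> \<le> U" using e K U by auto
      let ?y = "\<theta> * g e"
      have y: "\<bar>?y\<bar> \<le> \<bar>\<theta>\<bar> * K" unfolding abs_mult using ge by (intro mult_left_mono) auto
      let ?R = "iexp ?y - (1 + \<i> * complex_of_real ?y - complex_of_real (?y\<^sup>2 / 2))"
      have "norm ?R \<le> \<bar>?y\<bar> ^ 3 / 6" by (rule iexp_taylor2)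
      also have "\<dots> \<le> (\<bar>\<theta>\<bar> * K) ^ 3 / 6" using y by (intro divide_right_mono power_mono) auto
      finally have R: "norm ?R \<le> K ^ 3 / 6 * \<bar>\<theta>\<bar> ^ 3" by (simp add: power_mult_distrib mult.commute)
      have "norm (iexp ?y - 1) \<le> \<bar>?y\<bar>" using iexp_approx1[of ?y 0] by simp
      then have i1: "norm (iexp ?y - 1) \<le> \<bar>\<theta>\<bar> * K" using y by linarith
      have "A e - T e = ?R + (iexp ?y - 1) * complex_of_real (\<theta>\<^sup>2 / 2 * u (head G e))"
        unfolding A_def T_def by (simp add: field_simps power_mult_distrib)
      then have "norm (A e - T e) \<le> norm ?R + norm ((iexp ?y - 1) * complex_of_real (\<theta>\<^sup>2 / 2 * u (head G e)))"
        using norm_triangle_ineq[of ?R] by (simp only:)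
      also have "norm ((iexp ?y - 1) * complex_of_real (\<theta>\<^sup>2 / 2 * u (head G e))) \<le> (\<bar>\<theta>\<bar> * K) * (\<theta>\<^sup>2 / 2 * U)"
        unfolding norm_mult norm_of_real using i1 ue K by (intro mult_mono) (auto simp: abs_mult intro!: mult_left_mono)
      also have "(\<bar>\<theta>\<bar> * K) * (\<theta>\<^sup>2 / 2 * U) = K * U / 2 * \<bar>\<theta>\<bar> ^ 3"
      proof -
        have "\<theta>\<^sup>2 = \<bar>\<theta>\<bar> * \<bar>\<theta>\<bar>" by (simp add: power2_eq_square)
        then show ?thesis by (simp only:) (simp add: power3_eq_cube del: abs_mult_self_eq)
      qed
      finally show ?thesis using R by (simp add: algebra_simps)
    qed
    have "(\<Sum>e\<in>out_arcs G x. p e *\<^sub>R T e) =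
      complex_of_real (\<Sum>e\<in>out_arcs G x. p e * (1 + \<theta>\<^sup>2 / 2 * (u (head G e) - (g e)\<^sup>2)))
       + \<i> * complex_of_real (\<Sum>e\<in>out_arcs G x. p e * (\<theta> * g e))"
      unfolding T_def scaleR_conv_of_real of_real_sum sum_distrib_left sum.distrib[symmetric]
      by (intro sum.cong refl) (simp add: algebra_simps)
    also have "(\<Sum>e\<in>out_arcs G x. p e * (\<theta> * g e)) = \<theta> * (\<Sum>e\<in>out_arcs G x. p e * g e)"
      unfolding sum_distrib_left by (intro sum.cong refl) simp
    also have "(\<Sum>e\<in>out_arcs G x. p e * g e) = 0" using g x unfolding centered_def by blast
    also have "(\<Sum>e\<in>out_arcs G x. p e * (1 + \<theta>\<^sup>2 / 2 * (u (head G e) - (g e)\<^sup>2))) =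
      (\<Sum>e\<in>out_arcs G x. \<theta>\<^sup>2 / 2 * (p e * (- (g e)\<^sup>2 + (u (head G e) - u (tail G e)))) + p e * (1 + \<theta>\<^sup>2 / 2 * u x))"
      by (intro sum.cong refl) (auto simp: algebra_simps)
    also have "\<dots> = \<theta>\<^sup>2 / 2 * (- v) + (1 + \<theta>\<^sup>2 / 2 * u x)"
      unfolding sum.distrib sum_distrib_left[symmetric] sum_distrib_right[symmetric] u[OF x] p_sum[OF x] by simp
    finally have sumT: "(\<Sum>e\<in>out_arcs G x. p e *\<^sub>R T e) = complex_of_real (\<theta>\<^sup>2 / 2 * (- v) + (1 + \<theta>\<^sup>2 / 2 * u x))"
      by simp
    have rem: "\<bar>\<theta>\<^sup>2 / 2 * (- v) + (1 + \<theta>\<^sup>2 / 2 * u x) - (1 - \<theta>\<^sup>2 / 2 * v) * (1 + \<theta>\<^sup>2 / 2 * u x)\<bar> \<le> U * v / 4 * \<bar>\<theta>\<bar> ^ 3"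
    proof -
      have "\<theta>\<^sup>2 / 2 * (- v) + (1 + \<theta>\<^sup>2 / 2 * u x) - (1 - \<theta>\<^sup>2 / 2 * v) * (1 + \<theta>\<^sup>2 / 2 * u x) = \<theta> ^ 4 * (u x * v / 4)"
        by (simp add: algebra_simps power2_eq_square power4_eq_xxxx)
      also have "\<bar>\<dots>\<bar> = \<bar>\<theta>\<bar> ^ 4 * (\<bar>u x\<bar> * v / 4)" using v0 by (simp add: abs_mult power_abs)
      also have "\<dots> \<le> \<bar>\<theta>\<bar> ^ 3 * (U * v / 4)"
        using \<theta> U(2)[OF x] v0 by (intro mult_mono power_decreasing divide_right_mono mult_right_mono) auto
      finally show ?thesis by (simp add: mult.commute)
    qed
    have "norm ((\<Sum>e\<in>out_arcs G x. p e *\<^sub>R A e) - (\<Sum>e\<in>out_arcs G x. p e *\<^sub>R T e)) =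
      norm (\<Sum>e\<in>out_arcs G x. p e *\<^sub>R (A e - T e))" by (simp add: scaleR_diff_right sum_subtractf)
    also have "\<dots> \<le> (K ^ 3 / 6 + K * U / 2) * \<bar>\<theta>\<bar> ^ 3" by (rule row_average_le[OF x AT])
    finally have 1: "norm ((\<Sum>e\<in>out_arcs G x. p e *\<^sub>R A e) - (\<Sum>e\<in>out_arcs G x. p e *\<^sub>R T e)) \<le> \<dots>" .
    have 2: "norm ((\<Sum>e\<in>out_arcs G x. p e *\<^sub>R T e) - complex_of_real ((1 - \<theta>\<^sup>2 / 2 * v) * (1 + \<theta>\<^sup>2 / 2 * u x)))
      \<le> U * v / 4 * \<bar>\<theta>\<bar> ^ 3" unfolding sumT of_real_diff[symmetric] norm_of_real by (rule rem)
    show "norm ((\<Sum>e\<in>out_arcs G x. p e *\<^sub>R (iexp (\<theta> * g e) * complex_of_real (1 + \<theta>\<^sup>2 / 2 * u (head G e))))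
      - complex_of_real ((1 - \<theta>\<^sup>2 / 2 * v) * (1 + \<theta>\<^sup>2 / 2 * u x))) \<le> C * \<bar>\<theta>\<bar> ^ 3"
      using norm_diff_triangle_le[OF 1 2] unfolding A_def C_def by (simp add: algebra_simps)
  qed
qed

text \<open>The one-step transfer operator of \<open>iexp (\<theta> g)\<close> maps
  \<open>1 + \<theta>\<^sup>2 u / 2\<close> to \<open>(1 - \<theta>\<^sup>2 v / 2)\<close> times itself up to \<open>O(\<theta>\<^sup>3)\<close>, and it is a contraction.\<close>

theorem characteristic_limit:
  assumes g: "centered g" and x: "x \<in> verts G"
  shows "(\<lambda>n. path_exp n x (\<lambda>w. iexp (output_sum g w / sqrt (real n)))) \<longlonglongrightarrow>
    complex_of_real (exp (- mean (\<lambda>e. (g e)\<^sup>2) / 2))"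
proof -
  define v where "v = mean (\<lambda>e. (g e)\<^sup>2)"
  have v0: "0 \<le> v" unfolding v_def by (rule mean_nonneg) simp
  obtain u C where C: "0 \<le> C" and step: "\<And>(\<theta> :: real) x. \<lbrakk>\<bar>\<theta>\<bar> \<le> 1; x \<in> verts G\<rbrakk> \<Longrightarrow>
    norm ((\<Sum>e\<in>out_arcs G x. p e *\<^sub>R (iexp (\<theta> * g e) * complex_of_real (1 + \<theta>\<^sup>2 / 2 * u (head G e))))
      - complex_of_real ((1 - \<theta>\<^sup>2 / 2 * v) * (1 + \<theta>\<^sup>2 / 2 * u x))) \<le> C * \<bar>\<theta>\<bar> ^ 3"
    by (rule characteristic_step[OF g v_def], rule that)
  obtain U where U: "0 \<le> U" "\<And>x. x \<in> verts G \<Longrightarrow> \<bar>u x\<bar> \<le> U" using bounded_on_verts by blast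
  have main: "norm (path_exp n x (\<lambda>w. iexp (\<theta> * output_sum g w)) -
      complex_of_real ((1 - \<theta>\<^sup>2 / 2 * v) ^ n * (1 + \<theta>\<^sup>2 / 2 * u x))) \<le> \<theta>\<^sup>2 / 2 * U + real n * (C * \<bar>\<theta>\<bar> ^ 3)"
    if \<theta>: "\<bar>\<theta>\<bar> \<le> 1" "\<theta>\<^sup>2 / 2 * v \<le> 1" and "x \<in> verts G" for \<theta> :: real and n x
    using that(3)
  proof (induction n arbitrary: x)
    case 0
    have "path_exp 0 x (\<lambda>w. iexp (\<theta> * output_sum g w)) - complex_of_real ((1 - \<theta>\<^sup>2 / 2 * v) ^ 0 * (1 + \<theta>\<^sup>2 / 2 * u x))
      = complex_of_real (- (\<theta>\<^sup>2 / 2 * u x))"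
      using 0 by (simp add: path_exp_0 output_sum_Nil)
    then show ?case using U(2)[OF 0]
      by (simp only: norm_of_real) (simp add: abs_mult mult_left_mono)
  next
    case (Suc n)
    let ?l = "1 - \<theta>\<^sup>2 / 2 * v"
    let ?b = "\<lambda>x. 1 + \<theta>\<^sup>2 / 2 * u x"
    let ?\<phi> = "\<lambda>x. path_exp n x (\<lambda>w. iexp (\<theta> * output_sum g w))"
    have l: "0 \<le> ?l" "?l \<le> 1" using \<theta>(2) v0 by auto
    have E: "path_exp (Suc n) x (\<lambda>w. iexp (\<theta> * output_sum g w)) =
      (\<Sum>e\<in>out_arcs G x. p e *\<^sub>R (iexp (\<theta> * g e) * ?\<phi> (head G e)))"
      unfolding path_exp_Suc path_exp_cmult[symmetric] by (simp add: output_sum_Cons distrib_left exp_add)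
    \<comment> \<open>The old error is averaged with factors of modulus 1 and does not grow; the new
      one-step error is damped by \<open>?l ^ n\<close>, which is at most 1.\<close>
    have "path_exp (Suc n) x (\<lambda>w. iexp (\<theta> * output_sum g w)) - complex_of_real (?l ^ Suc n * ?b x) =
      (\<Sum>e\<in>out_arcs G x. p e *\<^sub>R (iexp (\<theta> * g e) * (?\<phi> (head G e) - complex_of_real (?l ^ n * ?b (head G e)))))
      + complex_of_real (?l ^ n) * ((\<Sum>e\<in>out_arcs G x. p e *\<^sub>R (iexp (\<theta> * g e) * complex_of_real (?b (head G e))))
         - complex_of_real (?l * ?b x))"
    proof -
      have "(\<Sum>e\<in>out_arcs G x. p e *\<^sub>R (iexp (\<theta> * g e) * (?\<phi> (head G e) - complex_of_real (?l ^ n * ?b (head G e))))) =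
        (\<Sum>e\<in>out_arcs G x. p e *\<^sub>R (iexp (\<theta> * g e) * ?\<phi> (head G e))) -
        complex_of_real (?l ^ n) * (\<Sum>e\<in>out_arcs G x. p e *\<^sub>R (iexp (\<theta> * g e) * complex_of_real (?b (head G e))))"
        unfolding sum_distrib_left sum_subtractf[symmetric]
        by (intro sum.cong refl) (simp only: right_diff_distrib scaleR_diff_right of_real_mult mult_scaleR_right mult.left_commute)
      then show ?thesis unfolding E by (simp only: right_diff_distrib power_Suc of_real_mult) simp
    qed
    also have "norm \<dots> \<le> (\<theta>\<^sup>2 / 2 * U + real n * (C * \<bar>\<theta>\<bar> ^ 3)) + C * \<bar>\<theta>\<bar> ^ 3"
    proof (rule norm_triangle_mono)
      show "norm (\<Sum>e\<in>out_arcs G x. p e *\<^sub>R (iexp (\<theta> * g e) * (?\<phi> (head G e) - complex_of_real (?l ^ n * ?b (head G e)))))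
        \<le> \<theta>\<^sup>2 / 2 * U + real n * (C * \<bar>\<theta>\<bar> ^ 3)"
      proof (rule row_average_le[OF Suc.prems])
        fix e assume "e \<in> out_arcs G x"
        then have "head G e \<in> verts G" by simp
        from Suc.IH[OF this]
        show "norm (iexp (\<theta> * g e) * (?\<phi> (head G e) - complex_of_real (?l ^ n * ?b (head G e))))
          \<le> \<theta>\<^sup>2 / 2 * U + real n * (C * \<bar>\<theta>\<bar> ^ 3)" unfolding norm_mult norm_exp_i_times mult_1_left .
      qed
      have "norm (complex_of_real (?l ^ n)) \<le> 1"
        unfolding norm_of_real using l by (simp add: power_le_one)
      then show "norm (complex_of_real (?l ^ n) * ((\<Sum>e\<in>out_arcs G x. p e *\<^sub>R (iexp (\<theta> * g e) * complex_of_real (?b (head G e))))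
         - complex_of_real (?l * ?b x))) \<le> C * \<bar>\<theta>\<bar> ^ 3"
        unfolding norm_mult[of "complex_of_real (?l ^ n)"]
        using mult_mono[OF _ step[OF \<theta>(1) Suc.prems], of "norm (complex_of_real (?l ^ n))" 1] by simp
    qed
    finally show ?case by (simp add: algebra_simps)
  qed
  \<comment> \<open>The approximation of \<open>main\<close> at
    \<open>\<theta> = 1 / sqrt n\<close>, where the powers become the usual approximants of the
    exponential.\<close>
  let ?\<psi> = "\<lambda>n. complex_of_real ((1 + (- v / 2) / real n) ^ n * (1 + 1 / real n / 2 * u x))"
  have "(\<lambda>n. path_exp n x (\<lambda>w. iexp (output_sum g w / sqrt (real n))) - ?\<psi> n) \<longlonglongrightarrow> 0"
  proof (rule Lim_null_comparison)
    show "(\<lambda>n. 1 / real n / 2 * U + C * (1 / sqrt (real n))) \<longlonglongrightarrow> 0"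
    proof -
      have a: "(\<lambda>n. 1 / real n) \<longlonglongrightarrow> 0" by (rule lim_1_over_n)
      have "(\<lambda>n. sqrt (1 / real n)) \<longlonglongrightarrow> sqrt 0" by (intro tendsto_intros a)
      then have b: "(\<lambda>n. 1 / sqrt (real n)) \<longlonglongrightarrow> 0" by (simp add: real_sqrt_divide)
      have "(\<lambda>n. 1 / real n / 2 * U + C * (1 / sqrt (real n))) \<longlonglongrightarrow> 0 / 2 * U + C * 0"
        by (intro tendsto_intros a b) simp
      then show ?thesis by simp
    qed
    show "\<forall>\<^sub>F n in sequentially. norm (path_exp n x (\<lambda>w. iexp (output_sum g w / sqrt (real n))) - ?\<psi> n)
      \<le> 1 / real n / 2 * U + C * (1 / sqrt (real n))"
      \<comment> \<open>From this \<open>n\<close> on, \<open>\<theta> = 1 / sqrt n\<close>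
        satisfies both smallness conditions of \<open>main\<close>.\<close>
      using eventually_ge_at_top[of "max 1 (nat \<lceil>v\<rceil>)"]
    proof eventually_elim
      case (elim n)
      then have n: "1 \<le> n" "v \<le> real n" by linarith+
      let ?t = "1 / sqrt (real n)"
      have sq: "?t\<^sup>2 = 1 / real n" using n by (simp add: power_divide)
      have t: "\<bar>?t\<bar> \<le> 1" "?t\<^sup>2 / 2 * v \<le> 1" unfolding sq using n by (auto simp: field_simps)
      \<comment> \<open>The \<open>n\<close> one-step errors of third order in \<open>?t\<close> add
        up to first order, which tends to 0.\<close>
      have cube: "real n * (C * \<bar>?t\<bar> ^ 3) = C * ?t"
      proof -
        have "real n * (C * \<bar>?t\<bar> ^ 3) = C * ?t * (real n * ?t\<^sup>2)"
          using n by (simp add: power3_eq_cube power2_eq_square)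
        then show ?thesis unfolding sq using n by simp
      qed
      have "1 - ?t\<^sup>2 / 2 * v = 1 + (- v / 2) / real n" unfolding sq by simp
      then show ?case using main[OF t x, of n] unfolding cube unfolding sq by (simp add: mult.commute)
    qed
  qed
  moreover have "?\<psi> \<longlonglongrightarrow> complex_of_real (exp (- v / 2) * (1 + 0 / 2 * u x))"
    by (intro tendsto_of_real tendsto_mult tendsto_exp_limit_sequentially tendsto_add tendsto_const
        tendsto_divide lim_1_over_n) simp
  ultimately have "(\<lambda>n. path_exp n x (\<lambda>w. iexp (output_sum g w / sqrt (real n)))) \<longlonglongrightarrow>
    0 + complex_of_real (exp (- v / 2) * (1 + 0 / 2 * u x))"
    using tendsto_add[of "\<lambda>n. path_exp n x (\<lambda>w. iexp (output_sum g w / sqrt (real n))) - ?\<psi> n" 0 sequentially ?\<psi>] by simp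
  then show ?thesis unfolding v_def by simp
qed

end

section \<open>Asymptotics of mean, covariance and joint law\<close>

lemma norm_iexp_diff_le: "norm (iexp a - iexp b) \<le> \<bar>a - b\<bar>"
proof -
  have "iexp a - iexp b = iexp b * (iexp (a - b) - 1)"
    by (simp add: right_diff_distrib exp_add[symmetric] algebra_simps)
  then have "norm (iexp a - iexp b) = norm (iexp (a - b) - 1)"
    by (simp only: norm_mult norm_exp_i_times mult_1_left)
  then show ?thesis using iexp_approx1[of "a - b" 0] by simp
qed

context ergodic_chain
begin

text \<open>The covariance rate \<open>c\<close>; with equal arguments it is the variance rate
  \<open>v_i\<close>.\<close>

definition acov :: "('e \<Rightarrow> real) \<Rightarrow> ('e \<Rightarrow> real) \<Rightarrow> real" where
  "acov k1 k2 = 1 / D1_sum F p (\<lambda>_. 1) *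
    (D1_pair F p (\<lambda>e. k1 e - mean k1) (\<lambda>e. k2 e - mean k2) -
     D2_pair F p (\<lambda>e. k1 e - mean k1) (\<lambda>e. k2 e - mean k2))"

definition corrected :: "('e \<Rightarrow> real) \<Rightarrow> (nat \<Rightarrow> real) \<Rightarrow> 'e \<Rightarrow> real" where
  "corrected k h e = k e - mean k + (h (head G e) - h (tail G e))"

lemma acov_eq_mean:
  assumes "centered (corrected k1 h1)" "centered (corrected k2 h2)"
  shows "acov k1 k2 = mean (\<lambda>e. corrected k1 h1 e * corrected k2 h2 e)"
proof -
  have row: "(\<Sum>e\<in>out_arcs F v. p e * g e) = 0" if "centered g" "v \<in> verts F" for g v
    using that S_subset by (auto simp: out_arcs_F centered_def)
  let ?d1 = "\<lambda>e. k1 e - mean k1" and ?d2 = "\<lambda>e. k2 e - mean k2"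
  have c: "corrected k h = (\<lambda>e. (k e - mean k) + (h (head F e) - h (tail F e)))" for k h
    unfolding corrected_def by (simp add: fun_eq_iff)
  have "D1_pair F p ?d1 ?d2 - D2_pair F p ?d1 ?d2 =
    D1_pair F p (corrected k1 h1) (corrected k2 h2) - D2_pair F p (corrected k1 h1) (corrected k2 h2)"
    unfolding c D1_pair_coboundary[of F p ?d1 h1 ?d2 h2] D2_pair_coboundary[of F p ?d1 h1 ?d2 h2] ..
  also have "\<dots> = D1_sum F p (\<lambda>e. corrected k1 h1 e * corrected k2 h2 e)"
    by (rule F.D1_pair_minus_D2_pair) (rule row[OF assms(1)], assumption, rule row[OF assms(2)], assumption)
  finally show ?thesis unfolding acov_def mean_def by simp
qed

lemma ex_corrected: obtains h where "centered (corrected k h)"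
  using ex_corrector[of k] unfolding corrected_def by blast

text \<open>Recentring at the exact expectation cancels the drift and the start state. Besides the
  martingale only the fluctuation of \<open>h\<close> at the final state is left.\<close>

lemma output_sum_deviation:
  assumes "centered (corrected k h)" "w \<in> paths n 1"
  shows "output_sum k w - path_exp n 1 (output_sum k) =
    output_sum (corrected k h) w - (h (awlast 1 w) - path_exp n 1 (\<lambda>w. h (awlast 1 w)))"
proof -
  have 1: "output_sum (corrected k h) w = output_sum k w - mean k * real n + (h (awlast 1 w) - h 1)"
    if "w \<in> paths n 1" for w
    using output_sum_coboundary[OF that, of k "mean k" h] unfolding corrected_def .
  have "0 = path_exp n 1 (output_sum (corrected k h))" by (rule path_exp_centered[OF assms(1) initial, symmetric])
  also have "\<dots> = path_exp n 1 (\<lambda>w. output_sum k w - mean k * real n + (h (awlast 1 w) - h 1))"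
    by (rule path_exp_cong) (rule 1)
  also have "\<dots> = path_exp n 1 (output_sum k) - mean k * real n + (path_exp n 1 (\<lambda>w. h (awlast 1 w)) - h 1)"
    by (simp only: path_exp_add path_exp_diff path_exp_const[OF initial])
  finally show ?thesis using 1[OF assms(2)] by simp
qed

lemma end_deviation_bound:
  fixes h :: "nat \<Rightarrow> real"
  assumes "\<And>x. x \<in> verts G \<Longrightarrow> \<bar>h x\<bar> \<le> H" "w \<in> paths n 1"
  shows "\<bar>h (awlast 1 w) - path_exp n 1 (\<lambda>w. h (awlast 1 w))\<bar> \<le> 2 * H"
proof -
  have "norm (path_exp n 1 (\<lambda>w. h (awlast 1 w))) \<le> H"
    by (rule norm_path_exp_le[OF initial]) (use assms(1) awlast_in_verts' in auto)
  moreover have "\<bar>h (awlast 1 w)\<bar> \<le> H" using assms awlast_in_verts' by blast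
  ultimately show ?thesis by simp
qed

lemma covariance_bounded:
  obtains B where "\<And>n. \<bar>path_exp n 1 (\<lambda>w. (output_sum k1 w - path_exp n 1 (output_sum k1)) * (output_sum k2 w - path_exp n 1 (output_sum k2)))
    - acov k1 k2 * real n\<bar> \<le> B"
proof -
  obtain h1 h2 where c: "centered (corrected k1 h1)" "centered (corrected k2 h2)"
    using ex_corrected[of k1] ex_corrected[of k2] by metis
  let ?g1 = "corrected k1 h1" and ?g2 = "corrected k2 h2"
  obtain H1 where H1: "0 \<le> H1" "\<And>x. x \<in> verts G \<Longrightarrow> \<bar>h1 x\<bar> \<le> H1" by (rule bounded_on_verts[of h1], rule that)
  obtain H2 where H2: "0 \<le> H2" "\<And>x. x \<in> verts G \<Longrightarrow> \<bar>h2 x\<bar> \<le> H2" by (rule bounded_on_verts[of h2], rule that)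
  obtain B0 where B0: "\<And>n x. x \<in> verts G \<Longrightarrow>
      \<bar>path_exp n x (output_sum (\<lambda>e. ?g1 e * ?g2 e)) - mean (\<lambda>e. ?g1 e * ?g2 e) * real n\<bar> \<le> B0"
    by (rule path_exp_output_sum_bounded, rule that)
  obtain B1 where B1: "\<And>n x. x \<in> verts G \<Longrightarrow> \<bar>path_exp n x (\<lambda>w. output_sum ?g1 w * h2 (awlast x w))\<bar> \<le> B1"
    by (rule path_exp_centered_awlast_bounded[OF c(1)], rule that)
  obtain B2 where B2: "\<And>n x. x \<in> verts G \<Longrightarrow> \<bar>path_exp n x (\<lambda>w. output_sum ?g2 w * h1 (awlast x w))\<bar> \<le> B2"
    by (rule path_exp_centered_awlast_bounded[OF c(2)], rule that)
  show ?thesis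
  proof (rule that[of "B0 + B1 + B2 + 2 * H1 * (2 * H2)"])
    fix n
    define \<eta>1 \<eta>2 where "\<eta>1 = path_exp n 1 (\<lambda>w. h1 (awlast 1 w))" and "\<eta>2 = path_exp n 1 (\<lambda>w. h2 (awlast 1 w))"
    let ?d = "\<lambda>w. (h1 (awlast 1 w) - \<eta>1) * (h2 (awlast 1 w) - \<eta>2)"
    \<comment> \<open>Expanded so that the constants \<open>\<eta>1\<close> and
      \<open>\<eta>2\<close> multiply bare martingales, whose means vanish.\<close>
    have "path_exp n 1 (\<lambda>w. (output_sum k1 w - path_exp n 1 (output_sum k1)) * (output_sum k2 w - path_exp n 1 (output_sum k2))) =
      path_exp n 1 (\<lambda>w. (output_sum ?g1 w * output_sum ?g2 w - output_sum ?g1 w * h2 (awlast 1 w) + \<eta>2 * output_sum ?g1 w)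
        - output_sum ?g2 w * h1 (awlast 1 w) + \<eta>1 * output_sum ?g2 w + ?d w)"
      unfolding \<eta>1_def \<eta>2_def
      by (rule path_exp_cong, simp only: output_sum_deviation[OF c(1)] output_sum_deviation[OF c(2)])
         (simp only: algebra_simps)
    also have "\<dots> = path_exp n 1 (output_sum (\<lambda>e. ?g1 e * ?g2 e)) - path_exp n 1 (\<lambda>w. output_sum ?g1 w * h2 (awlast 1 w))
        - path_exp n 1 (\<lambda>w. output_sum ?g2 w * h1 (awlast 1 w)) + path_exp n 1 ?d"
      by (simp only: path_exp_add path_exp_diff path_exp_cmult path_exp_centered[OF c(1) initial] path_exp_centered[OF c(2) initial]
          path_exp_centered_product[OF c initial] mult_zero_right add_0_right)
    finally have eq: "path_exp n 1 (\<lambda>w. (output_sum k1 w - path_exp n 1 (output_sum k1)) * (output_sum k2 w - path_exp n 1 (output_sum k2))) = \<dots>" .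
    have "norm (path_exp n 1 ?d) \<le> 2 * H1 * (2 * H2)"
    proof (rule norm_path_exp_le[OF initial])
      fix w assume w: "w \<in> paths n 1"
      show "norm (?d w) \<le> 2 * H1 * (2 * H2)"
        unfolding real_norm_def abs_mult \<eta>1_def \<eta>2_def
        using end_deviation_bound[OF H1(2) w] end_deviation_bound[OF H2(2) w] H1(1) by (intro mult_mono) auto
    qed
    then show "\<bar>path_exp n 1 (\<lambda>w. (output_sum k1 w - path_exp n 1 (output_sum k1)) * (output_sum k2 w - path_exp n 1 (output_sum k2)))
      - acov k1 k2 * real n\<bar> \<le> B0 + B1 + B2 + 2 * H1 * (2 * H2)"
      unfolding eq acov_eq_mean[OF c] real_norm_def
      using B0[OF initial, of n] B1[OF initial, of n] B2[OF initial, of n] by linarith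
  qed
qed

text \<open>Not visible from the difference that defines it, but clear for the mean of a square. It
  is needed as the variance of the Gaussian limit.\<close>

lemma acov_nonneg: "0 \<le> acov k k"
proof -
  obtain h where h: "centered (corrected k h)" by (rule ex_corrected, rule that)
  show ?thesis unfolding acov_eq_mean[OF h h] by (rule mean_nonneg) simp
qed

lemma centered_linear:
  assumes "centered g1" "centered g2"
  shows "centered (\<lambda>e. s * g1 e + t * g2 e)"
  unfolding centered_def
proof
  fix x assume x: "x \<in> verts G"
  have "(\<Sum>e\<in>out_arcs G x. p e * (s * g1 e + t * g2 e)) =
    s * (\<Sum>e\<in>out_arcs G x. p e * g1 e) + t * (\<Sum>e\<in>out_arcs G x. p e * g2 e)"
    unfolding sum_distrib_left sum.distrib[symmetric] by (intro sum.cong refl) (simp add: algebra_simps)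
  then show "(\<Sum>e\<in>out_arcs G x. p e * (s * g1 e + t * g2 e)) = 0"
    using assms x unfolding centered_def by simp
qed

lemma output_sum_linear: "output_sum (\<lambda>e. s * g1 e + t * g2 e) w = s * output_sum g1 w + t * output_sum g2 w"
  by (induction w) (simp_all add: output_sum_Nil output_sum_Cons algebra_simps)

lemma tendsto_const_over_sqrt: "(\<lambda>n. c / sqrt (real n)) \<longlonglongrightarrow> 0"
proof -
  have "(\<lambda>n. c * sqrt (1 / real n)) \<longlonglongrightarrow> c * sqrt 0" by (intro tendsto_intros lim_1_over_n)
  then show ?thesis by (simp add: real_sqrt_divide)
qed

definition scaled :: "('e \<Rightarrow> real) \<Rightarrow> nat \<Rightarrow> 'e list \<Rightarrow> real" where
  "scaled k n w = (output_sum k w - path_exp n 1 (output_sum k)) / sqrt (real n)"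

text \<open>As in the Cramer-Wold device, each linear combination of centred outputs is centred, so
  the one-dimensional limit applies to it. The end terms change the exponent only by order
  \<open>1 / sqrt n\<close>.\<close>

theorem scaled_characteristic_limit:
  "(\<lambda>n. path_exp n 1 (\<lambda>w. iexp (s * scaled k1 n w + t * scaled k2 n w))) \<longlonglongrightarrow>
    complex_of_real (exp (- (s\<^sup>2 * acov k1 k1 + 2 * s * t * acov k1 k2 + t\<^sup>2 * acov k2 k2) / 2))"
proof -
  obtain h1 h2 where c: "centered (corrected k1 h1)" "centered (corrected k2 h2)"
    using ex_corrected[of k1] ex_corrected[of k2] by metis
  let ?g1 = "corrected k1 h1" and ?g2 = "corrected k2 h2"
  let ?g = "\<lambda>e. s * ?g1 e + t * ?g2 e"
  obtain H1 where H1: "0 \<le> H1" "\<And>x. x \<in> verts G \<Longrightarrow> \<bar>h1 x\<bar> \<le> H1" by (rule bounded_on_verts[of h1], rule that)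
  obtain H2 where H2: "0 \<le> H2" "\<And>x. x \<in> verts G \<Longrightarrow> \<bar>h2 x\<bar> \<le> H2" by (rule bounded_on_verts[of h2], rule that)
  have "mean (\<lambda>e. (?g e)\<^sup>2) = mean (\<lambda>e. s\<^sup>2 * (?g1 e * ?g1 e) + 1 * (2 * s * t * (?g1 e * ?g2 e) + t\<^sup>2 * (?g2 e * ?g2 e)))"
    by (rule arg_cong[of _ _ mean]) (simp add: fun_eq_iff power2_eq_square algebra_simps)
  also have "\<dots> = s\<^sup>2 * acov k1 k1 + 2 * s * t * acov k1 k2 + t\<^sup>2 * acov k2 k2"
    unfolding mean_linear acov_eq_mean[OF c] acov_eq_mean[OF c(1) c(1)] acov_eq_mean[OF c(2) c(2)] by simp
  finally have var: "mean (\<lambda>e. (?g e)\<^sup>2) = \<dots>" .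
  let ?f = "\<lambda>n. path_exp n 1 (\<lambda>w. iexp (s * scaled k1 n w + t * scaled k2 n w))"
  let ?l = "\<lambda>n. path_exp n 1 (\<lambda>w. iexp (output_sum ?g w / sqrt (real n)))"
  let ?B = "\<bar>s\<bar> * (2 * H1) + \<bar>t\<bar> * (2 * H2)"
  have "(\<lambda>n. ?f n - ?l n) \<longlonglongrightarrow> 0"
  proof (rule Lim_null_comparison)
    show "(\<lambda>n. ?B / sqrt (real n)) \<longlonglongrightarrow> 0" by (rule tendsto_const_over_sqrt)
    show "\<forall>\<^sub>F n in sequentially. norm (?f n - ?l n) \<le> ?B / sqrt (real n)"
    \<comment> \<open>The bound includes \<open>n = 0\<close>, where division by
      \<open>sqrt 0\<close> makes both sides 0.\<close>
    proof (rule always_eventually, rule allI)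
      fix n
      have "norm (path_exp n 1 (\<lambda>w. iexp (s * scaled k1 n w + t * scaled k2 n w) - iexp (output_sum ?g w / sqrt (real n))))
        \<le> ?B / sqrt (real n)"
      proof (rule norm_path_exp_le[OF initial])
        fix w assume w: "w \<in> paths n 1"
        let ?d1 = "h1 (awlast 1 w) - path_exp n 1 (\<lambda>w. h1 (awlast 1 w))"
        let ?d2 = "h2 (awlast 1 w) - path_exp n 1 (\<lambda>w. h2 (awlast 1 w))"
        have "(s * scaled k1 n w + t * scaled k2 n w) - output_sum ?g w / sqrt (real n) =
          - (s * ?d1 + t * ?d2) / sqrt (real n)"
          unfolding scaled_def output_sum_deviation[OF c(1) w] output_sum_deviation[OF c(2) w] output_sum_linear
          by (simp add: add_divide_distrib diff_divide_distrib algebra_simps)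
        then have "\<bar>(s * scaled k1 n w + t * scaled k2 n w) - output_sum ?g w / sqrt (real n)\<bar> =
          \<bar>s * ?d1 + t * ?d2\<bar> / sqrt (real n)" by (simp only: abs_divide abs_minus_cancel) simp
        also have "\<dots> \<le> ?B / sqrt (real n)"
        proof (rule divide_right_mono)
          have "\<bar>s * ?d1\<bar> \<le> \<bar>s\<bar> * (2 * H1)" unfolding abs_mult
            using end_deviation_bound[OF H1(2) w] by (intro mult_left_mono) auto
          moreover have "\<bar>t * ?d2\<bar> \<le> \<bar>t\<bar> * (2 * H2)" unfolding abs_mult
            using end_deviation_bound[OF H2(2) w] by (intro mult_left_mono) auto
          ultimately show "\<bar>s * ?d1 + t * ?d2\<bar> \<le> ?B" by linarith
        qed simp
        finally show "norm (iexp (s * scaled k1 n w + t * scaled k2 n w) - iexp (output_sum ?g w / sqrt (real n)))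
          \<le> ?B / sqrt (real n)" using norm_iexp_diff_le order_trans by blast
      qed
      then show "norm (?f n - ?l n) \<le> ?B / sqrt (real n)" unfolding path_exp_diff .
    qed
  qed
  from tendsto_add[OF this characteristic_limit[OF centered_linear[OF c, of s t] initial]]
  show ?thesis unfolding var by simp
qed

end

section \<open>Gaussian product laws in the plane\<close>

lemma
  assumes "real_distribution \<mu>" "real_distribution \<nu>"
  shows prob_space_pair_real_distribution: "prob_space (\<mu> \<Otimes>\<^sub>M \<nu>)"
    and sets_pair_real_distribution: "sets (\<mu> \<Otimes>\<^sub>M \<nu>) = sets (borel :: (real \<times> real) measure)"
proof -
  interpret \<mu>: real_distribution \<mu> by fact
  interpret \<nu>: real_distribution \<nu> by fact
  interpret pair_prob_space \<mu> \<nu> ..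
  show "prob_space (\<mu> \<Otimes>\<^sub>M \<nu>)" by (rule prob_space_axioms)
  show "sets (\<mu> \<Otimes>\<^sub>M \<nu>) = sets (borel :: (real \<times> real) measure)"
    unfolding borel_prod[symmetric] by (rule sets_pair_measure_cong) auto
qed

text \<open>As the image of the standard normal law under scaling, it covers variance 0, where it is
  the Dirac measure at 0.\<close>

definition gaussian :: "real \<Rightarrow> real measure" where
  "gaussian v = distr std_normal_distribution borel (\<lambda>x. sqrt v * x)"

lemma real_distribution_gaussian: "real_distribution (gaussian v)"
proof -
  interpret N: real_distribution std_normal_distribution by (rule real_dist_normal_dist)
  show ?thesis unfolding gaussian_def by (rule N.real_distribution_distr) simp
qed

lemma char_gaussian: "0 \<le> v \<Longrightarrow> char (gaussian v) t = complex_of_real (exp (- (t\<^sup>2 * v) / 2))"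
proof -
  assume v: "0 \<le> v"
  have "char (gaussian v) t = char std_normal_distribution (t * sqrt v)"
    unfolding gaussian_def char_def by (subst integral_distr) (auto simp: mult.assoc)
  then show ?thesis using v by (simp add: char_std_normal_distribution power_mult_distrib)
qed

lemma integrable_gaussian_square: "integrable (gaussian v) (\<lambda>x. x\<^sup>2)"
  unfolding gaussian_def
  by (subst integrable_distr_eq)
     (auto simp: power_mult_distrib intro!: integrable_mult_right integrable_std_normal_distribution_moment)

lemma integrable_pair_fst_square:
  assumes "real_distribution \<mu>" "real_distribution \<nu>" "integrable \<mu> (\<lambda>x. x\<^sup>2)"
  shows "integrable (\<mu> \<Otimes>\<^sub>M \<nu>) (\<lambda>z. (fst z)\<^sup>2)"
proof -
  interpret \<mu>: real_distribution \<mu> by fact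
  interpret \<nu>: real_distribution \<nu> by fact
  have "integrable (distr (\<mu> \<Otimes>\<^sub>M \<nu>) \<mu> fst) (\<lambda>x. x\<^sup>2)"
    using assms(3) by (subst \<nu>.distr_pair_fst)
  then show ?thesis by (subst (asm) integrable_distr_eq) auto
qed

lemma integrable_pair_square:
  assumes "real_distribution \<mu>" "real_distribution \<nu>"
    and "integrable \<mu> (\<lambda>x. x\<^sup>2)" "integrable \<nu> (\<lambda>x. x\<^sup>2)"
  shows "integrable (\<mu> \<Otimes>\<^sub>M \<nu>) (\<lambda>z. (fst z)\<^sup>2 + (snd z)\<^sup>2)"
proof -
  interpret \<mu>: real_distribution \<mu> by fact
  interpret \<nu>: real_distribution \<nu> by fact
  interpret pair_sigma_finite \<nu> \<mu> ..
  have "integrable (\<mu> \<Otimes>\<^sub>M \<nu>) (\<lambda>z. (snd z)\<^sup>2)"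
    using integrable_product_swap[OF integrable_pair_fst_square[OF assms(2,1,4)]]
    by (simp add: case_prod_unfold)
  then show ?thesis using integrable_pair_fst_square[OF assms(1-3)] by simp
qed

section \<open>Limit law of the rescaled pair\<close>

context ergodic_chain
begin

definition scaled_law :: "('e \<Rightarrow> real) \<Rightarrow> ('e \<Rightarrow> real) \<Rightarrow> nat \<Rightarrow> (real \<times> real) measure" where
  "scaled_law k1 k2 n = distr (path_measure G p n) borel (\<lambda>w. (scaled k1 n w, scaled k2 n w))"

lemma prob_space_scaled_law: "prob_space (scaled_law k1 k2 n)"
  unfolding scaled_law_def
  by (rule prob_space.prob_space_distr[OF prob_space_path_measure measurable_path_measure])

lemma sets_scaled_law: "sets (scaled_law k1 k2 n) = sets borel"
  unfolding scaled_law_def by simp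

lemma char2_scaled_law_limit:
  "(\<lambda>n. char2 (scaled_law k1 k2 n) s t) \<longlonglongrightarrow>
    complex_of_real (exp (- (s\<^sup>2 * acov k1 k1 + 2 * s * t * acov k1 k2 + t\<^sup>2 * acov k2 k2) / 2))"
proof -
  have "char2 (scaled_law k1 k2 n) s t = path_exp n 1 (\<lambda>w. iexp (s * scaled k1 n w + t * scaled k2 n w))" for n
    unfolding char2_def scaled_law_def
  proof (subst integral_distr[OF measurable_path_measure])
    show "(\<lambda>z. iexp (s * fst z + t * snd z)) \<in> borel_measurable borel"
      by (intro borel_measurable_continuous_onI continuous_intros)
  qed (simp add: integral_path_measure)
  then show ?thesis using scaled_characteristic_limit by simp
qed

text \<open>Provides the uniform tail control for \<open>weak_conv_2d_if_char2\<close>.\<close>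

lemma scaled_second_moment:
  obtains C where "\<And>n. path_exp n 1 (\<lambda>w. (scaled k n w)\<^sup>2) \<le> C"
proof -
  obtain B where B: "\<And>n. \<bar>path_exp n 1 (\<lambda>w. (output_sum k w - path_exp n 1 (output_sum k)) * (output_sum k w - path_exp n 1 (output_sum k)))
    - acov k k * real n\<bar> \<le> B" by (rule covariance_bounded[of k k], rule that)
  have B0: "0 \<le> B" using order_trans[OF abs_ge_zero B[of 0]] .
  show ?thesis
  proof (rule that[of "acov k k + B"])
    fix n
    let ?V = "path_exp n 1 (\<lambda>w. (output_sum k w - path_exp n 1 (output_sum k)) * (output_sum k w - path_exp n 1 (output_sum k)))"
    have "path_exp n 1 (\<lambda>w. (scaled k n w)\<^sup>2) = path_exp n 1 (\<lambda>w. (1 / real n) *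
        ((output_sum k w - path_exp n 1 (output_sum k)) * (output_sum k w - path_exp n 1 (output_sum k))))"
      by (rule path_exp_cong) (simp add: scaled_def power_divide power2_eq_square)
    then have eq: "path_exp n 1 (\<lambda>w. (scaled k n w)\<^sup>2) = ?V / real n" unfolding path_exp_cmult by simp
    show "path_exp n 1 (\<lambda>w. (scaled k n w)\<^sup>2) \<le> acov k k + B"
    proof (cases "n = 0")
      \<comment> \<open>Division by 0 gives 0, so the rescaled moment vanishes here.\<close>
      case True
      then show ?thesis unfolding eq using B0 acov_nonneg[of k] by simp
    next
      case False
      have "?V \<le> acov k k * real n + B" using B[of n] by linarith
      also have "\<dots> \<le> (acov k k + B) * real n" using False B0 mult_left_mono[of 1 "real n" B] by (simp add: algebra_simps)
      finally show ?thesis unfolding eq using False by (simp add: divide_le_eq)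
    qed
  qed
qed

lemma scaled_law_weak_conv:
  assumes "acov k1 k2 = 0"
  shows "weak_conv_2d (scaled_law k1 k2) (gaussian (acov k1 k1) \<Otimes>\<^sub>M gaussian (acov k2 k2))"
proof -
  let ?\<mu> = "gaussian (acov k1 k1)" and ?\<nu> = "gaussian (acov k2 k2)"
  let ?L = "?\<mu> \<Otimes>\<^sub>M ?\<nu>"
  let ?w = "\<lambda>z :: real \<times> real. (fst z)\<^sup>2 + (snd z)\<^sup>2"
  note rd = real_distribution_gaussian[of "acov k1 k1"] real_distribution_gaussian[of "acov k2 k2"]
  obtain C1 where C1: "\<And>n. path_exp n 1 (\<lambda>w. (scaled k1 n w)\<^sup>2) \<le> C1" by (rule scaled_second_moment, rule that)
  obtain C2 where C2: "\<And>n. path_exp n 1 (\<lambda>w. (scaled k2 n w)\<^sup>2) \<le> C2" by (rule scaled_second_moment, rule that)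
  have meas: "?w \<in> borel_measurable borel"
    by (intro borel_measurable_continuous_onI continuous_intros)
  show ?thesis
  \<comment> \<open>One constant has to bound the second moments of all approximating laws and of
    the limit.\<close>
  proof (rule weak_conv_2d_if_char2[where C = "max (C1 + C2) (LINT z|?L. ?w z)"])
    show "prob_space (scaled_law k1 k2 n)" "sets (scaled_law k1 k2 n) = sets borel" for n
      by (rule prob_space_scaled_law sets_scaled_law)+
    show "prob_space ?L" "sets ?L = sets borel"
      using prob_space_pair_real_distribution[OF rd] sets_pair_real_distribution[OF rd] .
    show "(\<lambda>n. char2 (scaled_law k1 k2 n) s t) \<longlonglongrightarrow> char2 ?L s t" for s t
    proof -
      have "char2 ?L s t = complex_of_real (exp (- (s\<^sup>2 * acov k1 k1) / 2)) * complex_of_real (exp (- (t\<^sup>2 * acov k2 k2) / 2))"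
        unfolding char2_pair_measure[OF rd] char_gaussian[OF acov_nonneg] ..
      also have "\<dots> = complex_of_real (exp (- (s\<^sup>2 * acov k1 k1 + 2 * s * t * acov k1 k2 + t\<^sup>2 * acov k2 k2) / 2))"
        unfolding of_real_mult[symmetric] exp_add[symmetric] assms
        by (simp add: add_divide_distrib diff_divide_distrib)
      finally show ?thesis using char2_scaled_law_limit by simp
    qed
    show "integrable (scaled_law k1 k2 n) ?w" for n
      unfolding scaled_law_def
      by (subst integrable_distr_eq[OF measurable_path_measure meas]) (rule integrable_path_measure)
    show "(LINT z|scaled_law k1 k2 n. ?w z) \<le> max (C1 + C2) (LINT z|?L. ?w z)" for n
    proof -
      have "(LINT z|scaled_law k1 k2 n. ?w z) = path_exp n 1 (\<lambda>w. (scaled k1 n w)\<^sup>2 + (scaled k2 n w)\<^sup>2)"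
        unfolding scaled_law_def
        by (subst integral_distr[OF measurable_path_measure meas]) (simp add: integral_path_measure)
      also have "\<dots> \<le> C1 + C2" unfolding path_exp_add by (intro add_mono C1 C2)
      finally show ?thesis by simp
    qed
    show "integrable ?L ?w" by (rule integrable_pair_square[OF rd integrable_gaussian_square integrable_gaussian_square])
  qed simp
qed

text \<open>The factors may be arbitrary laws. The limit at \<open>(1, 0)\<close> and
  \<open>(0, 1)\<close> gives their characteristic functions at 1, and comparing the product with
  the limit at \<open>(1, 1)\<close> leaves only the mixed term, which must vanish.\<close>

lemma weak_conv_product_imp_acov_0:
  assumes \<mu>: "real_distribution \<mu>" and \<nu>: "real_distribution \<nu>"
    and conv: "weak_conv_2d (scaled_law k1 k2) (\<mu> \<Otimes>\<^sub>M \<nu>)"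
  shows "acov k1 k2 = 0"
proof -
  interpret \<mu>: real_distribution \<mu> by (rule \<mu>)
  interpret \<nu>: real_distribution \<nu> by (rule \<nu>)
  have lim: "char \<mu> s * char \<nu> t =
    complex_of_real (exp (- (s\<^sup>2 * acov k1 k1 + 2 * s * t * acov k1 k2 + t\<^sup>2 * acov k2 k2) / 2))" for s t
  proof -
    have "(\<lambda>n. char2 (scaled_law k1 k2 n) s t) \<longlonglongrightarrow> char2 (\<mu> \<Otimes>\<^sub>M \<nu>) s t"
      by (rule char2_tendsto_if_weak_conv_2d[OF prob_space_scaled_law sets_scaled_law
            prob_space_pair_real_distribution[OF \<mu> \<nu>] sets_pair_real_distribution[OF \<mu> \<nu>] conv])
    from LIMSEQ_unique[OF this char2_scaled_law_limit] show ?thesis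
      unfolding char2_pair_measure[OF \<mu> \<nu>] .
  qed
  have 1: "char \<mu> 1 = complex_of_real (exp (- acov k1 k1 / 2))" using lim[of 1 0] by (simp add: \<nu>.char_zero)
  have 2: "char \<nu> 1 = complex_of_real (exp (- acov k2 k2 / 2))" using lim[of 0 1] by (simp add: \<mu>.char_zero)
  have "exp (- acov k1 k1 / 2) * exp (- acov k2 k2 / 2) = exp (- (acov k1 k1 + 2 * acov k1 k2 + acov k2 k2) / 2)"
    using lim[of 1 1] unfolding 1 2 of_real_mult[symmetric] of_real_eq_iff by simp
  then have "- acov k1 k1 / 2 + - acov k2 k2 / 2 = - (acov k1 k1 + 2 * acov k1 k2 + acov k2 k2) / 2"
    unfolding exp_add[symmetric] by (simp only: exp_inj_iff)
  then show ?thesis by simp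
qed

lemma asymptotically_independent_iff:
  "asymptotically_independent (path_measure G p) (\<lambda>_. output_sum k1) (\<lambda>_. output_sum k2) \<longleftrightarrow> acov k1 k2 = 0"
proof -
  have law: "(\<lambda>n. distr (path_measure G p n) borel
      (\<lambda>\<omega>. ((output_sum k1 \<omega> - prob_space.expectation (path_measure G p n) (output_sum k1)) / sqrt (real n),
            (output_sum k2 \<omega> - prob_space.expectation (path_measure G p n) (output_sum k2)) / sqrt (real n)))) =
    scaled_law k1 k2"
    unfolding scaled_law_def scaled_def integral_path_measure ..
  show ?thesis unfolding asymptotically_independent_def law
    using scaled_law_weak_conv weak_conv_product_imp_acov_0 real_distribution_gaussian by blast
qed

end

theorem theorem3p6:
  fixes G :: "(nat, 'e) pre_digraph" and M :: nat and p :: "'e \<Rightarrow> real"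
    and k1 k2 :: "'e \<Rightarrow> real"
  assumes "finite_markov_chain G M p"
    and "finally_connected G"
    and "finally_aperiodic G"
  shows "let
      F = final_component G;
      P = path_measure G p;
      one = (\<lambda>_. 1);
      e = (\<lambda>k. D1_sum F p k / D1_sum F p one);
      dev = (\<lambda>k a. k a - e k * one a);
      v = (\<lambda>k. 1 / D1_sum F p one *
             (D1_pair F p (dev k) (dev k) - D2_pair F p (dev k) (dev k)));
      c = 1 / D1_sum F p one *
             (D1_pair F p (dev k1) (dev k2) - D2_pair F p (dev k1) (dev k2))
    in
      (\<forall>k\<in>{k1, k2}.
        (\<lambda>n. prob_space.expectation (P n) (output_sum k) - e k * real n) \<in> O(\<lambda>_. 1) \<and>
        (\<lambda>n. prob_space.variance (P n) (output_sum k) - v k * real n) \<in> O(\<lambda>_. 1)) \<and>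
      (\<lambda>n. covariance (P n) (output_sum k1) (output_sum k2) - c * real n) \<in> O(\<lambda>_. 1) \<and>
      (asymptotically_independent P (\<lambda>_. output_sum k1) (\<lambda>_. output_sum k2) \<longleftrightarrow>
        D1_pair F p (dev k1) (dev k2) = D2_pair F p (dev k1) (dev k2))"
proof -
  interpret ergodic_chain G M p
    by (intro ergodic_chain.intro ergodic_chain_axioms.intro) fact+
  let ?E = "\<lambda>n. prob_space.expectation (path_measure G p n)"
  have bdd: "f \<in> O(\<lambda>_. 1)" if "\<And>n. \<bar>f n\<bar> \<le> B" for f :: "nat \<Rightarrow> real" and B
    by (rule bigoI[of _ B]) (use that in auto)
  have expectation: "(\<lambda>n. ?E n (output_sum k) - mean k * real n) \<in> O(\<lambda>_. 1)" for k
  proof -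
    obtain B where "\<And>n x. x \<in> verts G \<Longrightarrow> \<bar>path_exp n x (output_sum k) - mean k * real n\<bar> \<le> B"
      by (rule path_exp_output_sum_bounded, rule that)
    then show ?thesis unfolding integral_path_measure by (intro bdd[of _ B]) (use initial in blast)
  qed
  have cov: "(\<lambda>n. covariance (path_measure G p n) (output_sum k) (output_sum k') - acov k k' * real n) \<in> O(\<lambda>_. 1)" for k k'
    unfolding covariance_def integral_path_measure by (rule covariance_bounded[of k k'], rule bdd)
  have var: "(\<lambda>n. prob_space.variance (path_measure G p n) (output_sum k) - acov k k * real n) \<in> O(\<lambda>_. 1)" for k
    using cov[of k k] unfolding covariance_def power2_eq_square .
  have indep: "acov k1 k2 = 0 \<longleftrightarrow>
      D1_pair F p (\<lambda>a. k1 a - mean k1) (\<lambda>a. k2 a - mean k2) = D2_pair F p (\<lambda>a. k1 a - mean k1) (\<lambda>a. k2 a - mean k2)"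
    unfolding acov_def using D1_sum_one_pos by simp
  show ?thesis
    \<comment> \<open>\<open>mult_1_right\<close> removes the constant function from the deviations,
      which then match \<open>acov\<close>.\<close>
    unfolding Let_def final_component_eq mult_1_right mean_def[symmetric] acov_def[symmetric]
    using expectation var cov asymptotically_independent_iff indep by blast
qed

end
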